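(* Let $A$ be an $\mathfrak h$-Hopf algebroid equipped with a $\ast$-structure, such that the antipode $S$ of $A$ is invertible. Then $$S\circ\ast\circ S\circ\ast=\mathrm{id}.$$
   Context: $\mathfrak h$ is a finite-dimensional complex commutative Lie algebra, $M_{\mathfrak h^*}$ is the field of meromorphic functions on $\mathfrak h^*$, and $T_\alpha f(\lambda)=f(\lambda+\alpha)$. An $\mathfrak h$-algebra is a complex associative unital algebra $A=\bigoplus_{\alpha,\beta\in\mathfrak h^*}A_{\alpha\beta}$, bigraded, with two algebra embeddings $\mu_l,\mu_r:M_{\mathfrak h^*}\to A_{00}$ such that $\mu_l(f)a=a\,\mu_l(T_\alpha f)$, $\mu_r(f)a=a\,\mu_r(T_\beta f)$ for $a\in A_{\alpha\beta}$. Homomorphisms preserve the moment maps and the bigrading. The matrix tensor product $A\widetilde\otimes B$ has $(A\widetilde\otimes B)_{\alpha\beta}=\bigoplus_\gamma A_{\alpha\gamma}\otimes_{M_{\mathfrak h^*}}B_{\gamma\beta}$, the tensor product being modulo $\mu_r^A(f)a\otimes b=a\otimes\mu_l^B(f)b$, with factorwise multiplication and moment maps $\mu_l^A(f)\otimes1$, $1\otimes\mu_r^B(f)$. $D_{\mathfrak h}$ is the $\mathfrak h$-algebra of difference operators $\sum_if_iT_{\beta_i}$ on $M_{\mathfrak h^*}$, with $fT_{-\beta}\in(D_{\mathfrak h})_{\beta\beta}$ and both moment maps the natural embedding; $A\simeq A\widetilde\otimes D_{\mathfrak h}\simeq D_{\mathfrak h}\widetilde\otimes A$ via $x\simeq x\otimes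 T_{-\beta}\simeq T_{-\alpha}\otimes x$, $x\in A_{\alpha\beta}$. An $\mathfrak h$-bialgebroid is an $\mathfrak h$-algebra with $\mathfrak h$-algebra homomorphisms $\Delta:A\to A\widetilde\otimes A$, $\varepsilon:A\to D_{\mathfrak h}$ with $(\Delta\otimes\mathrm{id})\Delta=(\mathrm{id}\otimes\Delta)\Delta$ and $(\varepsilon\otimes\mathrm{id})\Delta=(\mathrm{id}\otimes\varepsilon)\Delta=\mathrm{id}$ (under the canonical isomorphisms). An $\mathfrak h$-Hopf algebroid is an $\mathfrak h$-bialgebroid with a $\mathbb C$-linear map $S:A\to A$ (antipode) such that $S(\mu_r(f)a)=S(a)\mu_l(f)$, $S(a\mu_l(f))=\mu_r(f)S(a)$, $m(\mathrm{id}\otimes S)\Delta(a)=\mu_l(\varepsilon(a)1)$ for all $a\in A$, and $m(S\otimes\mathrm{id})\Delta(a)=\mu_r(T_\alpha(\varepsilon(a)1))$ for $a\in A_{\alpha\beta}$, where $m$ is multiplication and $\varepsilon(a)1$ is the operator $\varepsilon(a)$ applied to the constant function $1$. $\ast$-structures: a conjugation $\lambda\mapsto\bar\lambda$ (equivalently a real form) is fixed on $\mathfrak h^*$; for $f\in M_{\mathfrak h^*}$ put $\bar f(\lambda)=\overline{f(\bar\lambda)}$. A $\ast$-structure on an $\mathfrak h$-algebra $A$ is a $\mathbb C$-antilinear, antimultiplicative involution $a\mapsto a^*$ with $\mu_l(f)^*=\mu_l(\bar f)$, $\mu_r(f)^*=\mu_r(\bar f)$. A $\ast$-structure on an $\mathfrak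 h$-bialgebroid (in particular on an $\mathfrak h$-Hopf algebroid) is in addition required to satisfy $(\ast\otimes\ast)\circ\Delta=\Delta\circ\ast$ and $\varepsilon\circ\ast=\ast^{D_{\mathfrak h}}\circ\varepsilon$, where $\ast^{D_{\mathfrak h}}$ is defined by $(fT_\alpha)^*=T_{-\bar\alpha}\circ\bar f=(T_{-\bar\alpha}\bar f)T_{-\bar\alpha}$. *)

theory Defs
  imports "HOL-Analysis.Analysis" "HOL-Algebra.Free_Abelian_Groups" "HOL-Algebra.Module"
begin

section \<open>Finite-dimensional complex vector spaces with a conjugation\<close>

text \<open>
  The Lie algebra enters only through its dual space, an arbitrary finite-dimensional
  (possibly zero) complex vector space with a fixed conjugation; this is the type \<open>'v\<close> below.
  The norm only serves to speak about the topology and derivatives; in finite dimension nothing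
  depends on its choice, and no compatibility with \<open>scaleC\<close> or \<open>conjV\<close> beyond real scalars is asked.
\<close>

class complex_fd_space = real_normed_vector +
  fixes scaleC :: "complex \<Rightarrow> 'a \<Rightarrow> 'a"  (infixr \<open>*\<^sub>C\<close> 75)
  assumes scaleC_add_right: "c *\<^sub>C (x + y) = c *\<^sub>C x + c *\<^sub>C y"
    and scaleC_add_left: "(c + d) *\<^sub>C x = c *\<^sub>C x + d *\<^sub>C x"
    and scaleC_scaleC: "c *\<^sub>C d *\<^sub>C x = (c * d) *\<^sub>C x"
    and scaleC_of_real: "complex_of_real r *\<^sub>C x = r *\<^sub>R x"
    and finite_dim: "\<exists>B. finite B \<and> (\<forall>x. \<exists>c. x = (\<Sum>b\<in>B. c b *\<^sub>C b))"

class complex_fd_space_conj = complex_fd_space +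
  fixes conjV :: "'a \<Rightarrow> 'a"
  assumes conjV_add: "conjV (x + y) = conjV x + conjV y"
    and conjV_scaleC: "conjV (c *\<^sub>C x) = cnj c *\<^sub>C conjV x"
    and conjV_conjV: "conjV (conjV x) = x"

lemma independent_coords_bounded:
  fixes B :: "'a::real_normed_vector set"
  assumes "finite B" "independent B"
  shows "\<exists>K>0. \<forall>a. \<forall>b\<in>B. \<bar>a b\<bar> \<le> K * norm (\<Sum>b\<in>B. a b *\<^sub>R b)"
  using assms
proof (induction B rule: finite_induct)
  case empty
  then show ?case by (auto intro: exI[of _ 1])
next
  case (insert x B)
  then have indB: "independent B" and xB: "x \<notin> span B"
    by (auto simp: independent_insert)
  obtain K where K: "K > 0" "\<And>a b. b \<in> B \<Longrightarrow> \<bar>a b\<bar> \<le> K * norm (\<Sum>b\<in>B. a b *\<^sub>R b)"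
    using insert.IH[OF indB] by blast
  have "\<exists>d>0. \<forall>v\<in>span B. d \<le> norm (x - v)"
  proof (rule ccontr)
    assume "\<not> ?thesis"
    then have "\<forall>n. \<exists>v\<in>span B. norm (x - v) < inverse (real (Suc n))"
      by (metis not_le positive_imp_inverse_positive of_nat_0_less_iff zero_less_Suc)
    then obtain v where v: "\<And>n. v n \<in> span B" "\<And>n. norm (x - v n) < inverse (real (Suc n))"
      by metis
    have "\<forall>n. \<exists>a. v n = (\<Sum>b\<in>B. a b *\<^sub>R b)"
      using v(1) span_finite[OF insert.hyps(1)] by auto
    then obtain a where a: "\<And>n. v n = (\<Sum>b\<in>B. a n b *\<^sub>R b)" by metis
    have "(\<lambda>n. x - v n) \<longlonglongrightarrow> 0"
      using v(2) by (intro Lim_null_comparison[OF _ LIMSEQ_inverse_real_of_nat] always_eventually)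
        (auto intro: less_imp_le)
    then have "(\<lambda>n. x - (x - v n)) \<longlonglongrightarrow> x - 0" by (intro tendsto_intros)
    then have lim: "v \<longlonglongrightarrow> x" by simp
    then have Cv: "Cauchy v" by (rule LIMSEQ_imp_Cauchy)
    have Ca: "Cauchy (\<lambda>n. a n b)" if b: "b \<in> B" for b
    proof (rule metric_CauchyI)
      fix e :: real assume "e > 0"
      then have "e / K > 0" using K by simp
      then obtain M where M: "\<And>m n. m \<ge> M \<Longrightarrow> n \<ge> M \<Longrightarrow> dist (v m) (v n) < e / K"
        using Cv unfolding Cauchy_def by blast
      have "dist (a m b) (a n b) < e" if "m \<ge> M" "n \<ge> M" for m n
      proof -
        have "\<bar>a m b - a n b\<bar> \<le> K * norm (\<Sum>b\<in>B. (a m b - a n b) *\<^sub>R b)"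
          using K(2)[OF b, of "\<lambda>b. a m b - a n b"] by simp
        also have "(\<Sum>b\<in>B. (a m b - a n b) *\<^sub>R b) = v m - v n"
          by (simp add: a scaleR_left_diff_distrib sum_subtractf)
        also have "K * norm (v m - v n) < e"
          using M[OF that] K(1) by (simp add: dist_norm field_simps)
        finally show ?thesis by (simp add: dist_real_def)
      qed
      then show "\<exists>M. \<forall>m\<ge>M. \<forall>n\<ge>M. dist (a m b) (a n b) < e" by blast
    qed
    then have "\<forall>b\<in>B. \<exists>l. (\<lambda>n. a n b) \<longlonglongrightarrow> l"
      using Cauchy_convergent_iff convergent_def by blast
    then obtain l where l: "\<And>b. b \<in> B \<Longrightarrow> (\<lambda>n. a n b) \<longlonglongrightarrow> l b" by metis
    have "(\<lambda>n. \<Sum>b\<in>B. a n b *\<^sub>R b) \<longlonglongrightarrow> (\<Sum>b\<in>B. l b *\<^sub>R b)"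
      by (intro tendsto_intros l)
    then have "x = (\<Sum>b\<in>B. l b *\<^sub>R b)"
      using lim LIMSEQ_unique a by (metis (no_types, lifting) ext)
    then show False using xB by (simp add: span_sum span_base span_scale)
  qed
  then obtain d where d: "d > 0" "\<And>v. v \<in> span B \<Longrightarrow> d \<le> norm (x - v)" by blast
  have x_bd: "\<bar>a x\<bar> * d \<le> norm (a x *\<^sub>R x + w)" if "w \<in> span B" for a :: "'a \<Rightarrow> real" and w
  proof (cases "a x = 0")
    case False
    have "d \<le> norm (x - (- (1 / a x)) *\<^sub>R w)"
      by (intro d(2) span_scale that)
    then have "\<bar>a x\<bar> * d \<le> \<bar>a x\<bar> * norm (x - (- (1 / a x)) *\<^sub>R w)"
      by (intro mult_left_mono) auto
    also have "\<dots> = norm (a x *\<^sub>R (x - (- (1 / a x)) *\<^sub>R w))" by simp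
    also have "a x *\<^sub>R (x - (- (1 / a x)) *\<^sub>R w) = a x *\<^sub>R x + w"
      using False by (simp add: scaleR_right_diff_distrib scaleR_add_right)
    finally show ?thesis .
  qed simp
  define K' where "K' = max (1 / d) (K * (1 + norm x / d))"
  have K'0: "K' > 0" using d by (simp add: K'_def less_max_iff_disj)
  have "\<bar>a b\<bar> \<le> K' * norm (\<Sum>b\<in>insert x B. a b *\<^sub>R b)" if b: "b \<in> insert x B" for a b
  proof -
    define w where "w = (\<Sum>b\<in>B. a b *\<^sub>R b)"
    define s where "s = a x *\<^sub>R x + w"
    have s: "(\<Sum>b\<in>insert x B. a b *\<^sub>R b) = s" using insert.hyps by (simp add: s_def w_def)
    have "w \<in> span B" unfolding w_def by (intro span_sum span_scale span_base)
    from x_bd[OF this, of a] have ax: "\<bar>a x\<bar> \<le> norm s / d"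
      using d(1) by (simp add: s_def field_simps)
    show ?thesis
    proof (cases "b = x")
      case True
      have "norm s / d \<le> K' * norm s"
        using mult_right_mono[of "1 / d" K' "norm s"] by (simp add: K'_def)
      with ax True s show ?thesis by simp
    next
      case False
      then have "b \<in> B" using b by simp
      then have "\<bar>a b\<bar> \<le> K * norm w" using K(2)[of b a] by (simp add: w_def)
      also have "w = s - a x *\<^sub>R x" by (simp add: s_def)
      also have "norm (s - a x *\<^sub>R x) \<le> norm s + \<bar>a x\<bar> * norm x"
        using norm_triangle_ineq4[of s "a x *\<^sub>R x"] by simp
      also have "\<dots> \<le> norm s + norm s / d * norm x"
        using ax by (intro add_left_mono mult_right_mono) auto
      also have "K * (norm s + norm s / d * norm x) = K * (1 + norm x / d) * norm s"
        by (simp add: algebra_simps)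
      also have "\<dots> \<le> K' * norm s"
        by (intro mult_right_mono) (auto simp: K'_def)
      finally show ?thesis using K(1) s by simp
    qed
  qed
  then show ?case using K'0 by blast
qed

text \<open>Real-linear maps on a finite-dimensional complex space are continuous.\<close>

lemma bounded_linear_fd:
  fixes T :: "'a::complex_fd_space \<Rightarrow> 'b::real_normed_vector"
  assumes "linear T"
  shows "bounded_linear T"
proof -
  interpret T: linear T by fact
  obtain B :: "'a set" where B: "finite B" "\<And>x. \<exists>c. x = (\<Sum>b\<in>B. c b *\<^sub>C b)"
    using finite_dim by blast
  define C where "C = B \<union> scaleC \<i> ` B"
  have fC: "finite C" using B by (simp add: C_def)
  have spanC: "span C = UNIV"
  proof -
    have "x \<in> span C" for x
    proof -
      obtain c where c: "x = (\<Sum>b\<in>B. c b *\<^sub>C b)" using B by blast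
      have "c b *\<^sub>C b = Re (c b) *\<^sub>R b + Im (c b) *\<^sub>R (\<i> *\<^sub>C b)" for b
      proof -
        have "c b *\<^sub>C b = (complex_of_real (Re (c b)) + complex_of_real (Im (c b)) * \<i>) *\<^sub>C b"
          by (metis complex_eq mult.commute)
        also have "\<dots> = Re (c b) *\<^sub>R b + Im (c b) *\<^sub>R (\<i> *\<^sub>C b)"
          by (simp only: scaleC_add_left scaleC_scaleC[symmetric] scaleC_of_real)
        finally show ?thesis .
      qed
      then have "c b *\<^sub>C b \<in> span C" if "b \<in> B" for b
        using that by (auto simp: C_def intro!: span_add span_scale intro: span_base)
      then show ?thesis unfolding c by (intro span_sum)
    qed
    then show ?thesis by blast
  qed
  obtain E where E: "E \<subseteq> C" "independent E" "C \<subseteq> span E"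
    using maximal_independent_subset by blast
  have fE: "finite E" using E fC finite_subset by blast
  have spanE: "span E = UNIV"
    using E(3) spanC by (metis span_mono span_span top.extremum_uniqueI)
  obtain K where K: "K > 0" "\<And>a b. b \<in> E \<Longrightarrow> \<bar>a b\<bar> \<le> K * norm (\<Sum>b\<in>E. a b *\<^sub>R b)"
    using independent_coords_bounded[OF fE E(2)] by blast
  show ?thesis
  proof (rule bounded_linear_intro[where K = "\<Sum>b\<in>E. K * norm (T b)"])
    fix x
    obtain a where a: "x = (\<Sum>b\<in>E. a b *\<^sub>R b)"
      using spanE span_finite[OF fE] by (metis (mono_tags, lifting) UNIV_I imageE)
    have "norm (T x) \<le> (\<Sum>b\<in>E. norm (a b *\<^sub>R T b))"
      unfolding a by (simp add: T.sum T.scale norm_sum del: norm_scaleR)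
    also have "\<dots> \<le> (\<Sum>b\<in>E. K * norm x * norm (T b))"
      using K(2)[of _ a] by (intro sum_mono) (auto simp: a intro!: mult_right_mono)
    also have "\<dots> = norm x * (\<Sum>b\<in>E. K * norm (T b))"
      by (simp add: sum_distrib_left algebra_simps)
    finally show "norm (T x) \<le> norm x * (\<Sum>b\<in>E. K * norm (T b))" .
  qed (simp_all add: T.add T.scale)
qed

lemma bounded_linear_conjV: "bounded_linear (conjV :: 'v::complex_fd_space_conj \<Rightarrow> 'v)"
proof (rule bounded_linear_fd, rule linearI)
  fix r and x :: 'v
  show "conjV (r *\<^sub>R x) = r *\<^sub>R conjV x"
    by (metis complex_cnj_complex_of_real conjV_scaleC scaleC_of_real)
qed (rule conjV_add)


section \<open>Meromorphic functions\<close>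

definition holo_on :: "'v::complex_fd_space set \<Rightarrow> ('v \<Rightarrow> complex) \<Rightarrow> bool" where
  "holo_on U g \<longleftrightarrow>
     (\<forall>x\<in>U. \<exists>L. (g has_derivative L) (at x) \<and> (\<forall>c v. L (c *\<^sub>C v) = c * L v))"

text \<open>
  A function is meromorphic if it is locally a quotient \<open>g / h\<close> of holomorphic functions, where \<open>h\<close>
  vanishes identically on no nonempty open set. Values at the zeros of the denominators are
  irrelevant: meromorphic functions that agree on a dense open set are identified.
\<close>

definition nonvanishing_on :: "'v::complex_fd_space set \<Rightarrow> ('v \<Rightarrow> complex) \<Rightarrow> bool" where
  "nonvanishing_on U h \<longleftrightarrow> (\<forall>W. open W \<and> W \<subseteq> U \<and> W \<noteq> {} \<longrightarrow> (\<exists>x\<in>W. h x \<noteq> 0))"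

definition meromorphic_fun :: "('v::complex_fd_space \<Rightarrow> complex) \<Rightarrow> bool" where
  "meromorphic_fun F \<longleftrightarrow>
     (\<forall>p. \<exists>U g h. open U \<and> p \<in> U \<and> holo_on U g \<and> holo_on U h \<and> nonvanishing_on U h \<and>
        (\<forall>x\<in>U. h x \<noteq> 0 \<longrightarrow> F x = g x / h x))"

definition generically_eq :: "('v::complex_fd_space \<Rightarrow> complex) \<Rightarrow> ('v \<Rightarrow> complex) \<Rightarrow> bool" where
  "generically_eq F G \<longleftrightarrow> (\<exists>D. open D \<and> closure D = UNIV \<and> (\<forall>x\<in>D. F x = G x))"

lemma dense_open_Int:
  fixes D E :: "'a::topological_space set"
  assumes "open D" "closure D = UNIV" "open E" "closure E = UNIV"
  shows "open (D \<inter> E)" "closure (D \<inter> E) = UNIV"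
proof -
  show "closure (D \<inter> E) = UNIV"
    using open_Int_closure_subset[OF assms(1), of E] assms
    by (metis Int_UNIV_right closure_closure closure_mono top.extremum_uniqueI)
qed (use assms in auto)

lemma generically_eq_refl: "generically_eq F F"
  unfolding generically_eq_def by (rule exI[of _ UNIV]) auto

lemma generically_eq_sym: "generically_eq F G \<Longrightarrow> generically_eq G F"
  unfolding generically_eq_def by metis

lemma generically_eq_map2:
  assumes "generically_eq F F'" "generically_eq G G'"
  shows "generically_eq (\<lambda>x. k (F x) (G x)) (\<lambda>x. k (F' x) (G' x))"
proof -
  obtain D E where "open D" "closure D = UNIV" "\<forall>x\<in>D. F x = F' x"
    "open E" "closure E = UNIV" "\<forall>x\<in>E. G x = G' x"
    using assms unfolding generically_eq_def by blast
  then show ?thesis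
    unfolding generically_eq_def
    by (intro exI[of _ "D \<inter> E"]) (simp add: dense_open_Int)
qed

lemma generically_eq_trans:
  assumes "generically_eq F G" "generically_eq G H"
  shows "generically_eq F H"
proof -
  obtain D E where "open D" "closure D = UNIV" "\<forall>x\<in>D. F x = G x"
    "open E" "closure E = UNIV" "\<forall>x\<in>E. G x = H x"
    using assms unfolding generically_eq_def by blast
  then show ?thesis
    unfolding generically_eq_def
    by (intro exI[of _ "D \<inter> E"]) (simp add: dense_open_Int)
qed

lemma dense_open_vimage:
  fixes \<sigma> :: "'v::complex_fd_space \<Rightarrow> 'v"
  assumes "open D" "closure D = UNIV" "continuous_on UNIV \<sigma>" "continuous_on UNIV \<tau>"
    "\<And>x. \<tau> (\<sigma> x) = x" "\<And>x. \<sigma> (\<tau> x) = x"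
  shows "open (\<sigma> -` D)" "closure (\<sigma> -` D) = UNIV"
proof -
  show op: "open (\<sigma> -` D)" using assms(1,3) by (rule open_vimage)
  have "x \<in> closure (\<sigma> -` D)" for x
  proof (unfold closure_iff_nhds_not_empty, intro allI impI)
    fix A W assume A: "W \<subseteq> A" "open W" "x \<in> W"
    have "open (\<tau> -` W)" using A(2) assms(4) by (rule open_vimage)
    moreover have "\<sigma> x \<in> \<tau> -` W" using A assms by simp
    moreover have "\<sigma> x \<in> closure D" using assms by simp
    ultimately obtain y where "y \<in> D" "y \<in> \<tau> -` W"
      unfolding closure_iff_nhds_not_empty by blast
    then have "\<tau> y \<in> (\<sigma> -` D) \<inter> A" using A assms by auto
    then show "\<sigma> -` D \<inter> A \<noteq> {}" by blast
  qed
  then show "closure (\<sigma> -` D) = UNIV" by blast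
qed

lemma holo_on_const: "holo_on U (\<lambda>_. c)"
  unfolding holo_on_def by (auto intro!: exI[of _ "\<lambda>_. 0"])

lemma holo_on_subset: "holo_on U g \<Longrightarrow> W \<subseteq> U \<Longrightarrow> holo_on W g"
  unfolding holo_on_def by blast

lemma holo_on_add: 
  assumes "holo_on U g" "holo_on U h" shows "holo_on U (\<lambda>x. g x + h x)"
  unfolding holo_on_def
proof
  fix x assume "x \<in> U"
  then obtain L M where "(g has_derivative L) (at x)" "\<forall>c v. L (c *\<^sub>C v) = c * L v"
    "(h has_derivative M) (at x)" "\<forall>c v. M (c *\<^sub>C v) = c * M v"
    using assms unfolding holo_on_def by blast
  then show "\<exists>L. ((\<lambda>x. g x + h x) has_derivative L) (at x) \<and> (\<forall>c v. L (c *\<^sub>C v) = c * L v)"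
    by (intro exI[of _ "\<lambda>v. L v + M v"]) (auto intro!: has_derivative_add simp: algebra_simps)
qed

lemma holo_on_mult:
  assumes "holo_on U g" "holo_on U h" shows "holo_on U (\<lambda>x. g x * h x)"
  unfolding holo_on_def
proof
  fix x assume "x \<in> U"
  then obtain L M where "(g has_derivative L) (at x)" "\<forall>c v. L (c *\<^sub>C v) = c * L v"
    "(h has_derivative M) (at x)" "\<forall>c v. M (c *\<^sub>C v) = c * M v"
    using assms unfolding holo_on_def by blast
  then show "\<exists>L. ((\<lambda>x. g x * h x) has_derivative L) (at x) \<and> (\<forall>c v. L (c *\<^sub>C v) = c * L v)"
    by (intro exI[of _ "\<lambda>v. g x * M v + L v * h x"])
      (auto dest: has_derivative_mult simp: algebra_simps)
qed

lemma holo_on_continuous: "holo_on U g \<Longrightarrow> continuous_on U g"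
  unfolding holo_on_def
  by (meson continuous_at_imp_continuous_on has_derivative_continuous)

lemma nonvanishing_on_mult:
  assumes "open U" "holo_on U h" "nonvanishing_on U h" "nonvanishing_on U k"
  shows "nonvanishing_on U (\<lambda>x. h x * k x)"
  unfolding nonvanishing_on_def
proof (intro allI impI)
  fix W assume W: "open W \<and> W \<subseteq> U \<and> W \<noteq> {}"
  define W' where "W' = W \<inter> h -` (- {0})"
  have "open W'"
    unfolding W'_def
    using W holo_on_continuous[OF assms(2)]
    by (intro continuous_open_preimage) (auto intro: continuous_on_subset)
  moreover have "W' \<noteq> {}" using assms(3) W unfolding nonvanishing_on_def W'_def by blast
  moreover have "W' \<subseteq> U" using W by (auto simp: W'_def)
  ultimately obtain x where "x \<in> W'" "k x \<noteq> 0"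
    using assms(4) unfolding nonvanishing_on_def by blast
  then show "\<exists>x\<in>W. h x * k x \<noteq> 0" unfolding W'_def by auto
qed

lemma nonvanishing_on_subset: "nonvanishing_on U h \<Longrightarrow> W \<subseteq> U \<Longrightarrow> nonvanishing_on W h"
  unfolding nonvanishing_on_def by blast

lemma meromorphic_fun_pair:
  assumes "meromorphic_fun F" "meromorphic_fun G"
  obtains U g h g' h' where "open U" "p \<in> U" "holo_on U g" "holo_on U h" "nonvanishing_on U h"
    "\<And>x. x \<in> U \<Longrightarrow> h x \<noteq> 0 \<Longrightarrow> F x = g x / h x" "holo_on U g'" "holo_on U h'"
    "nonvanishing_on U h'" "\<And>x. x \<in> U \<Longrightarrow> h' x \<noteq> 0 \<Longrightarrow> G x = g' x / h' x"
proof -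
  obtain U g h where 1: "open U" "p \<in> U" "holo_on U g" "holo_on U h" "nonvanishing_on U h"
    "\<And>x. x \<in> U \<Longrightarrow> h x \<noteq> 0 \<Longrightarrow> F x = g x / h x"
    using assms(1) unfolding meromorphic_fun_def by metis
  obtain U' g' h' where 2: "open U'" "p \<in> U'" "holo_on U' g'" "holo_on U' h'" "nonvanishing_on U' h'"
    "\<And>x. x \<in> U' \<Longrightarrow> h' x \<noteq> 0 \<Longrightarrow> G x = g' x / h' x"
    using assms(2) unfolding meromorphic_fun_def by metis
  show ?thesis
    by (rule that[of "U \<inter> U'" g h g' h'])
      (use 1 2 in \<open>auto intro: holo_on_subset nonvanishing_on_subset\<close>)
qed

lemma meromorphic_fun_const: "meromorphic_fun (\<lambda>_. c)"
  unfolding meromorphic_fun_def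
  by (intro allI exI[of _ UNIV] exI[of _ "\<lambda>_. c"] exI[of _ "\<lambda>_. 1"])
    (auto simp: holo_on_const nonvanishing_on_def)

lemma meromorphic_fun_add:
  assumes "meromorphic_fun F" "meromorphic_fun G"
  shows "meromorphic_fun (\<lambda>x. F x + G x)"
  unfolding meromorphic_fun_def
proof
  fix p
  obtain U g h g' h' where U: "open U" "p \<in> U" "holo_on U g" "holo_on U h" "nonvanishing_on U h"
    "\<And>x. x \<in> U \<Longrightarrow> h x \<noteq> 0 \<Longrightarrow> F x = g x / h x" "holo_on U g'" "holo_on U h'"
    "nonvanishing_on U h'" "\<And>x. x \<in> U \<Longrightarrow> h' x \<noteq> 0 \<Longrightarrow> G x = g' x / h' x"
    using meromorphic_fun_pair[OF assms, of p] by metis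
  show "\<exists>U g h. open U \<and> p \<in> U \<and> holo_on U g \<and> holo_on U h \<and> nonvanishing_on U h \<and>
        (\<forall>x\<in>U. h x \<noteq> 0 \<longrightarrow> F x + G x = g x / h x)"
    by (intro exI[of _ U] exI[of _ "\<lambda>x. g x * h' x + g' x * h x"] exI[of _ "\<lambda>x. h x * h' x"])
      (use U in \<open>auto intro!: holo_on_add holo_on_mult nonvanishing_on_mult simp: add_frac_eq\<close>)
qed

lemma meromorphic_fun_mult:
  assumes "meromorphic_fun F" "meromorphic_fun G"
  shows "meromorphic_fun (\<lambda>x. F x * G x)"
  unfolding meromorphic_fun_def
proof
  fix p
  obtain U g h g' h' where U: "open U" "p \<in> U" "holo_on U g" "holo_on U h" "nonvanishing_on U h"
    "\<And>x. x \<in> U \<Longrightarrow> h x \<noteq> 0 \<Longrightarrow> F x = g x / h x" "holo_on U g'" "holo_on U h'"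
    "nonvanishing_on U h'" "\<And>x. x \<in> U \<Longrightarrow> h' x \<noteq> 0 \<Longrightarrow> G x = g' x / h' x"
    using meromorphic_fun_pair[OF assms, of p] by metis
  show "\<exists>U g h. open U \<and> p \<in> U \<and> holo_on U g \<and> holo_on U h \<and> nonvanishing_on U h \<and>
        (\<forall>x\<in>U. h x \<noteq> 0 \<longrightarrow> F x * G x = g x / h x)"
    by (intro exI[of _ U] exI[of _ "\<lambda>x. g x * g' x"] exI[of _ "\<lambda>x. h x * h' x"])
      (use U in \<open>auto intro!: holo_on_mult nonvanishing_on_mult\<close>)
qed

lemma meromorphic_fun_uminus: "meromorphic_fun F \<Longrightarrow> meromorphic_fun (\<lambda>x. - F x)"
  using meromorphic_fun_mult[OF meromorphic_fun_const[of "-1"]] by simp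

lemma holo_on_shift:
  assumes "holo_on U g" shows "holo_on ((\<lambda>x. x + \<alpha>) -` U) (\<lambda>x. g (x + \<alpha>))"
  unfolding holo_on_def
proof
  fix x assume "x \<in> (\<lambda>x. x + \<alpha>) -` U"
  then obtain L where L: "(g has_derivative L) (at (x + \<alpha>))" "\<forall>c v. L (c *\<^sub>C v) = c * L v"
    using assms unfolding holo_on_def by auto
  have "((\<lambda>x. x + \<alpha>) has_derivative (\<lambda>v. v)) (at x)"
    by (auto intro!: derivative_eq_intros)
  from has_derivative_compose[OF this L(1)] L(2)
  show "\<exists>L. ((\<lambda>x. g (x + \<alpha>)) has_derivative L) (at x) \<and> (\<forall>c v. L (c *\<^sub>C v) = c * L v)"
    by blast
qed

lemma holo_on_conj:
  fixes g :: "'v::complex_fd_space_conj \<Rightarrow> complex"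
  assumes "holo_on U g" shows "holo_on (conjV -` U) (\<lambda>x. cnj (g (conjV x)))"
  unfolding holo_on_def
proof
  fix x :: 'v assume "x \<in> conjV -` U"
  then obtain L where L: "(g has_derivative L) (at (conjV x))" "\<forall>c v. L (c *\<^sub>C v) = c * L v"
    using assms unfolding holo_on_def by auto
  have "((\<lambda>x. conjV x) has_derivative (\<lambda>v. conjV v)) (at x)"
    by (rule bounded_linear_imp_has_derivative) (rule bounded_linear_conjV)
  from bounded_linear.has_derivative[OF bounded_linear_cnj has_derivative_compose[OF this L(1)]] L(2)
  show "\<exists>L. ((\<lambda>x. cnj (g (conjV x))) has_derivative L) (at x) \<and> (\<forall>c v. L (c *\<^sub>C v) = c * L v)"
    by (intro exI[of _ "\<lambda>v. cnj (L (conjV v))"]) (simp add: conjV_scaleC)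
qed

lemma nonvanishing_on_vimage:
  fixes \<sigma> :: "'v::complex_fd_space \<Rightarrow> 'v"
  assumes "nonvanishing_on U h" "continuous_on UNIV \<tau>"
    "\<And>x. \<tau> (\<sigma> x) = x" "\<And>x. \<sigma> (\<tau> x) = x"
  shows "nonvanishing_on (\<sigma> -` U) (\<lambda>x. h (\<sigma> x))"
  unfolding nonvanishing_on_def
proof (intro allI impI)
  fix W assume W: "open W \<and> W \<subseteq> \<sigma> -` U \<and> W \<noteq> {}"
  have "open (\<tau> -` W)" using W assms(2) by (auto intro: open_vimage)
  moreover have "\<tau> -` W \<subseteq> U" using W assms(4) by (metis subsetD subsetI vimageE)
  moreover have "\<tau> -` W \<noteq> {}" using W assms(3) by (metis ex_in_conv vimageI2)
  ultimately obtain y where "y \<in> \<tau> -` W" "h y \<noteq> 0"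
    using assms(1) unfolding nonvanishing_on_def by blast
  then show "\<exists>x\<in>W. h (\<sigma> x) \<noteq> 0" using assms(4) by (metis vimageD)
qed

lemma meromorphic_fun_shift:
  assumes "meromorphic_fun F" shows "meromorphic_fun (\<lambda>x. F (x + \<alpha>))"
  unfolding meromorphic_fun_def
proof
  fix p
  obtain U g h where U: "open U" "p + \<alpha> \<in> U" "holo_on U g" "holo_on U h" "nonvanishing_on U h"
    "\<And>x. x \<in> U \<Longrightarrow> h x \<noteq> 0 \<Longrightarrow> F x = g x / h x"
    using assms unfolding meromorphic_fun_def by metis
  have "open ((\<lambda>x. x + \<alpha>) -` U)" using U(1) by (intro open_vimage continuous_intros)
  moreover have "nonvanishing_on ((\<lambda>x. x + \<alpha>) -` U) (\<lambda>x. h (x + \<alpha>))"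
    by (rule nonvanishing_on_vimage[OF U(5), where \<tau> = "\<lambda>x. x - \<alpha>"]) (auto intro!: continuous_intros)
  ultimately show "\<exists>U g h. open U \<and> p \<in> U \<and> holo_on U g \<and> holo_on U h \<and> nonvanishing_on U h \<and>
        (\<forall>x\<in>U. h x \<noteq> 0 \<longrightarrow> F (x + \<alpha>) = g x / h x)"
    using U
    by (intro exI[of _ "(\<lambda>x. x + \<alpha>) -` U"] exI[of _ "\<lambda>x. g (x + \<alpha>)"] exI[of _ "\<lambda>x. h (x + \<alpha>)"])
      (auto intro: holo_on_shift)
qed

lemma continuous_conjV: "continuous_on S (conjV :: 'v::complex_fd_space_conj \<Rightarrow> 'v)"
  by (rule bounded_linear.continuous_on[OF bounded_linear_conjV continuous_on_id])

lemma meromorphic_fun_conj: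
  fixes F :: "'v::complex_fd_space_conj \<Rightarrow> complex"
  assumes "meromorphic_fun F" shows "meromorphic_fun (\<lambda>x. cnj (F (conjV x)))"
  unfolding meromorphic_fun_def
proof
  fix p :: 'v
  obtain U g h where U: "open U" "conjV p \<in> U" "holo_on U g" "holo_on U h" "nonvanishing_on U h"
    "\<And>x. x \<in> U \<Longrightarrow> h x \<noteq> 0 \<Longrightarrow> F x = g x / h x"
    using assms unfolding meromorphic_fun_def by metis
  have "open (conjV -` U)" using U(1) continuous_conjV by (rule open_vimage)
  moreover have "nonvanishing_on (conjV -` U) (\<lambda>x. h (conjV x))"
    by (rule nonvanishing_on_vimage[OF U(5), where \<tau> = conjV]) (auto intro!: continuous_conjV simp: conjV_conjV)
  then have "nonvanishing_on (conjV -` U) (\<lambda>x. cnj (h (conjV x)))"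
    unfolding nonvanishing_on_def by simp
  ultimately show "\<exists>U g h. open U \<and> p \<in> U \<and> holo_on U g \<and> holo_on U h \<and> nonvanishing_on U h \<and>
        (\<forall>x\<in>U. h x \<noteq> 0 \<longrightarrow> cnj (F (conjV x)) = g x / h x)"
    using U
    by (intro exI[of _ "conjV -` U"] exI[of _ "\<lambda>x. cnj (g (conjV x))"] exI[of _ "\<lambda>x. cnj (h (conjV x))"])
      (auto intro: holo_on_conj)
qed

quotient_type (overloaded) 'v merom = "'v::complex_fd_space \<Rightarrow> complex" / partial:
  "\<lambda>F G. meromorphic_fun F \<and> meromorphic_fun G \<and> generically_eq F G"
proof (rule part_equivpI)
  show "\<exists>F::'v \<Rightarrow> complex. meromorphic_fun F \<and> meromorphic_fun F \<and> generically_eq F F"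
    using meromorphic_fun_const generically_eq_refl by blast
qed (auto intro!: sympI transpI intro: generically_eq_sym generically_eq_trans)

instantiation merom :: (complex_fd_space) comm_ring_1
begin

lift_definition zero_merom :: "'a merom" is "\<lambda>_. 0"
  by (simp add: meromorphic_fun_const generically_eq_refl)
lift_definition one_merom :: "'a merom" is "\<lambda>_. 1"
  by (simp add: meromorphic_fun_const generically_eq_refl)
lift_definition plus_merom :: "'a merom \<Rightarrow> 'a merom \<Rightarrow> 'a merom" is "\<lambda>F G x. F x + G x"
  by (simp add: meromorphic_fun_add generically_eq_map2)
lift_definition times_merom :: "'a merom \<Rightarrow> 'a merom \<Rightarrow> 'a merom" is "\<lambda>F G x. F x * G x"
  by (simp add: meromorphic_fun_mult generically_eq_map2)
lift_definition uminus_merom :: "'a merom \<Rightarrow> 'a merom" is "\<lambda>F x. - F x"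
  using generically_eq_map2[where k = "\<lambda>a b. - a"] by (blast intro: meromorphic_fun_uminus)
definition minus_merom :: "'a merom \<Rightarrow> 'a merom \<Rightarrow> 'a merom" where
  "minus_merom f g = f + - g"

instance
proof
  fix f g h :: "'a merom"
  show "f + g + h = f + (g + h)"
    by transfer (simp add: add.assoc meromorphic_fun_add generically_eq_refl)
  show "f + g = g + f"
    by transfer (simp add: add.commute meromorphic_fun_add generically_eq_refl)
  show "0 + f = f" by transfer (simp add: generically_eq_refl)
  show "- f + f = 0" by transfer (simp add: meromorphic_fun_const generically_eq_refl)
  show "f - g = f + - g" by (rule minus_merom_def)
  show "f * g * h = f * (g * h)"
    by transfer (simp add: mult.assoc meromorphic_fun_mult generically_eq_refl)
  show "f * g = g * f"
    by transfer (simp add: mult.commute meromorphic_fun_mult generically_eq_refl)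
  show "1 * f = f" by transfer (simp add: generically_eq_refl)
  show "(f + g) * h = f * h + g * h"
    by transfer (simp add: distrib_right meromorphic_fun_mult meromorphic_fun_add generically_eq_refl)
  show "(0::'a merom) \<noteq> 1"
    by transfer (auto simp: generically_eq_def)
qed

end

lift_definition const_merom :: "complex \<Rightarrow> 'v::complex_fd_space merom" is "\<lambda>c _. c"
  by (simp add: meromorphic_fun_const generically_eq_refl)

text \<open>The shift \<open>T\<^sub>\<alpha>\<close>.\<close>

lift_definition shift :: "'v::complex_fd_space \<Rightarrow> 'v merom \<Rightarrow> 'v merom" is "\<lambda>\<alpha> F x. F (x + \<alpha>)"
proof -
  fix \<alpha> :: 'v and F G :: "'v \<Rightarrow> complex"
  assume *: "meromorphic_fun F \<and> meromorphic_fun G \<and> generically_eq F G"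
  then obtain D where D: "open D" "closure D = UNIV" "\<forall>x\<in>D. F x = G x"
    unfolding generically_eq_def by blast
  have "generically_eq (\<lambda>x. F (x + \<alpha>)) (\<lambda>x. G (x + \<alpha>))"
    unfolding generically_eq_def
    using D(3) dense_open_vimage[OF D(1,2), of "\<lambda>x. x + \<alpha>" "\<lambda>x. x - \<alpha>"]
    by (intro exI[of _ "(\<lambda>x. x + \<alpha>) -` D"]) (simp add: continuous_on_add continuous_on_diff)
  with * show "meromorphic_fun (\<lambda>x. F (x + \<alpha>)) \<and> meromorphic_fun (\<lambda>x. G (x + \<alpha>)) \<and>
      generically_eq (\<lambda>x. F (x + \<alpha>)) (\<lambda>x. G (x + \<alpha>))"
    by (simp add: meromorphic_fun_shift)
qed

lift_definition conj_merom :: "'v::complex_fd_space_conj merom \<Rightarrow> 'v merom"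
  is "\<lambda>F x. cnj (F (conjV x))"
proof -
  fix F G :: "'v \<Rightarrow> complex"
  assume *: "meromorphic_fun F \<and> meromorphic_fun G \<and> generically_eq F G"
  then obtain D where D: "open D" "closure D = UNIV" "\<forall>x\<in>D. F x = G x"
    unfolding generically_eq_def by blast
  have "generically_eq (\<lambda>x. cnj (F (conjV x))) (\<lambda>x. cnj (G (conjV x)))"
    unfolding generically_eq_def
    using D dense_open_vimage[OF D(1,2), of conjV conjV]
    by (intro exI[of _ "conjV -` D"]) (auto simp: conjV_conjV continuous_conjV)
  with * show "meromorphic_fun (\<lambda>x. cnj (F (conjV x))) \<and> meromorphic_fun (\<lambda>x. cnj (G (conjV x))) \<and>
      generically_eq (\<lambda>x. cnj (F (conjV x))) (\<lambda>x. cnj (G (conjV x)))"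
    by (simp add: meromorphic_fun_conj)
qed


section \<open>Algebras with dynamical moment maps\<close>

definition complex_ring :: "complex ring" where
  "complex_ring = \<lparr>carrier = UNIV, monoid.mult = (*), one = 1, zero = 0, add = (+)\<rparr>"

record (overloaded) ('v::complex_fd_space, 'a) halg = "(complex, 'a) module" +
  bigrade :: "'v \<Rightarrow> 'v \<Rightarrow> 'a set"
  mom_l :: "'v merom \<Rightarrow> 'a"
  mom_r :: "'v merom \<Rightarrow> 'a"

definition moment_embedding ::
  "('v::complex_fd_space, 'a) halg \<Rightarrow> ('v merom \<Rightarrow> 'a) \<Rightarrow> bool" where
  "moment_embedding A \<mu> \<longleftrightarrow>
     inj \<mu> \<and> range \<mu> \<subseteq> bigrade A 0 0 \<and> \<mu> 1 = \<one>\<^bsub>A\<^esub> \<and>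
     (\<forall>f g. \<mu> (f + g) = \<mu> f \<oplus>\<^bsub>A\<^esub> \<mu> g) \<and> (\<forall>f g. \<mu> (f * g) = \<mu> f \<otimes>\<^bsub>A\<^esub> \<mu> g) \<and>
     (\<forall>c f. \<mu> (const_merom c * f) = c \<odot>\<^bsub>A\<^esub> \<mu> f)"

locale h_algebra = ring A + cmod: Module.module complex_ring A
  for A :: "('v::complex_fd_space, 'a) halg" (structure) +
  assumes smult_mult_left:
      "x \<in> carrier A \<Longrightarrow> y \<in> carrier A \<Longrightarrow> (c \<odot> x) \<otimes> y = c \<odot> (x \<otimes> y)"
    and smult_mult_right:
      "x \<in> carrier A \<Longrightarrow> y \<in> carrier A \<Longrightarrow> x \<otimes> (c \<odot> y) = c \<odot> (x \<otimes> y)"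
    and bigrade_submodule: "submodule (bigrade A \<alpha> \<beta>) complex_ring A"
    and bigrade_span:
      "x \<in> carrier A \<Longrightarrow>
        \<exists>I w. finite I \<and> (\<forall>(\<alpha>, \<beta>)\<in>I. w (\<alpha>, \<beta>) \<in> bigrade A \<alpha> \<beta>) \<and> x = (\<Oplus>p\<in>I. w p)"
    and bigrade_independent:
      "finite I \<Longrightarrow> \<forall>(\<alpha>, \<beta>)\<in>I. w (\<alpha>, \<beta>) \<in> bigrade A \<alpha> \<beta> \<Longrightarrow> (\<Oplus>p\<in>I. w p) = \<zero> \<Longrightarrow>
        p \<in> I \<Longrightarrow> w p = \<zero>"
    and bigrade_mult:
      "x \<in> bigrade A \<alpha> \<beta> \<Longrightarrow> y \<in> bigrade A \<gamma> \<delta> \<Longrightarrow> x \<otimes> y \<in> bigrade A (\<alpha> + \<gamma>) (\<beta> + \<delta>)"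
    and mom_l_embedding: "moment_embedding A (mom_l A)"
    and mom_r_embedding: "moment_embedding A (mom_r A)"
    and mom_l_shift: "x \<in> bigrade A \<alpha> \<beta> \<Longrightarrow> mom_l A f \<otimes> x = x \<otimes> mom_l A (shift \<alpha> f)"
    and mom_r_shift: "x \<in> bigrade A \<alpha> \<beta> \<Longrightarrow> mom_r A f \<otimes> x = x \<otimes> mom_r A (shift \<beta> f)"

definition h_hom ::
  "('v::complex_fd_space, 'a) halg \<Rightarrow> ('v, 'b) halg \<Rightarrow> ('a \<Rightarrow> 'b) \<Rightarrow> bool" where
  "h_hom A B \<phi> \<longleftrightarrow>
     \<phi> \<in> ring_hom A B \<and> (\<forall>c. \<forall>x\<in>carrier A. \<phi> (c \<odot>\<^bsub>A\<^esub> x) = c \<odot>\<^bsub>B\<^esub> \<phi> x) \<and>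
     (\<forall>\<alpha> \<beta>. \<phi> ` bigrade A \<alpha> \<beta> \<subseteq> bigrade B \<alpha> \<beta>) \<and>
     (\<forall>f. \<phi> (mom_l A f) = mom_l B f) \<and> (\<forall>f. \<phi> (mom_r A f) = mom_r B f)"


section \<open>The algebra of difference operators\<close>

text \<open>\<open>diffop I f\<close> is \<open>\<Sum>\<beta>\<in>I. f\<^sub>\<beta> T\<^sub>\<beta>\<close>, as an operator on meromorphic functions.\<close>

definition diffop ::
  "'v set \<Rightarrow> ('v \<Rightarrow> 'v merom) \<Rightarrow> 'v::complex_fd_space merom \<Rightarrow> 'v merom" where
  "diffop I f = (\<lambda>g. \<Sum>\<beta>\<in>I. f \<beta> * shift \<beta> g)"

definition Dh :: "('v::complex_fd_space, 'v merom \<Rightarrow> 'v merom) halg" where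
  "Dh = \<lparr>carrier = {diffop I f |I f. finite I},
         monoid.mult = (\<lambda>D E. D \<circ> E), one = id,
         zero = (\<lambda>_. 0), add = (\<lambda>D E g. D g + E g),
         smult = (\<lambda>c D g. const_merom c * D g),
         bigrade = (\<lambda>\<alpha> \<beta>. if \<alpha> = \<beta> then {\<lambda>g. f * shift (- \<beta>) g |f. True} else {\<lambda>_. 0}),
         mom_l = (*), mom_r = (*)\<rparr>"

text \<open>
  The involution sending \<open>f T\<^sub>\<beta>\<close> to the operator \<open>g \<mapsto> shift (- conjV \<beta>) (conj_merom f * g)\<close>, extended
  additively. The value does not depend on the way \<open>D\<close> is written, since distinct shifts are
  linearly independent over the meromorphic functions.
\<close>

definition star_Dh ::
  "('v::complex_fd_space_conj merom \<Rightarrow> 'v merom) \<Rightarrow> 'v merom \<Rightarrow> 'v merom" where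
  "star_Dh D = (THE E. \<exists>I f. finite I \<and> D = diffop I f \<and>
     E = (\<lambda>g. \<Sum>\<beta>\<in>I. shift (- conjV \<beta>) (conj_merom (f \<beta>) * g)))"


section \<open>The matrix tensor product\<close>

text \<open>
  The direct sum of all \<open>A\<^sub>\<alpha>\<^sub>\<gamma> \<otimes> B\<^sub>\<gamma>\<^sub>\<beta>\<close> is realised as the free abelian group on all pairs \<open>(a, b)\<close> from
  \<open>A\<^sub>\<alpha>\<^sub>\<gamma> \<times> B\<^sub>\<gamma>\<^sub>\<beta>\<close>, modulo biadditivity within each component and the balancing relation. A pair of nonzero
  elements determines its component, and pairs with a zero entry are killed by
  biadditivity. Complex bilinearity is balancing with constant functions.
\<close>

definition matching ::
  "('v::complex_fd_space, 'a) halg \<Rightarrow> ('v, 'b) halg \<Rightarrow> ('a \<times> 'b) set" where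
  "matching A B = (\<Union>\<alpha> \<beta> \<gamma>. bigrade A \<alpha> \<gamma> \<times> bigrade B \<gamma> \<beta>)"

inductive_set tensor_rel ::
  "('v::complex_fd_space, 'a) halg \<Rightarrow> ('v, 'b) halg \<Rightarrow> ('a \<times> 'b \<Rightarrow>\<^sub>0 int) set"
  for A B where
  add_left: "a \<in> bigrade A \<alpha> \<gamma> \<Longrightarrow> a' \<in> bigrade A \<alpha> \<gamma> \<Longrightarrow> b \<in> bigrade B \<gamma> \<beta> \<Longrightarrow>
    frag_of (a \<oplus>\<^bsub>A\<^esub> a', b) - frag_of (a, b) - frag_of (a', b) \<in> tensor_rel A B"
| add_right: "a \<in> bigrade A \<alpha> \<gamma> \<Longrightarrow> b \<in> bigrade B \<gamma> \<beta> \<Longrightarrow> b' \<in> bigrade B \<gamma> \<beta> \<Longrightarrow>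
    frag_of (a, b \<oplus>\<^bsub>B\<^esub> b') - frag_of (a, b) - frag_of (a, b') \<in> tensor_rel A B"
| balance: "a \<in> bigrade A \<alpha> \<gamma> \<Longrightarrow> b \<in> bigrade B \<gamma> \<beta> \<Longrightarrow>
    frag_of (mom_r A f \<otimes>\<^bsub>A\<^esub> a, b) - frag_of (a, mom_l B f \<otimes>\<^bsub>B\<^esub> b) \<in> tensor_rel A B"

definition tensor_null ::
  "('v::complex_fd_space, 'a) halg \<Rightarrow> ('v, 'b) halg \<Rightarrow> ('a \<times> 'b \<Rightarrow>\<^sub>0 int) set" where
  "tensor_null A B = generate (free_Abelian_group (matching A B)) (tensor_rel A B)"

definition tensor_group ::
  "('v::complex_fd_space, 'a) halg \<Rightarrow> ('v, 'b) halg \<Rightarrow> ('a \<times> 'b \<Rightarrow>\<^sub>0 int) set monoid" where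
  "tensor_group A B = free_Abelian_group (matching A B) Mod tensor_null A B"

text \<open>
  The pure tensor \<open>a \<otimes> b\<close>; the convention that it vanishes when the inner degrees of \<open>a\<close> and \<open>b\<close> do
  not match only matters in the definition of \<open>tensor_assoc\<close> below.
\<close>

definition pure_tensor ::
  "('v::complex_fd_space, 'a) halg \<Rightarrow> ('v, 'b) halg \<Rightarrow> 'a \<Rightarrow> 'b \<Rightarrow> ('a \<times> 'b \<Rightarrow>\<^sub>0 int) set" where
  "pure_tensor A B a b =
     (if (a, b) \<in> matching A B
      then tensor_null A B #>\<^bsub>free_Abelian_group (matching A B)\<^esub> frag_of (a, b)
      else tensor_null A B)"

text \<open>
  The additive map \<open>\<Sum> a\<^sub>i \<otimes> b\<^sub>i \<mapsto> \<Sum> \<Phi> (a\<^sub>i, b\<^sub>i)\<close> on a tensor product, with values in the abelian group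
  \<open>H\<close> (written multiplicatively): \<open>free_lift H \<Phi>\<close> is constant on each coset \<open>X\<close> as soon as \<open>\<Phi>\<close>
  respects \<open>tensor_rel\<close>, see \<open>tensor_lift_coset\<close>.
\<close>

definition free_lift :: "('b, 'm) monoid_scheme \<Rightarrow> ('p \<Rightarrow> 'b) \<Rightarrow> ('p \<Rightarrow>\<^sub>0 int) \<Rightarrow> 'b" where
  "free_lift H \<Phi> x =
     finprod H (\<lambda>p. \<Phi> p [^]\<^bsub>H\<^esub> Poly_Mapping.lookup x p) (Poly_Mapping.keys x)"

definition tensor_lift :: "('b, 'm) monoid_scheme \<Rightarrow> ('p \<Rightarrow> 'b) \<Rightarrow> ('p \<Rightarrow>\<^sub>0 int) set \<Rightarrow> 'b" where
  "tensor_lift H \<Phi> X = the_elem (free_lift H \<Phi> ` X)"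

lemma free_lift_superset:
  assumes "comm_group H" "\<And>p. p \<in> K \<Longrightarrow> \<Phi> p \<in> carrier H" "finite K" "Poly_Mapping.keys x \<subseteq> K"
  shows "free_lift H \<Phi> x = finprod H (\<lambda>p. \<Phi> p [^]\<^bsub>H\<^esub> Poly_Mapping.lookup x p) K"
proof -
  interpret comm_group H by fact
  show ?thesis
    unfolding free_lift_def
    using assms
    by (intro finprod_mono_neutral_cong_left) (auto simp: in_keys_iff)
qed

lemma free_lift_hom:
  assumes "comm_group H" "\<And>p. p \<in> P \<Longrightarrow> \<Phi> p \<in> carrier H"
  shows "free_lift H \<Phi> \<in> hom (free_Abelian_group P) H"
proof (rule homI)
  interpret comm_group H by fact
  fix x assume "x \<in> carrier (free_Abelian_group P)"
  then have x: "Poly_Mapping.keys x \<subseteq> P" by simp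
  then show "free_lift H \<Phi> x \<in> carrier H"
    using assms(2) unfolding free_lift_def by (intro finprod_closed) auto
  fix y assume "y \<in> carrier (free_Abelian_group P)"
  then have y: "Poly_Mapping.keys y \<subseteq> P" by simp
  let ?K = "Poly_Mapping.keys x \<union> Poly_Mapping.keys y"
  have K: "finite ?K" "\<And>p. p \<in> ?K \<Longrightarrow> \<Phi> p \<in> carrier H" using x y assms(2) by auto
  have "free_lift H \<Phi> (x + y) = finprod H (\<lambda>p. \<Phi> p [^]\<^bsub>H\<^esub> Poly_Mapping.lookup (x + y) p) ?K"
    using Poly_Mapping.keys_add[where f = x and g = y]
    by (intro free_lift_superset[OF assms(1) K(2,1)])
  also have "\<dots> = finprod H (\<lambda>p. \<Phi> p [^]\<^bsub>H\<^esub> Poly_Mapping.lookup x p \<otimes>\<^bsub>H\<^esub> \<Phi> p [^]\<^bsub>H\<^esub> Poly_Mapping.lookup y p) ?K"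
    using K(2) by (intro finprod_cong) (auto simp: lookup_add int_pow_mult simp_implies_def)
  also have "\<dots> = free_lift H \<Phi> x \<otimes>\<^bsub>H\<^esub> free_lift H \<Phi> y"
    using free_lift_superset[where \<Phi> = \<Phi> and x = x, OF assms(1) K(2,1)] free_lift_superset[where \<Phi> = \<Phi> and x = y, OF assms(1) K(2,1)] K(2)
    by (subst finprod_multf) auto
  finally show "free_lift H \<Phi> (x \<otimes>\<^bsub>free_Abelian_group P\<^esub> y) = free_lift H \<Phi> x \<otimes>\<^bsub>H\<^esub> free_lift H \<Phi> y"
    by simp
qed

lemma free_lift_frag_of:
  assumes "comm_group H" "\<Phi> p \<in> carrier H"
  shows "free_lift H \<Phi> (frag_of p) = \<Phi> p"
proof -
  interpret comm_group H by fact
  show ?thesis using assms(2) by (simp add: free_lift_def)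
qed

lemma tensor_lift_coset:
  assumes H: "comm_group H" and \<Phi>: "\<And>p. p \<in> matching A B \<Longrightarrow> \<Phi> p \<in> carrier H"
    and sub: "tensor_rel A B \<subseteq> carrier (free_Abelian_group (matching A B))"
    and rel: "\<And>r. r \<in> tensor_rel A B \<Longrightarrow> free_lift H \<Phi> r = \<one>\<^bsub>H\<^esub>"
    and x: "x \<in> carrier (free_Abelian_group (matching A B))"
  shows "tensor_lift H \<Phi> (tensor_null A B #>\<^bsub>free_Abelian_group (matching A B)\<^esub> x) = free_lift H \<Phi> x"
proof -
  let ?F = "free_Abelian_group (matching A B)"
  interpret H: comm_group H by fact
  interpret F: group ?F by simp
  interpret h: group_hom ?F H "free_lift H \<Phi>"
    by unfold_locales (rule free_lift_hom[OF H \<Phi>])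
  have null: "n \<in> carrier ?F \<and> free_lift H \<Phi> n = \<one>\<^bsub>H\<^esub>" if "n \<in> tensor_null A B" for n
    using that unfolding tensor_null_def
  proof (induction rule: generate.induct)
    case one
    show ?case using h.hom_one by simp
  next
    case (incl r)
    then show ?case using sub rel by blast
  next
    case (inv r)
    then have "r \<in> carrier ?F" "free_lift H \<Phi> r = \<one>\<^bsub>H\<^esub>" using sub rel by blast+
    then show ?case using h.hom_inv[of r] F.inv_closed[of r] by simp
  next
    case (eng m n)
    then show ?case using h.hom_mult[of m n] F.m_closed[of m n] by simp
  qed
  have "free_lift H \<Phi> y = free_lift H \<Phi> x" if y: "y \<in> tensor_null A B #>\<^bsub>?F\<^esub> x" for y
  proof -
    obtain n where n: "n \<in> tensor_null A B" "y = n \<otimes>\<^bsub>?F\<^esub> x"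
      using y unfolding r_coset_def by blast
    show ?thesis
      using null[OF n(1)] h.hom_mult[of n x] h.hom_closed[OF x] x n(2) by simp
  qed
  moreover have "x \<in> tensor_null A B #>\<^bsub>?F\<^esub> x"
    unfolding r_coset_def tensor_null_def using generate.one[of ?F "tensor_rel A B"] by force
  ultimately have "free_lift H \<Phi> ` (tensor_null A B #>\<^bsub>?F\<^esub> x) = {free_lift H \<Phi> x}"
    by blast
  then show ?thesis unfolding tensor_lift_def by simp
qed

definition mtensor ::
  "('v::complex_fd_space, 'a) halg \<Rightarrow> ('v, 'b) halg \<Rightarrow> ('v, ('a \<times> 'b \<Rightarrow>\<^sub>0 int) set) halg" where
  "mtensor A B = (let Q = tensor_group A B; t = pure_tensor A B in
     \<lparr>carrier = carrier Q,
      monoid.mult = (\<lambda>X Y. tensor_lift Q (\<lambda>(a, b).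
         tensor_lift Q (\<lambda>(c, d). t (a \<otimes>\<^bsub>A\<^esub> c) (b \<otimes>\<^bsub>B\<^esub> d)) Y) X),
      one = t \<one>\<^bsub>A\<^esub> \<one>\<^bsub>B\<^esub>,
      zero = \<one>\<^bsub>Q\<^esub>, add = (\<lambda>X Y. X \<otimes>\<^bsub>Q\<^esub> Y),
      smult = (\<lambda>z. tensor_lift Q (\<lambda>(a, b). t (z \<odot>\<^bsub>A\<^esub> a) b)),
      bigrade = (\<lambda>\<alpha> \<beta>. generate Q {t a b |a b \<gamma>. a \<in> bigrade A \<alpha> \<gamma> \<and> b \<in> bigrade B \<gamma> \<beta>}),
      mom_l = (\<lambda>f. t (mom_l A f) \<one>\<^bsub>B\<^esub>),
      mom_r = (\<lambda>f. t \<one>\<^bsub>A\<^esub> (mom_r B f))\<rparr>)"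

definition tensor_map ::
  "('v::complex_fd_space, 'c) halg \<Rightarrow> ('v, 'd) halg \<Rightarrow> ('a \<Rightarrow> 'c) \<Rightarrow> ('b \<Rightarrow> 'd) \<Rightarrow>
     ('a \<times> 'b \<Rightarrow>\<^sub>0 int) set \<Rightarrow> ('c \<times> 'd \<Rightarrow>\<^sub>0 int) set" where
  "tensor_map C D \<phi> \<psi> =
     tensor_lift (add_monoid (mtensor C D)) (\<lambda>(a, b). pure_tensor C D (\<phi> a) (\<psi> b))"

text \<open>The canonical map \<open>(a \<otimes> b) \<otimes> c \<mapsto> a \<otimes> (b \<otimes> c)\<close>.\<close>

definition tensor_assoc ::
  "('v::complex_fd_space, 'a) halg \<Rightarrow> ('v, 'b) halg \<Rightarrow> ('v, 'c) halg \<Rightarrow>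
     (('a \<times> 'b \<Rightarrow>\<^sub>0 int) set \<times> 'c \<Rightarrow>\<^sub>0 int) set \<Rightarrow> ('a \<times> ('b \<times> 'c \<Rightarrow>\<^sub>0 int) set \<Rightarrow>\<^sub>0 int) set" where
  "tensor_assoc A B C =
     (let H = add_monoid (mtensor A (mtensor B C)) in
      tensor_lift H (\<lambda>(Y, c).
        tensor_lift H (\<lambda>(a, b). pure_tensor A (mtensor B C) a (pure_tensor B C b c)) Y))"


section \<open>Bialgebroids, Hopf algebroids and involutions\<close>

locale h_bialgebroid = h_algebra A
  for A :: "('v::complex_fd_space, 'a) halg" (structure) +
  fixes \<Delta> :: "'a \<Rightarrow> ('a \<times> 'a \<Rightarrow>\<^sub>0 int) set"
    and \<epsilon> :: "'a \<Rightarrow> 'v merom \<Rightarrow> 'v merom"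
  assumes comult_hom: "h_hom A (mtensor A A) \<Delta>"
    and counit_hom: "h_hom A Dh \<epsilon>"
    and coassoc: "a \<in> carrier A \<Longrightarrow>
      tensor_assoc A A A (tensor_map (mtensor A A) A \<Delta> (\<lambda>x. x) (\<Delta> a)) =
      tensor_map A (mtensor A A) (\<lambda>x. x) \<Delta> (\<Delta> a)"
    and counit_left: "a \<in> bigrade A \<alpha> \<beta> \<Longrightarrow>
      tensor_map Dh A \<epsilon> (\<lambda>x. x) (\<Delta> a) = pure_tensor Dh A (shift (- \<alpha>)) a"
    and counit_right: "a \<in> bigrade A \<alpha> \<beta> \<Longrightarrow>
      tensor_map A Dh (\<lambda>x. x) \<epsilon> (\<Delta> a) = pure_tensor A Dh a (shift (- \<beta>))"

locale h_hopf_algebroid = h_bialgebroid A \<Delta> \<epsilon>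
  for A :: "('v::complex_fd_space, 'a) halg" (structure) and \<Delta> \<epsilon> +
  fixes S :: "'a \<Rightarrow> 'a"
  assumes antipode_closed: "S \<in> carrier A \<rightarrow> carrier A"
    and antipode_add: "a \<in> carrier A \<Longrightarrow> b \<in> carrier A \<Longrightarrow> S (a \<oplus> b) = S a \<oplus> S b"
    and antipode_smult: "a \<in> carrier A \<Longrightarrow> S (c \<odot> a) = c \<odot> S a"
    and antipode_mom_r: "a \<in> carrier A \<Longrightarrow> S (mom_r A f \<otimes> a) = S a \<otimes> mom_l A f"
    and antipode_mom_l: "a \<in> carrier A \<Longrightarrow> S (a \<otimes> mom_l A f) = mom_r A f \<otimes> S a"
    and antipode_right: "a \<in> carrier A \<Longrightarrow>
      tensor_lift (add_monoid A) (\<lambda>(x, y). x \<otimes> S y) (\<Delta> a) = mom_l A (\<epsilon> a 1)"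
    and antipode_left: "a \<in> bigrade A \<alpha> \<beta> \<Longrightarrow>
      tensor_lift (add_monoid A) (\<lambda>(x, y). S x \<otimes> y) (\<Delta> a) = mom_r A (shift \<alpha> (\<epsilon> a 1))"

locale h_star_algebra = h_algebra A
  for A :: "('v::complex_fd_space_conj, 'a) halg" (structure) +
  fixes star :: "'a \<Rightarrow> 'a"
  assumes star_closed: "star \<in> carrier A \<rightarrow> carrier A"
    and star_add: "a \<in> carrier A \<Longrightarrow> b \<in> carrier A \<Longrightarrow> star (a \<oplus> b) = star a \<oplus> star b"
    and star_smult: "a \<in> carrier A \<Longrightarrow> star (c \<odot> a) = cnj c \<odot> star a"
    and star_mult: "a \<in> carrier A \<Longrightarrow> b \<in> carrier A \<Longrightarrow> star (a \<otimes> b) = star b \<otimes> star a"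
    and star_star: "a \<in> carrier A \<Longrightarrow> star (star a) = a"
    and star_mom_l: "star (mom_l A f) = mom_l A (conj_merom f)"
    and star_mom_r: "star (mom_r A f) = mom_r A (conj_merom f)"

text \<open>
  The map \<open>star \<otimes> star\<close> makes sense because \<open>star\<close> automatically sends degree \<open>(\<alpha>, \<beta>)\<close> to
  \<open>(- conjV \<alpha>, - conjV \<beta>)\<close>, by the commutation relations with the moment maps.
\<close>

locale h_star_bialgebroid = h_bialgebroid A \<Delta> \<epsilon> + h_star_algebra A star
  for A :: "('v::complex_fd_space_conj, 'a) halg" (structure) and \<Delta> \<epsilon> star +
  assumes star_comult: "a \<in> carrier A \<Longrightarrow> tensor_map A A star star (\<Delta> a) = \<Delta> (star a)"
    and star_counit: "a \<in> carrier A \<Longrightarrow> \<epsilon> (star a) = star_Dh (\<epsilon> a)"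

end

theory Submission
  imports Defs
begin

text \<open>
  It suffices to show \<open>S = T\<close>, where \<open>T = * \<circ> S\<^sup>-\<^sup>1 \<circ> *\<close>. A linear map \<open>F\<close> with
  \<open>F (\<mu>\<^sub>r f \<cdot> a) = F a \<cdot> \<mu>\<^sub>l f\<close> is determined by its convolution product \<open>\<Sum> F a\<^sub>1 \<cdot> a\<^sub>2\<close> with the
  identity, because the antipode inverts the identity on the right. Applied twice, with one factor
  of a product fixed at a time, this gives \<open>S (a \<cdot> b) = S b \<cdot> S a\<close>. Hence \<open>T\<close> satisfies the
  required rule for \<open>\<mu>\<^sub>r\<close>, and with \<open>c = b\<^sup>*\<close> one finds
  \<open>\<Sum> T b\<^sub>1 \<cdot> b\<^sub>2 = (S\<^sup>-\<^sup>1 (\<Sum> c\<^sub>1 \<cdot> S c\<^sub>2))\<^sup>*\<close>, which is the value of the left antipode axiom at \<open>b\<close>.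
\<close>

section \<open>Homomorphisms on tensor products\<close>

text \<open>Uniqueness of inverses in a convolution monoid cannot simply be quoted. The assignments
  sending x, y to F x * y and to x * S y descend to the tensor product under different moment-map
  rules, and the two antipode axioms have values in the images of different moment maps instead of a
  common unit. Cancellation is therefore carried out on the threefold sum F a1 * a2 * S a3, with
  coassociativity changing the bracketing. Antimultiplicativity has to come first, because inverting
  S must turn products x * S y into reversed ones. The grading is the other obstacle. Applying star
  to both tensor factors makes sense only if star sends matching pairs to matching pairs, and the
  adjoint of a difference operator makes sense only if the operator determines its coefficients. One
  device serves both: a complex linear functional, regarded as a meromorphic function, differs from
  its shifts by constants, and these constants tell degrees apart.\<close>

lemma hom_eq_on_generate:
  assumes "group G" "group H" "h \<in> hom G H" "k \<in> hom G H" "X \<subseteq> carrier G"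
    "\<And>x. x \<in> X \<Longrightarrow> h x = k x" "y \<in> generate G X"
  shows "h y = k y"
proof -
  interpret G: group G by fact
  interpret h: group_hom G H h by (intro group_hom.intro group_hom_axioms.intro) fact+
  interpret k: group_hom G H k by (intro group_hom.intro group_hom_axioms.intro) fact+
  show ?thesis
    using assms(7)
  proof (induction rule: generate.induct)
    case one
    then show ?case by simp
  next
    case (incl x)
    then show ?case using assms by simp
  next
    case (inv x)
    then show ?case using assms by auto
  next
    case (eng x y)
    then have "x \<in> carrier G" "y \<in> carrier G" using G.generate_in_carrier[OF assms(5)] by auto
    with eng show ?case by simp
  qed
qed

lemma hom_generate_closed:
  assumes "group G" "group H" "h \<in> hom G H" "X \<subseteq> carrier G" "subgroup K H"
    "\<And>x. x \<in> X \<Longrightarrow> h x \<in> K" "y \<in> generate G X"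
  shows "h y \<in> K"
proof -
  interpret G: group G by fact
  interpret h: group_hom G H h by (intro group_hom.intro group_hom_axioms.intro) fact+
  interpret K: subgroup K H by fact
  show ?thesis
    using assms(7)
  proof (induction rule: generate.induct)
    case one
    then show ?case by simp
  next
    case (incl x)
    then show ?case using assms by simp
  next
    case (inv x)
    then show ?case using assms by auto
  next
    case (eng x y)
    then have "x \<in> carrier G" "y \<in> carrier G" using G.generate_in_carrier[OF assms(4)] by auto
    with eng show ?case by simp
  qed
qed

text \<open>The structure that suffices for lifting maps out of tensor products. \<open>Dh\<close>
  and \<open>mtensor A B\<close> are shown to have it, so tensor products with them can be formed
  without first making them h-algebras.\<close>

locale moment_graded = abelian_group A
  for A :: "('v::complex_fd_space, 'a) halg" (structure) +
  assumes bigrade_subgroup: "subgroup (bigrade A \<alpha> \<beta>) (add_monoid A)"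
    and mom_l_bigrade: "x \<in> bigrade A \<alpha> \<beta> \<Longrightarrow> mom_l A f \<otimes> x \<in> bigrade A \<alpha> \<beta>"
    and mom_r_bigrade: "x \<in> bigrade A \<alpha> \<beta> \<Longrightarrow> mom_r A f \<otimes> x \<in> bigrade A \<alpha> \<beta>"
begin

lemma bigrade_carrier: "x \<in> bigrade A \<alpha> \<beta> \<Longrightarrow> x \<in> carrier A"
  using subgroup.mem_carrier[OF bigrade_subgroup] by fastforce

lemma bigrade_add: "x \<in> bigrade A \<alpha> \<beta> \<Longrightarrow> y \<in> bigrade A \<alpha> \<beta> \<Longrightarrow> x \<oplus> y \<in> bigrade A \<alpha> \<beta>"
  using subgroup.m_closed[OF bigrade_subgroup] by fastforce

lemma bigrade_zero: "\<zero> \<in> bigrade A \<alpha> \<beta>"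
  using subgroup.one_closed[OF bigrade_subgroup] by fastforce

end

text \<open>The three families of \<open>tensor_rel\<close>, read as equations for
  \<open>\<Phi>\<close>. Nothing is asked at pairs outside \<open>matching\<close>, and the target
  group is written multiplicatively.\<close>

definition balanced ::
  "('v::complex_fd_space, 'a) halg \<Rightarrow> ('v, 'b) halg \<Rightarrow> ('c, 'm) monoid_scheme \<Rightarrow> ('a \<times> 'b \<Rightarrow> 'c) \<Rightarrow> bool" where
  "balanced A B H \<Phi> \<longleftrightarrow>
    (\<forall>\<alpha> \<beta> \<gamma>. \<forall>a\<in>bigrade A \<alpha> \<gamma>. \<forall>b\<in>bigrade B \<gamma> \<beta>. \<Phi> (a, b) \<in> carrier H \<and>
      (\<forall>a'\<in>bigrade A \<alpha> \<gamma>. \<Phi> (a \<oplus>\<^bsub>A\<^esub> a', b) = \<Phi> (a, b) \<otimes>\<^bsub>H\<^esub> \<Phi> (a', b)) \<and>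
      (\<forall>b'\<in>bigrade B \<gamma> \<beta>. \<Phi> (a, b \<oplus>\<^bsub>B\<^esub> b') = \<Phi> (a, b) \<otimes>\<^bsub>H\<^esub> \<Phi> (a, b')) \<and>
      (\<forall>f. \<Phi> (mom_r A f \<otimes>\<^bsub>A\<^esub> a, b) = \<Phi> (a, mom_l B f \<otimes>\<^bsub>B\<^esub> b)))"

lemma balancedI:
  assumes "\<And>\<alpha> \<beta> \<gamma> a b. a \<in> bigrade A \<alpha> \<gamma> \<Longrightarrow> b \<in> bigrade B \<gamma> \<beta> \<Longrightarrow> \<Phi> (a, b) \<in> carrier H"
    "\<And>\<alpha> \<beta> \<gamma> a a' b. a \<in> bigrade A \<alpha> \<gamma> \<Longrightarrow> a' \<in> bigrade A \<alpha> \<gamma> \<Longrightarrow> b \<in> bigrade B \<gamma> \<beta> \<Longrightarrow>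
      \<Phi> (a \<oplus>\<^bsub>A\<^esub> a', b) = \<Phi> (a, b) \<otimes>\<^bsub>H\<^esub> \<Phi> (a', b)"
    "\<And>\<alpha> \<beta> \<gamma> a b b'. a \<in> bigrade A \<alpha> \<gamma> \<Longrightarrow> b \<in> bigrade B \<gamma> \<beta> \<Longrightarrow> b' \<in> bigrade B \<gamma> \<beta> \<Longrightarrow>
      \<Phi> (a, b \<oplus>\<^bsub>B\<^esub> b') = \<Phi> (a, b) \<otimes>\<^bsub>H\<^esub> \<Phi> (a, b')"
    "\<And>\<alpha> \<beta> \<gamma> a b f. a \<in> bigrade A \<alpha> \<gamma> \<Longrightarrow> b \<in> bigrade B \<gamma> \<beta> \<Longrightarrow>
      \<Phi> (mom_r A f \<otimes>\<^bsub>A\<^esub> a, b) = \<Phi> (a, mom_l B f \<otimes>\<^bsub>B\<^esub> b)"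
  shows "balanced A B H \<Phi>"
  using assms unfolding balanced_def by metis

lemma balancedD:
  assumes "balanced A B H \<Phi>" "a \<in> bigrade A \<alpha> \<gamma>" "b \<in> bigrade B \<gamma> \<beta>"
  shows "\<Phi> (a, b) \<in> carrier H"
    "a' \<in> bigrade A \<alpha> \<gamma> \<Longrightarrow> \<Phi> (a \<oplus>\<^bsub>A\<^esub> a', b) = \<Phi> (a, b) \<otimes>\<^bsub>H\<^esub> \<Phi> (a', b)"
    "b' \<in> bigrade B \<gamma> \<beta> \<Longrightarrow> \<Phi> (a, b \<oplus>\<^bsub>B\<^esub> b') = \<Phi> (a, b) \<otimes>\<^bsub>H\<^esub> \<Phi> (a, b')"
    "\<Phi> (mom_r A f \<otimes>\<^bsub>A\<^esub> a, b) = \<Phi> (a, mom_l B f \<otimes>\<^bsub>B\<^esub> b)"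
  using assms unfolding balanced_def by blast+

lemma matchingI: "a \<in> bigrade A \<alpha> \<gamma> \<Longrightarrow> b \<in> bigrade B \<gamma> \<beta> \<Longrightarrow> (a, b) \<in> matching A B"
  unfolding matching_def by blast

lemma matchingE:
  assumes "p \<in> matching A B"
  obtains a b \<alpha> \<beta> \<gamma> where "p = (a, b)" "a \<in> bigrade A \<alpha> \<gamma>" "b \<in> bigrade B \<gamma> \<beta>"
  using assms unfolding matching_def by blast

definition pure_bigrade ::
  "('v::complex_fd_space, 'a) halg \<Rightarrow> ('v, 'b) halg \<Rightarrow> 'v \<Rightarrow> 'v \<Rightarrow> ('a \<times> 'b \<Rightarrow>\<^sub>0 int) set set" where
  "pure_bigrade A B \<alpha> \<beta> =
     {pure_tensor A B a b |a b \<gamma>. a \<in> bigrade A \<alpha> \<gamma> \<and> b \<in> bigrade B \<gamma> \<beta>}"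

lemma bigrade_mtensor:
  "bigrade (mtensor A B) \<alpha> \<beta> = generate (tensor_group A B) (pure_bigrade A B \<alpha> \<beta>)"
  by (simp add: mtensor_def Let_def pure_bigrade_def)

lemma mtensor_simps [simp]:
  "carrier (mtensor A B) = carrier (tensor_group A B)"
  "\<zero>\<^bsub>mtensor A B\<^esub> = \<one>\<^bsub>tensor_group A B\<^esub>"
  "X \<oplus>\<^bsub>mtensor A B\<^esub> Y = X \<otimes>\<^bsub>tensor_group A B\<^esub> Y"
  "mom_l (mtensor A B) f = pure_tensor A B (mom_l A f) \<one>\<^bsub>B\<^esub>"
  "mom_r (mtensor A B) f = pure_tensor A B \<one>\<^bsub>A\<^esub> (mom_r B f)"
  "\<one>\<^bsub>mtensor A B\<^esub> = pure_tensor A B \<one>\<^bsub>A\<^esub> \<one>\<^bsub>B\<^esub>"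
  by (simp_all add: mtensor_def Let_def)

lemma mtensor_mult:
  "X \<otimes>\<^bsub>mtensor A B\<^esub> Y = tensor_lift (tensor_group A B) (\<lambda>(a, b).
         tensor_lift (tensor_group A B) (\<lambda>(c, d). pure_tensor A B (a \<otimes>\<^bsub>A\<^esub> c) (b \<otimes>\<^bsub>B\<^esub> d)) Y) X"
  by (simp add: mtensor_def Let_def)

section \<open>Universal property of the matrix tensor product\<close>

locale tensor_pair = A: moment_graded A + B: moment_graded B
  for A :: "('v::complex_fd_space, 'a) halg" and B :: "('v, 'b) halg"
begin

abbreviation F where "F \<equiv> free_Abelian_group (matching A B)"
abbreviation Q where "Q \<equiv> tensor_group A B"
abbreviation t where "t \<equiv> pure_tensor A B"

lemma frag_of_F: "a \<in> bigrade A \<alpha> \<gamma> \<Longrightarrow> b \<in> bigrade B \<gamma> \<beta> \<Longrightarrow> frag_of (a, b) \<in> carrier F"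
  by (simp add: matchingI del: carrier_free_Abelian_group_iff)

lemma F_diff: "x \<in> carrier F \<Longrightarrow> y \<in> carrier F \<Longrightarrow> x - y \<in> carrier F"
  using keys_diff[of x y] by auto

lemma rel_carrier: "tensor_rel A B \<subseteq> carrier F"
proof
  fix r assume "r \<in> tensor_rel A B"
  then show "r \<in> carrier F"
    by induction (auto intro!: F_diff simp del: carrier_free_Abelian_group_iff
        intro: frag_of_F A.bigrade_add B.bigrade_add A.mom_r_bigrade B.mom_l_bigrade)
qed

lemma null_normal: "tensor_null A B \<lhd> F"
proof -
  interpret comm_group F by (rule abelian_free_Abelian_group)
  show ?thesis
    unfolding tensor_null_def
    by (intro subgroup_imp_normal generate_is_subgroup rel_carrier)
qed

lemma null_subgroup: "subgroup (tensor_null A B) F"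
  using null_normal by (simp add: normal_def)

lemma Q_comm: "comm_group Q"
proof -
  interpret comm_group F by (rule abelian_free_Abelian_group)
  show ?thesis unfolding tensor_group_def by (rule abelian_FactGroup[OF null_subgroup])
qed

sublocale Q: comm_group Q by (rule Q_comm)

lemma coset_hom: "(\<lambda>x. tensor_null A B #>\<^bsub>F\<^esub> x) \<in> hom F Q"
  unfolding tensor_group_def by (rule normal.r_coset_hom_Mod[OF null_normal])

lemma Q_carrierE:
  assumes "X \<in> carrier Q"
  obtains x where "x \<in> carrier F" "X = tensor_null A B #>\<^bsub>F\<^esub> x"
  using assms unfolding tensor_group_def carrier_FactGroup by blast

lemma pure_eq: "(a, b) \<in> matching A B \<Longrightarrow> t a b = tensor_null A B #>\<^bsub>F\<^esub> frag_of (a, b)"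
  by (simp add: pure_tensor_def)

lemma pure_nonmatching: "(a, b) \<notin> matching A B \<Longrightarrow> t a b = \<one>\<^bsub>Q\<^esub>"
  by (simp add: pure_tensor_def tensor_group_def)

lemma pure_closed: "t a b \<in> carrier Q"
proof (cases "(a, b) \<in> matching A B")
  case True
  then show ?thesis
    using hom_in_carrier[OF coset_hom, of "frag_of (a, b)"] by (simp add: pure_eq)
qed (simp add: pure_nonmatching)

lemma coset_rel:
  assumes "r \<in> tensor_rel A B" 
  shows "tensor_null A B #>\<^bsub>F\<^esub> r = \<one>\<^bsub>Q\<^esub>"
proof -
  have "r \<in> tensor_null A B" unfolding tensor_null_def using assms by (rule generate.incl)
  then show ?thesis
    using group.coset_join2[of F r "tensor_null A B"] null_subgroup subgroup.subset[OF null_subgroup]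
    by (auto simp: tensor_group_def)
qed

lemma coset_diff:
  assumes "x \<in> carrier F" "y \<in> carrier F" 
  shows "tensor_null A B #>\<^bsub>F\<^esub> (x - y) =
    (tensor_null A B #>\<^bsub>F\<^esub> x) \<otimes>\<^bsub>Q\<^esub> inv\<^bsub>Q\<^esub> (tensor_null A B #>\<^bsub>F\<^esub> y)"
proof -
  interpret h: group_hom F Q "\<lambda>x. tensor_null A B #>\<^bsub>F\<^esub> x"
    by (intro group_hom.intro group_hom_axioms.intro coset_hom Q.is_group group_free_Abelian_group)
  have "x - y = x \<otimes>\<^bsub>F\<^esub> inv\<^bsub>F\<^esub> y" using assms by simp
  then show ?thesis using assms h.hom_mult h.hom_inv
    by (metis h.G.inv_closed)
qed

text \<open>Each relator lies in the subgroup that is divided out, so its coset is neutral;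
  rearranged, this is the corresponding clause of \<open>balanced\<close>.\<close>

lemma pure_balanced: "balanced A B Q (\<lambda>(a, b). t a b)"
proof (rule balancedI; simp only: prod.case)
  fix \<alpha> \<beta> \<gamma> a a' b
  assume *: "a \<in> bigrade A \<alpha> \<gamma>" "a' \<in> bigrade A \<alpha> \<gamma>" "b \<in> bigrade B \<gamma> \<beta>"
  have fr: "frag_of (a, b) \<in> carrier F" "frag_of (a', b) \<in> carrier F" "frag_of (a \<oplus>\<^bsub>A\<^esub> a', b) \<in> carrier F"
    using * A.bigrade_add by (blast intro: frag_of_F)+
  from coset_rel[OF tensor_rel.add_left[OF *]]
  have "t (a \<oplus>\<^bsub>A\<^esub> a') b \<otimes>\<^bsub>Q\<^esub> inv\<^bsub>Q\<^esub> t a b \<otimes>\<^bsub>Q\<^esub> inv\<^bsub>Q\<^esub> t a' b = \<one>\<^bsub>Q\<^esub>"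
    using fr * A.bigrade_add[OF *(1,2)]
    by (simp add: coset_diff F_diff pure_eq matchingI del: carrier_free_Abelian_group_iff)
  then show "t (a \<oplus>\<^bsub>A\<^esub> a') b = t a b \<otimes>\<^bsub>Q\<^esub> t a' b"
    using pure_closed Q.inv_closed
    by (smt (verit) Q.inv_equality Q.inv_inv Q.inv_mult Q.m_assoc Q.m_closed)
next
  fix \<alpha> \<beta> \<gamma> a b b'
  assume *: "a \<in> bigrade A \<alpha> \<gamma>" "b \<in> bigrade B \<gamma> \<beta>" "b' \<in> bigrade B \<gamma> \<beta>"
  have fr: "frag_of (a, b) \<in> carrier F" "frag_of (a, b') \<in> carrier F" "frag_of (a, b \<oplus>\<^bsub>B\<^esub> b') \<in> carrier F"
    using * B.bigrade_add by (blast intro: frag_of_F)+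
  from coset_rel[OF tensor_rel.add_right[OF *]]
  have "t a (b \<oplus>\<^bsub>B\<^esub> b') \<otimes>\<^bsub>Q\<^esub> inv\<^bsub>Q\<^esub> t a b \<otimes>\<^bsub>Q\<^esub> inv\<^bsub>Q\<^esub> t a b' = \<one>\<^bsub>Q\<^esub>"
    using fr * B.bigrade_add[OF *(2,3)]
    by (simp add: coset_diff F_diff pure_eq matchingI del: carrier_free_Abelian_group_iff)
  then show "t a (b \<oplus>\<^bsub>B\<^esub> b') = t a b \<otimes>\<^bsub>Q\<^esub> t a b'"
    using pure_closed Q.inv_closed
    by (smt (verit) Q.inv_equality Q.inv_inv Q.inv_mult Q.m_assoc Q.m_closed)
next
  fix \<alpha> \<beta> \<gamma> a b f
  assume *: "a \<in> bigrade A \<alpha> \<gamma>" "b \<in> bigrade B \<gamma> \<beta>"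
  have fr: "frag_of (mom_r A f \<otimes>\<^bsub>A\<^esub> a, b) \<in> carrier F" "frag_of (a, mom_l B f \<otimes>\<^bsub>B\<^esub> b) \<in> carrier F"
    using * A.mom_r_bigrade B.mom_l_bigrade by (blast intro: frag_of_F)+
  from coset_rel[OF tensor_rel.balance[OF *]]
  have "t (mom_r A f \<otimes>\<^bsub>A\<^esub> a) b \<otimes>\<^bsub>Q\<^esub> inv\<^bsub>Q\<^esub> t a (mom_l B f \<otimes>\<^bsub>B\<^esub> b) = \<one>\<^bsub>Q\<^esub>"
    using fr matchingI[OF A.mom_r_bigrade[OF *(1)] *(2)] matchingI[OF *(1) B.mom_l_bigrade[OF *(2)]]
    by (simp add: coset_diff F_diff pure_eq del: carrier_free_Abelian_group_iff)
  then show "t (mom_r A f \<otimes>\<^bsub>A\<^esub> a) b = t a (mom_l B f \<otimes>\<^bsub>B\<^esub> b)"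
    using pure_closed by (metis Q.inv_closed Q.inv_equality Q.inv_inv)
qed (rule pure_closed)

lemma pure_zero_left:
  assumes "b \<in> bigrade B \<gamma> \<beta>" shows "t \<zero>\<^bsub>A\<^esub> b = \<one>\<^bsub>Q\<^esub>"
  using balancedD(2)[OF pure_balanced A.bigrade_zero assms A.bigrade_zero] pure_closed
  by simp

lemma pure_zero_right:
  assumes "a \<in> bigrade A \<alpha> \<gamma>" shows "t a \<zero>\<^bsub>B\<^esub> = \<one>\<^bsub>Q\<^esub>"
  using balancedD(3)[OF pure_balanced assms B.bigrade_zero B.bigrade_zero] pure_closed
  by simp

text \<open>Supplies the hypothesis of \<open>tensor_lift_coset\<close>: each kind of relator is
  killed by the corresponding clause of \<open>balanced\<close>.\<close>

lemma free_lift_rel: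
  assumes H: "comm_group H" and b: "balanced A B H \<Phi>" and r: "r \<in> tensor_rel A B"
  shows "free_lift H \<Phi> r = \<one>\<^bsub>H\<^esub>"
proof -
  interpret H: comm_group H by fact
  have car: "\<Phi> p \<in> carrier H" if "p \<in> matching A B" for p
    using that balancedD(1)[OF b] by (metis matchingE)
  interpret h: group_hom F H "free_lift H \<Phi>"
    by (intro group_hom.intro group_hom_axioms.intro free_lift_hom[OF H car] H.is_group group_free_Abelian_group)
  have diff: "free_lift H \<Phi> (x - y) = free_lift H \<Phi> x \<otimes>\<^bsub>H\<^esub> inv\<^bsub>H\<^esub> free_lift H \<Phi> y"
    if "x \<in> carrier F" "y \<in> carrier F" for x y
  proof -
    have "x - y = x \<otimes>\<^bsub>F\<^esub> inv\<^bsub>F\<^esub> y" using that by simp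
    then show ?thesis using that h.hom_mult h.hom_inv by (metis h.G.inv_closed)
  qed
  show ?thesis
    using r
  proof induction
    case (add_left a \<alpha> \<gamma> a' c \<beta>)
    then have "frag_of (a, c) \<in> carrier F" "frag_of (a', c) \<in> carrier F" "frag_of (a \<oplus>\<^bsub>A\<^esub> a', c) \<in> carrier F"
      using A.bigrade_add by (blast intro: frag_of_F)+
    with add_left balancedD[OF b] car show ?case
      by (simp add: diff F_diff free_lift_frag_of[OF H] balancedD[OF b] matchingI H.m_ac A.bigrade_add
          H.inv_mult[symmetric] del: carrier_free_Abelian_group_iff)
  next
    case (add_right a \<alpha> \<gamma> c \<beta> c')
    then have "frag_of (a, c) \<in> carrier F" "frag_of (a, c') \<in> carrier F" "frag_of (a, c \<oplus>\<^bsub>B\<^esub> c') \<in> carrier F"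
      using B.bigrade_add by (blast intro: frag_of_F)+
    with add_right balancedD[OF b] car show ?case
      by (simp add: diff F_diff free_lift_frag_of[OF H] balancedD[OF b] matchingI H.m_ac B.bigrade_add
          H.inv_mult[symmetric] del: carrier_free_Abelian_group_iff)
  next
    case (balance a \<alpha> \<gamma> c \<beta> f)
    then have "frag_of (mom_r A f \<otimes>\<^bsub>A\<^esub> a, c) \<in> carrier F" "frag_of (a, mom_l B f \<otimes>\<^bsub>B\<^esub> c) \<in> carrier F"
      using A.mom_r_bigrade B.mom_l_bigrade by (blast intro: frag_of_F)+
    moreover have "\<Phi> (mom_r A f \<otimes>\<^bsub>A\<^esub> a, c) = \<Phi> (a, mom_l B f \<otimes>\<^bsub>B\<^esub> c)" "\<Phi> (a, mom_l B f \<otimes>\<^bsub>B\<^esub> c) \<in> carrier H"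
      using balancedD(4)[OF b balance] balancedD(1)[OF b balance(1) B.mom_l_bigrade[OF balance(2)]] .
    ultimately show ?case
      by (simp add: diff free_lift_frag_of[OF H] del: carrier_free_Abelian_group_iff)
  qed
qed

lemma lift_coset:
  assumes H: "comm_group H" and b: "balanced A B H \<Phi>" and x: "x \<in> carrier F"
  shows "tensor_lift H \<Phi> (tensor_null A B #>\<^bsub>F\<^esub> x) = free_lift H \<Phi> x"
  by (rule tensor_lift_coset[OF H _ rel_carrier free_lift_rel[OF H b] x])
    (metis b balancedD(1) matchingE)

lemma lift_hom:
  assumes H: "comm_group H" and b: "balanced A B H \<Phi>"
  shows "tensor_lift H \<Phi> \<in> hom Q H"
proof -
  have car: "\<Phi> p \<in> carrier H" if "p \<in> matching A B" for p
    using that balancedD(1)[OF b] by (metis matchingE)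
  have h: "free_lift H \<Phi> \<in> hom F H" by (rule free_lift_hom[OF H car])
  show ?thesis
  proof (rule homI)
    fix X Y assume "X \<in> carrier Q" "Y \<in> carrier Q"
    then obtain x y where *: "x \<in> carrier F" "X = tensor_null A B #>\<^bsub>F\<^esub> x"
       "y \<in> carrier F" "Y = tensor_null A B #>\<^bsub>F\<^esub> y" by (metis Q_carrierE)
    have xy: "x \<otimes>\<^bsub>F\<^esub> y \<in> carrier F"
      by (rule monoid.m_closed) (use * in \<open>auto intro: group.is_monoid\<close>)
    show "tensor_lift H \<Phi> X \<in> carrier H"
      using * by (simp add: lift_coset[OF H b] hom_in_carrier[OF h] del: carrier_free_Abelian_group_iff)
    show "tensor_lift H \<Phi> (X \<otimes>\<^bsub>Q\<^esub> Y) = tensor_lift H \<Phi> X \<otimes>\<^bsub>H\<^esub> tensor_lift H \<Phi> Y"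
      unfolding *(2,4) hom_mult[OF coset_hom *(1,3), symmetric]
      by (simp only: lift_coset[OF H b] * xy hom_mult[OF h])
  qed
qed

lemma lift_pure:
  assumes H: "comm_group H" and b: "balanced A B H \<Phi>" 
    and ab: "x \<in> bigrade A \<alpha> \<gamma>" "y \<in> bigrade B \<gamma> \<beta>"
  shows "tensor_lift H \<Phi> (t x y) = \<Phi> (x, y)"
  using matchingI[OF ab] balancedD(1)[OF b ab]
  by (simp add: pure_eq lift_coset[OF H b] free_lift_frag_of[OF H] frag_of_F[OF ab] 
     del: carrier_free_Abelian_group_iff)

text \<open>Pure tensors of matching degrees generate the group, so later identities between
  additive maps on tensor products reduce to computations with two homogeneous elements.\<close>

lemma hom_eqI:
  assumes H: "group H" and hk: "h \<in> hom Q H" "k \<in> hom Q H"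
    and eq: "\<And>\<alpha> \<beta> \<gamma> a b. a \<in> bigrade A \<alpha> \<gamma> \<Longrightarrow> b \<in> bigrade B \<gamma> \<beta> \<Longrightarrow> h (t a b) = k (t a b)"
    and X: "X \<in> carrier Q"
  shows "h X = k X"
proof -
  interpret H: group H by fact
  obtain x where x: "x \<in> carrier F" "X = tensor_null A B #>\<^bsub>F\<^esub> x" using X by (metis Q_carrierE)
  interpret h: group_hom F H "\<lambda>x. h (tensor_null A B #>\<^bsub>F\<^esub> x)"
    using hom_compose[OF coset_hom hk(1)] H
    by (intro group_hom.intro group_hom_axioms.intro) (simp_all add: o_def)
  interpret k: group_hom F H "\<lambda>x. k (tensor_null A B #>\<^bsub>F\<^esub> x)"
    using hom_compose[OF coset_hom hk(2)] H
    by (intro group_hom.intro group_hom_axioms.intro) (simp_all add: o_def)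
  \<comment> \<open>Membership is carried along because the homomorphism laws, used in the
    difference step, hold only on the carrier.\<close>
  have "x \<in> carrier F \<and> h (tensor_null A B #>\<^bsub>F\<^esub> x) = k (tensor_null A B #>\<^bsub>F\<^esub> x)"
  proof (rule free_Abelian_group_induct[of x "matching A B"])
    show "Poly_Mapping.keys x \<subseteq> matching A B" using x by simp
    show "0 \<in> carrier F \<and> h (tensor_null A B #>\<^bsub>F\<^esub> 0) = k (tensor_null A B #>\<^bsub>F\<^esub> 0)"
      using h.hom_one k.hom_one by simp
    fix x y assume "Poly_Mapping.keys x \<subseteq> matching A B" "Poly_Mapping.keys y \<subseteq> matching A B"
      and *: "x \<in> carrier F \<and> h (tensor_null A B #>\<^bsub>F\<^esub> x) = k (tensor_null A B #>\<^bsub>F\<^esub> x)"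
        "y \<in> carrier F \<and> h (tensor_null A B #>\<^bsub>F\<^esub> y) = k (tensor_null A B #>\<^bsub>F\<^esub> y)"
    have "x - y = x \<otimes>\<^bsub>F\<^esub> inv\<^bsub>F\<^esub> y" using * by simp
    then show "x - y \<in> carrier F \<and> h (tensor_null A B #>\<^bsub>F\<^esub> (x - y)) = k (tensor_null A B #>\<^bsub>F\<^esub> (x - y))"
      using * F_diff h.hom_mult h.hom_inv k.hom_mult k.hom_inv h.G.inv_closed by metis
  next
    fix p assume p: "p \<in> matching A B"
    then show "frag_of p \<in> carrier F \<and> h (tensor_null A B #>\<^bsub>F\<^esub> frag_of p) = k (tensor_null A B #>\<^bsub>F\<^esub> frag_of p)"
      by (elim matchingE) (use eq in \<open>auto simp: pure_eq matchingI\<close>)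
  qed
  then show ?thesis using x by simp
qed

lemma pure_bigrade_carrier: "pure_bigrade A B \<alpha> \<beta> \<subseteq> carrier Q"
  unfolding pure_bigrade_def using pure_closed by blast

lemma bigrade_mtensor_carrier: "X \<in> bigrade (mtensor A B) \<alpha> \<beta> \<Longrightarrow> X \<in> carrier Q"
  unfolding bigrade_mtensor using Q.generate_in_carrier[OF pure_bigrade_carrier] .

lemma pure_in_bigrade:
  "a \<in> bigrade A \<alpha> \<gamma> \<Longrightarrow> b \<in> bigrade B \<gamma> \<beta> \<Longrightarrow> t a b \<in> bigrade (mtensor A B) \<alpha> \<beta>"
  unfolding bigrade_mtensor by (rule generate.incl) (auto simp: pure_bigrade_def)

text \<open>Restricts the comparison to the generators of one bidegree, for maps whose agreement
  depends on the outer degrees.\<close>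

lemma hom_eq_bigradeI:
  assumes "group H" "h \<in> hom Q H" "k \<in> hom Q H"
    and "\<And>\<gamma> a b. a \<in> bigrade A \<alpha> \<gamma> \<Longrightarrow> b \<in> bigrade B \<gamma> \<beta> \<Longrightarrow> h (t a b) = k (t a b)"
    and "X \<in> bigrade (mtensor A B) \<alpha> \<beta>"
  shows "h X = k X"
  using assms(5) unfolding bigrade_mtensor
  by (rule hom_eq_on_generate[OF Q.is_group assms(1-3) pure_bigrade_carrier, rotated])
    (use assms(4) in \<open>auto simp: pure_bigrade_def\<close>)

lemma hom_closed_bigradeI:
  assumes "group H" "h \<in> hom Q H" "subgroup K H"
    and "\<And>\<gamma> a b. a \<in> bigrade A \<alpha> \<gamma> \<Longrightarrow> b \<in> bigrade B \<gamma> \<beta> \<Longrightarrow> h (t a b) \<in> K"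
    and "X \<in> bigrade (mtensor A B) \<alpha> \<beta>"
  shows "h X \<in> K"
  using assms(5) unfolding bigrade_mtensor
  by (rule hom_generate_closed[OF Q.is_group assms(1,2) pure_bigrade_carrier assms(3), rotated])
    (use assms(4) in \<open>auto simp: pure_bigrade_def\<close>)

lemma abelian_group_mtensor: "abelian_group (mtensor A B)"
proof -
  have "comm_group (add_monoid (mtensor A B))"
    by (rule comm_groupI) (simp_all add: Q.m_ac Q.l_inv_ex)
  then show ?thesis
    unfolding abelian_group_def abelian_monoid_def abelian_group_axioms_def
    by (simp add: comm_group.axioms)
qed

text \<open>The additive monoid of \<open>mtensor A B\<close> and \<open>tensor_group A B\<close>
  are different records with the same carrier and operation; this lemma and the next pass between
  them.\<close>

lemma hom_add_mtensor:
  "h \<in> hom G (add_monoid (mtensor A B)) \<longleftrightarrow> h \<in> hom G Q"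
  by (simp add: hom_def)

lemma balanced_add_mtensor:
  "balanced C D (add_monoid (mtensor A B)) \<Phi> \<longleftrightarrow> balanced C D Q \<Phi>"
  by (simp add: balanced_def)

end

section \<open>Multiplication in the matrix tensor product\<close>

lemma shift_shift: "shift \<alpha> (shift \<beta> f) = shift (\<alpha> + \<beta>) f"
  by transfer (simp add: meromorphic_fun_shift generically_eq_refl add.assoc)

lemma shift_0 [simp]: "shift 0 f = f"
  by transfer (simp add: meromorphic_fun_shift generically_eq_refl)

lemma shift_mult: "shift \<alpha> (f * g) = shift \<alpha> f * shift \<alpha> g"
  by transfer (simp add: meromorphic_fun_shift meromorphic_fun_mult generically_eq_refl)

lemma shift_const [simp]: "shift \<alpha> (const_merom c) = const_merom c"
  by transfer (simp add: meromorphic_fun_const generically_eq_refl)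

lemma const_merom_1: "const_merom 1 = 1"
  by transfer (simp add: meromorphic_fun_const generically_eq_refl)

lemma const_merom_0: "const_merom 0 = 0"
  by transfer (simp add: meromorphic_fun_const generically_eq_refl)

lemma const_merom_mult: "const_merom c * const_merom d = const_merom (c * d)"
  by transfer (simp add: meromorphic_fun_const generically_eq_refl)

lemma shift_1 [simp]: "shift \<alpha> 1 = 1"
  by (metis const_merom_1 shift_const)

lemma shift_zero_merom [simp]: "shift \<alpha> 0 = 0"
  by (metis const_merom_0 shift_const)

lemma hom_mult2:
  assumes "comm_group H" "h \<in> hom G H" "k \<in> hom G H"
  shows "(\<lambda>x. h x \<otimes>\<^bsub>H\<^esub> k x) \<in> hom G H"
proof -
  interpret H: comm_group H by fact
  show ?thesis
    by (rule homI) (simp_all add: hom_in_carrier[OF assms(2)] hom_in_carrier[OF assms(3)]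
        hom_mult[OF assms(2)] hom_mult[OF assms(3)] H.m_ac)
qed

lemma balanced_hom:
  assumes "balanced A B G \<Phi>" "h \<in> hom G H"
  shows "balanced A B H (\<lambda>p. h (\<Phi> p))"
  by (rule balancedI)
    (auto simp: balancedD[OF assms(1)] hom_mult[OF assms(2)] intro: hom_in_carrier[OF assms(2)])

context h_algebra
begin

lemma mom_l_in: "mom_l A f \<in> bigrade A 0 0"
  and mom_r_in: "mom_r A f \<in> bigrade A 0 0"
  using mom_l_embedding mom_r_embedding unfolding moment_embedding_def by auto

sublocale moment_graded A
proof (intro moment_graded.intro moment_graded_axioms.intro)
  show "abelian_group A" by (rule is_abelian_group)
  fix \<alpha> \<beta> x f
  show "subgroup (bigrade A \<alpha> \<beta>) (add_monoid A)"
    using bigrade_submodule by (simp add: submodule_def)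
  assume "x \<in> bigrade A \<alpha> \<beta>"
  then show "mom_l A f \<otimes> x \<in> bigrade A \<alpha> \<beta>" "mom_r A f \<otimes> x \<in> bigrade A \<alpha> \<beta>"
    using bigrade_mult[OF mom_l_in] bigrade_mult[OF mom_r_in] by fastforce+
qed

lemma mom_l_closed [simp, intro]: "mom_l A f \<in> carrier A"
  and mom_r_closed [simp, intro]: "mom_r A f \<in> carrier A"
  using mom_l_in mom_r_in bigrade_carrier by blast+

lemma mom_r_mult: "mom_r A (f * g) = mom_r A f \<otimes> mom_r A g"
  and mom_r_add: "mom_r A (f + g) = mom_r A f \<oplus> mom_r A g"
  and mom_l_one [simp]: "mom_l A 1 = \<one>"
  and mom_r_one [simp]: "mom_r A 1 = \<one>"
  using mom_l_embedding mom_r_embedding unfolding moment_embedding_def by auto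

lemma mom_l_shift_right: "x \<in> bigrade A \<alpha> \<beta> \<Longrightarrow> x \<otimes> mom_l A f = mom_l A (shift (- \<alpha>) f) \<otimes> x"
  using mom_l_shift[of x \<alpha> \<beta> "shift (- \<alpha>) f"] by (simp add: shift_shift)

lemma mom_r_shift_right: "x \<in> bigrade A \<alpha> \<beta> \<Longrightarrow> x \<otimes> mom_r A f = mom_r A (shift (- \<beta>) f) \<otimes> x"
  using mom_r_shift[of x \<alpha> \<beta> "shift (- \<beta>) f"] by (simp add: shift_shift)

lemma mom_l_mom_r: "mom_l A f \<otimes> mom_r A g = mom_r A g \<otimes> mom_l A f"
  using mom_l_shift[OF mom_r_in] by simp

lemma one_in: "\<one> \<in> bigrade A 0 0"
  using mom_l_in[of 1] by simp

lemma hom_eq_on_bigrade: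
  assumes "group H" "h \<in> hom (add_monoid A) H" "k \<in> hom (add_monoid A) H"
    and "\<And>\<alpha> \<beta> x. x \<in> bigrade A \<alpha> \<beta> \<Longrightarrow> h x = k x" and "x \<in> carrier A"
  shows "h x = k x"
proof -
  interpret h: group_hom "add_monoid A" H h
    by (intro group_hom.intro group_hom_axioms.intro assms add.is_group)
  interpret k: group_hom "add_monoid A" H k
    by (intro group_hom.intro group_hom_axioms.intro assms add.is_group)
  obtain I w where Iw: "finite I" "\<forall>(\<alpha>, \<beta>)\<in>I. w (\<alpha>, \<beta>) \<in> bigrade A \<alpha> \<beta>" "x = (\<Oplus>p\<in>I. w p)"
    using bigrade_span assms(5) by blast
  have "h (\<Oplus>p\<in>I. w p) = k (\<Oplus>p\<in>I. w p)"
    using Iw(1,2)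
  proof (induction I rule: finite_induct)
    case empty
    then show ?case using h.hom_one k.hom_one by simp
  next
    case (insert p I)
    obtain \<alpha> \<beta> where p: "p = (\<alpha>, \<beta>)" by (cases p)
    have w: "w \<in> I \<rightarrow> carrier A" "w p \<in> carrier A" "h (w p) = k (w p)"
      using insert.prems p assms(4) bigrade_carrier by auto
    then show ?case
      using insert h.hom_mult[of "w p" "\<Oplus>p\<in>I. w p"] k.hom_mult[of "w p" "\<Oplus>p\<in>I. w p"] by simp
  qed
  with Iw show ?thesis by simp
qed

lemma hom_l_mult: "a \<in> carrier A \<Longrightarrow> (\<lambda>x. a \<otimes> x) \<in> hom (add_monoid A) (add_monoid A)"
  by (auto simp: hom_def r_distr)

lemma hom_r_mult: "a \<in> carrier A \<Longrightarrow> (\<lambda>x. x \<otimes> a) \<in> hom (add_monoid A) (add_monoid A)"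
  by (auto simp: hom_def l_distr)

end

section \<open>Factorwise multiplication\<close>

locale h_algebra_pair = A: h_algebra A + B: h_algebra B
  for A :: "('v::complex_fd_space, 'a) halg" and B :: "('v, 'b) halg"
begin

sublocale tensor_pair A B ..

text \<open>Moving \<open>mom_r A f\<close> to the left past a and \<open>mom_l B f\<close> to the
  left past b shifts f by - \<gamma> in both cases, because the right degree of a is the left degree
  of b.\<close>

lemma pure_mult_balanced:
  assumes a: "a \<in> bigrade A \<alpha> \<gamma>" and b: "b \<in> bigrade B \<gamma> \<beta>"
  shows "balanced A B Q (\<lambda>(c, d). t (a \<otimes>\<^bsub>A\<^esub> c) (b \<otimes>\<^bsub>B\<^esub> d))"
proof (rule balancedI; simp only: prod.case)
  have ab: "a \<in> carrier A" "b \<in> carrier B" using a b A.bigrade_carrier B.bigrade_carrier by auto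
  fix \<alpha>' \<beta>' \<gamma>' c d
  assume c: "c \<in> bigrade A \<alpha>' \<gamma>'" and d: "d \<in> bigrade B \<gamma>' \<beta>'"
  note cd = c[THEN A.bigrade_carrier] d[THEN B.bigrade_carrier]
  note ac = A.bigrade_mult[OF a c] and bd = B.bigrade_mult[OF b d]
  show "t (a \<otimes>\<^bsub>A\<^esub> (c \<oplus>\<^bsub>A\<^esub> c')) (b \<otimes>\<^bsub>B\<^esub> d) = t (a \<otimes>\<^bsub>A\<^esub> c) (b \<otimes>\<^bsub>B\<^esub> d) \<otimes>\<^bsub>Q\<^esub> t (a \<otimes>\<^bsub>A\<^esub> c') (b \<otimes>\<^bsub>B\<^esub> d)"
    if "c' \<in> bigrade A \<alpha>' \<gamma>'" for c'
    using balancedD(2)[OF pure_balanced ac bd A.bigrade_mult[OF a that]] ab cd that A.bigrade_carrier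
    by (simp add: A.r_distr)
  show "t (a \<otimes>\<^bsub>A\<^esub> c) (b \<otimes>\<^bsub>B\<^esub> (d \<oplus>\<^bsub>B\<^esub> d')) = t (a \<otimes>\<^bsub>A\<^esub> c) (b \<otimes>\<^bsub>B\<^esub> d) \<otimes>\<^bsub>Q\<^esub> t (a \<otimes>\<^bsub>A\<^esub> c) (b \<otimes>\<^bsub>B\<^esub> d')"
    if "d' \<in> bigrade B \<gamma>' \<beta>'" for d'
    using balancedD(3)[OF pure_balanced ac bd B.bigrade_mult[OF b that]] ab cd that B.bigrade_carrier
    by (simp add: B.r_distr)
  show "t (a \<otimes>\<^bsub>A\<^esub> (mom_r A f \<otimes>\<^bsub>A\<^esub> c)) (b \<otimes>\<^bsub>B\<^esub> d) = t (a \<otimes>\<^bsub>A\<^esub> c) (b \<otimes>\<^bsub>B\<^esub> (mom_l B f \<otimes>\<^bsub>B\<^esub> d))" for f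
  proof -
    have "a \<otimes>\<^bsub>A\<^esub> (mom_r A f \<otimes>\<^bsub>A\<^esub> c) = mom_r A (shift (- \<gamma>) f) \<otimes>\<^bsub>A\<^esub> (a \<otimes>\<^bsub>A\<^esub> c)"
      using A.mom_r_shift_right[OF a] ab cd by (metis A.m_assoc A.mom_r_closed)
    moreover have "b \<otimes>\<^bsub>B\<^esub> (mom_l B f \<otimes>\<^bsub>B\<^esub> d) = mom_l B (shift (- \<gamma>) f) \<otimes>\<^bsub>B\<^esub> (b \<otimes>\<^bsub>B\<^esub> d)"
      using B.mom_l_shift_right[OF b] ab cd by (metis B.m_assoc B.mom_l_closed)
    ultimately show ?thesis
      using balancedD(4)[OF pure_balanced ac bd] by simp
  qed
qed (rule pure_closed)

text \<open>The inner lift in the multiplication of \<open>mtensor\<close>, isolated so that its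
  dependence on the pair (a, b) can be shown to be balanced.\<close>

definition mult_pure where
  "mult_pure Y = (\<lambda>(a, b). tensor_lift Q (\<lambda>(c, d). t (a \<otimes>\<^bsub>A\<^esub> c) (b \<otimes>\<^bsub>B\<^esub> d)) Y)"

lemma mult_pure_hom:
  "a \<in> bigrade A \<alpha> \<gamma> \<Longrightarrow> b \<in> bigrade B \<gamma> \<beta> \<Longrightarrow> (\<lambda>Y. mult_pure Y (a, b)) \<in> hom Q Q"
  using lift_hom[OF Q_comm pure_mult_balanced] by (simp add: mult_pure_def)

lemma mult_pure_pure:
  "a \<in> bigrade A \<alpha> \<gamma> \<Longrightarrow> b \<in> bigrade B \<gamma> \<beta> \<Longrightarrow> c \<in> bigrade A \<alpha>' \<gamma>' \<Longrightarrow> d \<in> bigrade B \<gamma>' \<beta>' \<Longrightarrow>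
    mult_pure (t c d) (a, b) = t (a \<otimes>\<^bsub>A\<^esub> c) (b \<otimes>\<^bsub>B\<^esub> d)"
  using lift_pure[OF Q_comm pure_mult_balanced] by (simp add: mult_pure_def)

text \<open>Both sides of each rule are additive in Y, so Y may be taken pure. In contrast to
  \<open>pure_mult_balanced\<close>, balancing involves no shift, since the moment maps already
  stand at the far left.\<close>

lemma mult_pure_balanced:
  assumes Y: "Y \<in> carrier Q"
  shows "balanced A B Q (mult_pure Y)"
proof (rule balancedI)
  fix \<alpha> \<beta> \<gamma> a b
  assume a: "a \<in> bigrade A \<alpha> \<gamma>" and b: "b \<in> bigrade B \<gamma> \<beta>"
  note ab = a[THEN A.bigrade_carrier] b[THEN B.bigrade_carrier]
  show "mult_pure Y (a, b) \<in> carrier Q"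
    by (rule hom_in_carrier[OF mult_pure_hom[OF a b] Y])
  show "mult_pure Y (a \<oplus>\<^bsub>A\<^esub> a', b) = mult_pure Y (a, b) \<otimes>\<^bsub>Q\<^esub> mult_pure Y (a', b)"
    if a': "a' \<in> bigrade A \<alpha> \<gamma>" for a'
  proof (rule hom_eqI[OF Q.is_group mult_pure_hom[OF A.bigrade_add[OF a a'] b]
        hom_mult2[OF Q_comm mult_pure_hom[OF a b] mult_pure_hom[OF a' b]] _ Y])
    fix \<alpha>' \<beta>' \<gamma>' c d
    assume c: "c \<in> bigrade A \<alpha>' \<gamma>'" and d: "d \<in> bigrade B \<gamma>' \<beta>'"
    show "mult_pure (t c d) (a \<oplus>\<^bsub>A\<^esub> a', b) = mult_pure (t c d) (a, b) \<otimes>\<^bsub>Q\<^esub> mult_pure (t c d) (a', b)"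
      unfolding mult_pure_pure[OF A.bigrade_add[OF a a'] b c d] mult_pure_pure[OF a b c d]
        mult_pure_pure[OF a' b c d]
        A.l_distr[OF ab(1) a'[THEN A.bigrade_carrier] c[THEN A.bigrade_carrier]]
      by (rule balancedD(2)[OF pure_balanced A.bigrade_mult[OF a c] B.bigrade_mult[OF b d]
            A.bigrade_mult[OF a' c], simplified])
  qed
  show "mult_pure Y (a, b \<oplus>\<^bsub>B\<^esub> b') = mult_pure Y (a, b) \<otimes>\<^bsub>Q\<^esub> mult_pure Y (a, b')"
    if b': "b' \<in> bigrade B \<gamma> \<beta>" for b'
  proof (rule hom_eqI[OF Q.is_group mult_pure_hom[OF a B.bigrade_add[OF b b']]
        hom_mult2[OF Q_comm mult_pure_hom[OF a b] mult_pure_hom[OF a b']] _ Y])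
    fix \<alpha>' \<beta>' \<gamma>' c d
    assume c: "c \<in> bigrade A \<alpha>' \<gamma>'" and d: "d \<in> bigrade B \<gamma>' \<beta>'"
    show "mult_pure (t c d) (a, b \<oplus>\<^bsub>B\<^esub> b') = mult_pure (t c d) (a, b) \<otimes>\<^bsub>Q\<^esub> mult_pure (t c d) (a, b')"
      unfolding mult_pure_pure[OF a B.bigrade_add[OF b b'] c d] mult_pure_pure[OF a b c d]
        mult_pure_pure[OF a b' c d]
        B.l_distr[OF ab(2) b'[THEN B.bigrade_carrier] d[THEN B.bigrade_carrier]]
      by (rule balancedD(3)[OF pure_balanced A.bigrade_mult[OF a c] B.bigrade_mult[OF b d]
            B.bigrade_mult[OF b' d], simplified])
  qed
  show "mult_pure Y (mom_r A f \<otimes>\<^bsub>A\<^esub> a, b) = mult_pure Y (a, mom_l B f \<otimes>\<^bsub>B\<^esub> b)" for f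
  proof (rule hom_eqI[OF Q.is_group mult_pure_hom[OF A.mom_r_bigrade[OF a] b]
        mult_pure_hom[OF a B.mom_l_bigrade[OF b]] _ Y])
    fix \<alpha>' \<beta>' \<gamma>' c d
    assume c: "c \<in> bigrade A \<alpha>' \<gamma>'" and d: "d \<in> bigrade B \<gamma>' \<beta>'"
    show "mult_pure (t c d) (mom_r A f \<otimes>\<^bsub>A\<^esub> a, b) = mult_pure (t c d) (a, mom_l B f \<otimes>\<^bsub>B\<^esub> b)"
      unfolding mult_pure_pure[OF A.mom_r_bigrade[OF a] b c d] mult_pure_pure[OF a B.mom_l_bigrade[OF b] c d]
        A.m_assoc[OF A.mom_r_closed ab(1) c[THEN A.bigrade_carrier]]
        B.m_assoc[OF B.mom_l_closed ab(2) d[THEN B.bigrade_carrier]]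
      by (rule balancedD(4)[OF pure_balanced A.bigrade_mult[OF a c] B.bigrade_mult[OF b d], simplified])
  qed
qed

lemma mtensor_mult_eq: "X \<otimes>\<^bsub>mtensor A B\<^esub> Y = tensor_lift Q (mult_pure Y) X"
  by (simp add: mtensor_mult mult_pure_def)

lemma mult_hom_left: "Y \<in> carrier Q \<Longrightarrow> (\<lambda>X. X \<otimes>\<^bsub>mtensor A B\<^esub> Y) \<in> hom Q Q"
  unfolding mtensor_mult_eq by (rule lift_hom[OF Q_comm mult_pure_balanced])

lemma pure_mult_eq:
  "a \<in> bigrade A \<alpha> \<gamma> \<Longrightarrow> b \<in> bigrade B \<gamma> \<beta> \<Longrightarrow> Y \<in> carrier Q \<Longrightarrow>
    t a b \<otimes>\<^bsub>mtensor A B\<^esub> Y = mult_pure Y (a, b)"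
  unfolding mtensor_mult_eq by (rule lift_pure[OF Q_comm mult_pure_balanced])

lemma pure_mult_pure:
  "a \<in> bigrade A \<alpha> \<gamma> \<Longrightarrow> b \<in> bigrade B \<gamma> \<beta> \<Longrightarrow> c \<in> bigrade A \<alpha>' \<gamma>' \<Longrightarrow> d \<in> bigrade B \<gamma>' \<beta>' \<Longrightarrow>
    t a b \<otimes>\<^bsub>mtensor A B\<^esub> t c d = t (a \<otimes>\<^bsub>A\<^esub> c) (b \<otimes>\<^bsub>B\<^esub> d)"
  by (simp add: pure_mult_eq pure_closed mult_pure_pure)

text \<open>Both sides are additive in X, and for pure X the claim is additivity of the inner
  lift.\<close>

lemma mult_hom_right:
  assumes X: "X \<in> carrier Q"
  shows "(\<lambda>Y. X \<otimes>\<^bsub>mtensor A B\<^esub> Y) \<in> hom Q Q"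
proof (rule homI)
  fix Y Z assume YZ: "Y \<in> carrier Q" "Z \<in> carrier Q"
  show "X \<otimes>\<^bsub>mtensor A B\<^esub> Y \<in> carrier Q" by (rule hom_in_carrier[OF mult_hom_left[OF YZ(1)] X])
  show "X \<otimes>\<^bsub>mtensor A B\<^esub> (Y \<otimes>\<^bsub>Q\<^esub> Z) = X \<otimes>\<^bsub>mtensor A B\<^esub> Y \<otimes>\<^bsub>Q\<^esub> (X \<otimes>\<^bsub>mtensor A B\<^esub> Z)"
    by (rule hom_eqI[OF Q.is_group mult_hom_left[OF Q.m_closed[OF YZ]]
          hom_mult2[OF Q_comm mult_hom_left[OF YZ(1)] mult_hom_left[OF YZ(2)]] _ X])
      (simp add: YZ pure_mult_eq hom_mult[OF mult_pure_hom YZ])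
qed

lemma mom_l_mult_pure:
  "a \<in> bigrade A \<alpha> \<gamma> \<Longrightarrow> b \<in> bigrade B \<gamma> \<beta> \<Longrightarrow>
    mom_l (mtensor A B) f \<otimes>\<^bsub>mtensor A B\<^esub> t a b = t (mom_l A f \<otimes>\<^bsub>A\<^esub> a) b"
  using pure_mult_pure[OF A.mom_l_in B.one_in] by (simp add: B.bigrade_carrier)

lemma mom_r_mult_pure:
  "a \<in> bigrade A \<alpha> \<gamma> \<Longrightarrow> b \<in> bigrade B \<gamma> \<beta> \<Longrightarrow>
    mom_r (mtensor A B) f \<otimes>\<^bsub>mtensor A B\<^esub> t a b = t a (mom_r B f \<otimes>\<^bsub>B\<^esub> b)"
  using pure_mult_pure[OF A.one_in B.mom_r_in] by (simp add: A.bigrade_carrier)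

lemma mom_l_mult_hom: "(\<lambda>X. mom_l (mtensor A B) f \<otimes>\<^bsub>mtensor A B\<^esub> X) \<in> hom Q Q"
  and mom_r_mult_hom: "(\<lambda>X. mom_r (mtensor A B) f \<otimes>\<^bsub>mtensor A B\<^esub> X) \<in> hom Q Q"
  by (rule mult_hom_right, simp add: pure_closed)+

text \<open>Permits a further tensor product on either side, as coassociativity requires.\<close>

lemma moment_graded_mtensor: "moment_graded (mtensor A B)"
proof (intro moment_graded.intro moment_graded_axioms.intro abelian_group_mtensor)
  have sub: "subgroup (bigrade (mtensor A B) \<alpha> \<beta>) Q" for \<alpha> \<beta>
    unfolding bigrade_mtensor by (rule Q.generate_is_subgroup[OF pure_bigrade_carrier])
  show "subgroup (bigrade (mtensor A B) \<alpha> \<beta>) (add_monoid (mtensor A B))" for \<alpha> \<beta>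
  proof -
    interpret s: subgroup "bigrade (mtensor A B) \<alpha> \<beta>" Q by (rule sub)
    interpret M: abelian_group "mtensor A B" by (rule abelian_group_mtensor)
    show ?thesis
    proof (rule M.add.subgroupI)
      show "bigrade (mtensor A B) \<alpha> \<beta> \<subseteq> carrier (mtensor A B)" using s.subset by simp
      show "bigrade (mtensor A B) \<alpha> \<beta> \<noteq> {}" using s.one_closed by blast
      fix X assume X: "X \<in> bigrade (mtensor A B) \<alpha> \<beta>"
      have "inv\<^bsub>Q\<^esub> X = \<ominus>\<^bsub>mtensor A B\<^esub> X"
        using X s.mem_carrier[OF X]
        by (intro M.minus_equality[symmetric]) simp_all
      then show "\<ominus>\<^bsub>mtensor A B\<^esub> X \<in> bigrade (mtensor A B) \<alpha> \<beta>" using s.m_inv_closed[OF X] by simp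
    qed (simp add: s.m_closed)
  qed
  fix X \<alpha> \<beta> f assume X: "X \<in> bigrade (mtensor A B) \<alpha> \<beta>"
  show "mom_l (mtensor A B) f \<otimes>\<^bsub>mtensor A B\<^esub> X \<in> bigrade (mtensor A B) \<alpha> \<beta>"
    by (rule hom_closed_bigradeI[OF Q.is_group mom_l_mult_hom sub _ X])
      (simp only: mom_l_mult_pure pure_in_bigrade[OF A.mom_l_bigrade])
  show "mom_r (mtensor A B) f \<otimes>\<^bsub>mtensor A B\<^esub> X \<in> bigrade (mtensor A B) \<alpha> \<beta>"
    by (rule hom_closed_bigradeI[OF Q.is_group mom_r_mult_hom sub _ X])
      (simp only: mom_r_mult_pure pure_in_bigrade[OF _ B.mom_r_bigrade])
qed

end

section \<open>Difference operators\<close>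

lemma Dh_simps:
  "\<zero>\<^bsub>Dh\<^esub> = (\<lambda>_. 0)" "D \<oplus>\<^bsub>Dh\<^esub> E = (\<lambda>g. D g + E g)" "D \<otimes>\<^bsub>Dh\<^esub> E = D \<circ> E" "\<one>\<^bsub>Dh\<^esub> = id"
  "mom_l Dh f = (*) f" "mom_r Dh f = (*) f" "carrier Dh = {diffop I f |I f. finite I}"
  "bigrade Dh \<alpha> \<beta> = (if \<alpha> = \<beta> then {\<lambda>g. f * shift (- \<beta>) g |f. True} else {\<lambda>_. 0})"
  by (simp_all add: Dh_def)

text \<open>Padding with zero coefficients brings two operators to a common index set.\<close>

lemma diffop_extend:
  assumes "finite J" "I \<subseteq> J"
  shows "diffop I f = diffop J (\<lambda>\<beta>. if \<beta> \<in> I then f \<beta> else 0)"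
  unfolding diffop_def
  using assms by (intro ext sum.mono_neutral_cong_left) auto

lemma moment_graded_Dh: "moment_graded (Dh :: ('v::complex_fd_space, _) halg)"
proof -
  let ?D = "Dh :: ('v, _) halg"
  have "comm_group (add_monoid ?D)"
  proof (rule comm_groupI)
    fix D E assume "D \<in> carrier (add_monoid ?D)" "E \<in> carrier (add_monoid ?D)"
    then obtain I f J g where *: "finite I" "finite J" "D = diffop I f" "E = diffop J g"
      by (auto simp: Dh_simps)
    have "D = diffop (I \<union> J) (\<lambda>\<beta>. if \<beta> \<in> I then f \<beta> else 0)" "E = diffop (I \<union> J) (\<lambda>\<beta>. if \<beta> \<in> J then g \<beta> else 0)"
      unfolding * by (rule diffop_extend, use * in auto)+
    then have "(\<lambda>h. D h + E h) = diffop (I \<union> J) (\<lambda>\<beta>. (if \<beta> \<in> I then f \<beta> else 0) + (if \<beta> \<in> J then g \<beta> else 0))"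
      by (simp add: diffop_def fun_eq_iff sum.distrib distrib_right)
    then show "D \<otimes>\<^bsub>add_monoid ?D\<^esub> E \<in> carrier (add_monoid ?D)" using * by (auto simp: Dh_simps)
  next
    have "(\<lambda>_. 0) = diffop {} (\<lambda>_. 0)" by (simp add: diffop_def)
    then show "\<one>\<^bsub>add_monoid ?D\<^esub> \<in> carrier (add_monoid ?D)" by (auto simp: Dh_simps)
  next
    fix D assume "D \<in> carrier (add_monoid ?D)"
    then obtain I f where *: "finite I" "D = diffop I f" by (auto simp: Dh_simps)
    have "diffop I (\<lambda>\<beta>. - f \<beta>) \<in> carrier ?D" using *(1) by (auto simp: Dh_simps)
    then show "\<exists>E\<in>carrier (add_monoid ?D). E \<otimes>\<^bsub>add_monoid ?D\<^esub> D = \<one>\<^bsub>add_monoid ?D\<^esub>"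
      by (intro bexI[of _ "diffop I (\<lambda>\<beta>. - f \<beta>)"])
        (simp_all add: Dh_simps(1,2) fun_eq_iff *(2), simp add: diffop_def sum_negf)
  qed (simp_all add: Dh_simps(1,2) add_ac)
  then interpret abelian_group ?D
    unfolding abelian_group_def abelian_monoid_def abelian_group_axioms_def
    by (simp add: comm_group.axioms)
  show ?thesis
  proof (intro moment_graded.intro moment_graded_axioms.intro abelian_group_axioms)
    fix \<alpha> \<beta> :: 'v
    show "subgroup (bigrade ?D \<alpha> \<beta>) (add_monoid ?D)"
    proof (rule add.subgroupI)
      show "bigrade ?D \<alpha> \<beta> \<subseteq> carrier ?D"
      proof
        fix D assume "D \<in> bigrade ?D \<alpha> \<beta>"
        \<comment> \<open>Off the diagonal the only element is zero; it is written with coefficient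
          0.\<close>
        then obtain f where "D = diffop {- \<beta>} (\<lambda>_. f)"
          by (auto simp: Dh_simps diffop_def split: if_splits intro: that[of 0])
        then show "D \<in> carrier ?D" unfolding Dh_simps by blast
      qed
      then have car: "D \<in> bigrade ?D \<alpha> \<beta> \<Longrightarrow> D \<in> carrier ?D" for D by blast
      show "bigrade ?D \<alpha> \<beta> \<noteq> {}" by (auto simp: Dh_simps)
      fix D assume D: "D \<in> bigrade ?D \<alpha> \<beta>"
      have E: "(\<lambda>g. - D g) \<in> bigrade ?D \<alpha> \<beta>"
        using D by (auto simp: Dh_simps split: if_splits) (metis mult_minus_left)
      have "\<ominus>\<^bsub>?D\<^esub> D = (\<lambda>g. - D g)"
        by (rule minus_equality[OF _ car[OF D] car[OF E]]) (simp add: Dh_simps)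
      with E show "\<ominus>\<^bsub>?D\<^esub> D \<in> bigrade ?D \<alpha> \<beta>" by simp
      fix D' assume "D' \<in> bigrade ?D \<alpha> \<beta>"
      then obtain f f' where f: "D = (\<lambda>g. f * shift (- \<beta>) g)" "D' = (\<lambda>g. f' * shift (- \<beta>) g)"
        and \<alpha>: "\<alpha> \<noteq> \<beta> \<Longrightarrow> f = 0" "\<alpha> \<noteq> \<beta> \<Longrightarrow> f' = 0"
        using D by (auto simp: Dh_simps(8) split: if_splits intro: that[of 0 0])
      have "D \<oplus>\<^bsub>?D\<^esub> D' = (\<lambda>g. (f + f') * shift (- \<beta>) g)"
        unfolding f Dh_simps(2) by (simp add: distrib_right)
      then show "D \<oplus>\<^bsub>?D\<^esub> D' \<in> bigrade ?D \<alpha> \<beta>"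
        using \<alpha> by (auto simp: Dh_simps(8))
    qed
    fix D f assume "D \<in> bigrade ?D \<alpha> \<beta>"
    then obtain h where h: "D = (\<lambda>g. h * shift (- \<beta>) g)" and \<alpha>: "\<alpha> \<noteq> \<beta> \<Longrightarrow> h = 0"
      by (auto simp: Dh_simps(8) split: if_splits intro: that[of 0])
    have "(*) f \<circ> D = (\<lambda>g. (f * h) * shift (- \<beta>) g)"
      unfolding h o_def by (simp add: mult.assoc)
    then have "(*) f \<circ> D \<in> bigrade ?D \<alpha> \<beta>" using \<alpha> by (auto simp: Dh_simps(8))
    then show "mom_l ?D f \<otimes>\<^bsub>?D\<^esub> D \<in> bigrade ?D \<alpha> \<beta>" "mom_r ?D f \<otimes>\<^bsub>?D\<^esub> D \<in> bigrade ?D \<alpha> \<beta>"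
      by (simp_all add: Dh_simps(3,5,6))
  qed
qed

text \<open>Shifts fix the constant 1, so a homogeneous operator has its value at 1 as
  coefficient.\<close>

lemma Dh_apply_1:
  assumes "D \<in> bigrade Dh \<alpha> \<beta>"
  shows "D = (\<lambda>g. D 1 * shift (- \<beta>) g)" "\<alpha> \<noteq> \<beta> \<Longrightarrow> D = (\<lambda>_. 0)"
  using assms by (auto simp: Dh_simps split: if_splits)

section \<open>Functoriality of the matrix tensor product\<close>

text \<open>\<open>balanced\<close> inspects matching pairs only, and the sums and moment-map
  products that occur in it keep their degrees.\<close>

lemma (in tensor_pair) balanced_cong:
  assumes "balanced A B H \<Phi>"
    and "\<And>\<alpha> \<beta> \<gamma> a b. a \<in> bigrade A \<alpha> \<gamma> \<Longrightarrow> b \<in> bigrade B \<gamma> \<beta> \<Longrightarrow> \<Psi> (a, b) = \<Phi> (a, b)"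
  shows "balanced A B H \<Psi>"
proof (rule balancedI)
  note \<Phi> = balancedD[OF assms(1)]
  fix \<alpha> \<beta> \<gamma> a b assume ab: "a \<in> bigrade A \<alpha> \<gamma>" "b \<in> bigrade B \<gamma> \<beta>"
  show "\<Psi> (a, b) \<in> carrier H" using \<Phi>(1)[OF ab] assms(2)[OF ab] by simp
  show "\<Psi> (a \<oplus>\<^bsub>A\<^esub> a', b) = \<Psi> (a, b) \<otimes>\<^bsub>H\<^esub> \<Psi> (a', b)" if "a' \<in> bigrade A \<alpha> \<gamma>" for a'
    using \<Phi>(2)[OF ab that] assms(2)[OF ab] assms(2)[OF that ab(2)] assms(2)[OF A.bigrade_add[OF ab(1) that] ab(2)]
    by simp
  show "\<Psi> (a, b \<oplus>\<^bsub>B\<^esub> b') = \<Psi> (a, b) \<otimes>\<^bsub>H\<^esub> \<Psi> (a, b')" if "b' \<in> bigrade B \<gamma> \<beta>" for b'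
    using \<Phi>(3)[OF ab that] assms(2)[OF ab] assms(2)[OF ab(1) that] assms(2)[OF ab(1) B.bigrade_add[OF ab(2) that]]
    by simp
  show "\<Psi> (mom_r A f \<otimes>\<^bsub>A\<^esub> a, b) = \<Psi> (a, mom_l B f \<otimes>\<^bsub>B\<^esub> b)" for f
    using \<Phi>(4)[OF ab] assms(2)[OF A.mom_r_bigrade[OF ab(1)] ab(2)] assms(2)[OF ab(1) B.mom_l_bigrade[OF ab(2)]]
    by simp
qed

lemma (in tensor_pair) lift_cong:
  assumes "comm_group H" "balanced A B H \<Phi>" "balanced A B H \<Psi>"
    and "\<And>\<gamma> a b. a \<in> bigrade A \<alpha> \<gamma> \<Longrightarrow> b \<in> bigrade B \<gamma> \<beta> \<Longrightarrow> \<Phi> (a, b) = \<Psi> (a, b)"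
    and "X \<in> bigrade (mtensor A B) \<alpha> \<beta>"
  shows "tensor_lift H \<Phi> X = tensor_lift H \<Psi> X"
  by (rule hom_eq_bigradeI[OF comm_group.axioms(2)[OF assms(1)] lift_hom[OF assms(1,2)] lift_hom[OF assms(1,3)] _ assms(5)])
    (simp add: lift_pure[OF assms(1,2)] lift_pure[OF assms(1,3)] assms(4))

lemma tensor_map_hom:
  assumes "tensor_pair A B" "tensor_pair C D"
    and bal: "balanced A B (tensor_group C D) (\<lambda>(a, b). pure_tensor C D (\<phi> a) (\<psi> b))"
  shows "tensor_map C D \<phi> \<psi> \<in> hom (tensor_group A B) (tensor_group C D)"
    and "a \<in> bigrade A \<alpha> \<gamma> \<Longrightarrow> b \<in> bigrade B \<gamma> \<beta> \<Longrightarrow>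
      tensor_map C D \<phi> \<psi> (pure_tensor A B a b) = pure_tensor C D (\<phi> a) (\<psi> b)"
proof -
  interpret AB: tensor_pair A B by fact
  interpret CD: tensor_pair C D by fact
  interpret M: abelian_group "mtensor C D" by (rule CD.abelian_group_mtensor)
  have bal': "balanced A B (add_monoid (mtensor C D)) (\<lambda>(a, b). CD.t (\<phi> a) (\<psi> b))"
    using bal CD.balanced_add_mtensor by blast
  show "tensor_map C D \<phi> \<psi> \<in> hom AB.Q CD.Q"
    using AB.lift_hom[OF M.a_comm_group bal'] unfolding tensor_map_def CD.hom_add_mtensor by simp
  show "tensor_map C D \<phi> \<psi> (AB.t a b) = CD.t (\<phi> a) (\<psi> b)"
    if "a \<in> bigrade A \<alpha> \<gamma>" "b \<in> bigrade B \<gamma> \<beta>"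
    unfolding tensor_map_def AB.lift_pure[OF M.a_comm_group bal' that] by simp
qed

text \<open>Naturality of the lift. The hypothesis \<open>deg\<close> keeps the image pairs in
  matching degrees, away from the default value of \<open>pure_tensor\<close>, where the lift would
  not return \<open>\<Phi>\<close>.\<close>

lemma tensor_lift_map:
  assumes AB: "tensor_pair A B" and CD: "tensor_pair C D" and H: "comm_group H"
    and \<Phi>: "balanced C D H \<Phi>"
    and bal: "balanced A B (tensor_group C D) (\<lambda>(a, b). pure_tensor C D (\<phi> a) (\<psi> b))"
    and deg: "\<And>\<alpha> \<beta> \<gamma> a b. a \<in> bigrade A \<alpha> \<gamma> \<Longrightarrow> b \<in> bigrade B \<gamma> \<beta> \<Longrightarrow> (\<phi> a, \<psi> b) \<in> matching C D"
    and X: "X \<in> carrier (tensor_group A B)"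
  shows "tensor_lift H \<Phi> (tensor_map C D \<phi> \<psi> X) = tensor_lift H (\<lambda>(a, b). \<Phi> (\<phi> a, \<psi> b)) X"
    and "balanced A B H (\<lambda>(a, b). \<Phi> (\<phi> a, \<psi> b))"
proof -
  interpret AB: tensor_pair A B by fact
  interpret CD: tensor_pair C D by fact
  have pt: "tensor_lift H \<Phi> (CD.t (\<phi> a) (\<psi> b)) = \<Phi> (\<phi> a, \<psi> b)"
    if "a \<in> bigrade A \<alpha> \<gamma>" "b \<in> bigrade B \<gamma> \<beta>" for \<alpha> \<beta> \<gamma> a b
    using deg[OF that] by (auto elim!: matchingE simp: CD.lift_pure[OF H \<Phi>])
  show b': "balanced A B H (\<lambda>(a, b). \<Phi> (\<phi> a, \<psi> b))"
    by (rule AB.balanced_cong[OF balanced_hom[OF bal CD.lift_hom[OF H \<Phi>]]]) (simp add: pt)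
  show "tensor_lift H \<Phi> (tensor_map C D \<phi> \<psi> X) = tensor_lift H (\<lambda>(a, b). \<Phi> (\<phi> a, \<psi> b)) X"
    by (rule AB.hom_eqI[OF comm_group.axioms(2)[OF H]
          hom_compose[OF tensor_map_hom(1)[OF AB CD bal] CD.lift_hom[OF H \<Phi>], unfolded o_def]
          AB.lift_hom[OF H b'] _ X])
      (simp add: tensor_map_hom(2)[OF AB CD bal] pt AB.lift_pure[OF H b'])
qed

text \<open>The part of \<open>h_hom\<close> that induces maps on tensor products, required on
  homogeneous elements only. It is shared by \<open>\<Delta>\<close>, \<open>\<epsilon>\<close> and
  the identity.\<close>

definition graded_map :: "('v::complex_fd_space, 'a) halg \<Rightarrow> ('v, 'c) halg \<Rightarrow> ('a \<Rightarrow> 'c) \<Rightarrow> bool" where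
  "graded_map A C \<phi> \<longleftrightarrow> (\<forall>\<alpha> \<beta>. \<forall>x\<in>bigrade A \<alpha> \<beta>. \<phi> x \<in> bigrade C \<alpha> \<beta> \<and>
     (\<forall>y\<in>bigrade A \<alpha> \<beta>. \<phi> (x \<oplus>\<^bsub>A\<^esub> y) = \<phi> x \<oplus>\<^bsub>C\<^esub> \<phi> y) \<and>
     (\<forall>f. \<phi> (mom_l A f \<otimes>\<^bsub>A\<^esub> x) = mom_l C f \<otimes>\<^bsub>C\<^esub> \<phi> x \<and> \<phi> (mom_r A f \<otimes>\<^bsub>A\<^esub> x) = mom_r C f \<otimes>\<^bsub>C\<^esub> \<phi> x))"

lemma graded_mapD:
  assumes "graded_map A C \<phi>" "x \<in> bigrade A \<alpha> \<beta>"
  shows "\<phi> x \<in> bigrade C \<alpha> \<beta>"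
    "y \<in> bigrade A \<alpha> \<beta> \<Longrightarrow> \<phi> (x \<oplus>\<^bsub>A\<^esub> y) = \<phi> x \<oplus>\<^bsub>C\<^esub> \<phi> y"
    "\<phi> (mom_l A f \<otimes>\<^bsub>A\<^esub> x) = mom_l C f \<otimes>\<^bsub>C\<^esub> \<phi> x"
    "\<phi> (mom_r A f \<otimes>\<^bsub>A\<^esub> x) = mom_r C f \<otimes>\<^bsub>C\<^esub> \<phi> x"
  using assms unfolding graded_map_def by blast+

lemma graded_map_id: "graded_map A A (\<lambda>x. x)"
  unfolding graded_map_def by simp

lemma (in h_algebra) graded_map_h_hom:
  assumes "h_hom A C \<phi>" shows "graded_map A C \<phi>"
  unfolding graded_map_def
proof (intro allI ballI conjI)
  have r: "\<phi> \<in> ring_hom A C" and deg: "\<And>\<alpha> \<beta>. \<phi> ` bigrade A \<alpha> \<beta> \<subseteq> bigrade C \<alpha> \<beta>"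
    and mom: "\<And>f. \<phi> (mom_l A f) = mom_l C f" "\<And>f. \<phi> (mom_r A f) = mom_r C f"
    using assms unfolding h_hom_def by blast+
  fix \<alpha> \<beta> x assume x: "x \<in> bigrade A \<alpha> \<beta>"
  then show "\<phi> x \<in> bigrade C \<alpha> \<beta>" using deg by blast
  show "\<phi> (x \<oplus> y) = \<phi> x \<oplus>\<^bsub>C\<^esub> \<phi> y" if "y \<in> bigrade A \<alpha> \<beta>" for y
    using ring_hom_add[OF r] x that bigrade_carrier by blast
  show "\<phi> (mom_l A f \<otimes> x) = mom_l C f \<otimes>\<^bsub>C\<^esub> \<phi> x" "\<phi> (mom_r A f \<otimes> x) = mom_r C f \<otimes>\<^bsub>C\<^esub> \<phi> x" for f
    using ring_hom_mult[OF r] x bigrade_carrier mom by (metis mom_l_closed, metis mom_r_closed)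
qed

lemma balanced_graded_map:
  assumes "tensor_pair C D" and \<phi>: "graded_map A C \<phi>" and \<psi>: "graded_map B D \<psi>"
  shows "balanced A B (tensor_group C D) (\<lambda>(a, b). pure_tensor C D (\<phi> a) (\<psi> b))"
proof -
  interpret CD: tensor_pair C D by fact
  note b = balancedD[OF CD.pure_balanced, simplified]
  show ?thesis
    by (rule balancedI; simp only: prod.case graded_mapD[OF \<phi>] graded_mapD[OF \<psi>])
      (rule CD.pure_closed b(2-4)[OF graded_mapD(1)[OF \<phi>] graded_mapD(1)[OF \<psi>]];
        (assumption | rule graded_mapD(1)[OF \<phi>] graded_mapD(1)[OF \<psi>])+)+
qed

lemma tensor_lift_graded_map:
  assumes "tensor_pair A B" "tensor_pair C D" "comm_group H" "balanced C D H \<Phi>"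
    and \<phi>: "graded_map A C \<phi>" and \<psi>: "graded_map B D \<psi>"
    and "X \<in> carrier (tensor_group A B)"
  shows "tensor_lift H \<Phi> (tensor_map C D \<phi> \<psi> X) = tensor_lift H (\<lambda>(a, b). \<Phi> (\<phi> a, \<psi> b)) X"
    and "balanced A B H (\<lambda>(a, b). \<Phi> (\<phi> a, \<psi> b))"
  by (rule tensor_lift_map[OF assms(1-4) balanced_graded_map[OF assms(2) \<phi> \<psi>] _ assms(7)],
      blast intro: matchingI graded_mapD(1)[OF \<phi>] graded_mapD(1)[OF \<psi>])+

section \<open>Associativity and Sweedler sums\<close>

context h_algebra
begin

text \<open>Placing x in one degree and its negative in the other gives a vanishing sum of
  homogeneous terms, so independence forces x to be zero.\<close>

lemma bigrade_disjoint:
  assumes x: "x \<in> bigrade A \<alpha> \<beta>" "x \<in> bigrade A \<alpha>' \<beta>'" and ne: "(\<alpha>, \<beta>) \<noteq> (\<alpha>', \<beta>')"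
  shows "x = \<zero>"
proof -
  let ?w = "\<lambda>p. if p = (\<alpha>, \<beta>) then x else \<ominus> x"
  have nx: "\<ominus> x \<in> bigrade A \<alpha>' \<beta>'"
    using subgroup.m_inv_closed[OF bigrade_subgroup x(2)] by (simp add: a_inv_def)
  have "(\<Oplus>p\<in>{(\<alpha>, \<beta>), (\<alpha>', \<beta>')}. ?w p) = \<zero>"
    using ne x(1)[THEN bigrade_carrier] by (subst finsum_insert) (auto simp: r_neg)
  then have "?w (\<alpha>, \<beta>) = \<zero>"
    using x nx ne by (intro bigrade_independent[of "{(\<alpha>, \<beta>), (\<alpha>', \<beta>')}" ?w]) auto
  then show ?thesis by simp
qed

end

section \<open>The associativity map and Sweedler sums\<close>

context h_bialgebroid
begin

sublocale AA: h_algebra_pair A A ..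

abbreviation M where "M \<equiv> mtensor A A"

sublocale M: moment_graded M by (rule AA.moment_graded_mtensor)
sublocale D: moment_graded "Dh :: ('v, 'v merom \<Rightarrow> 'v merom) halg" by (rule moment_graded_Dh)
sublocale AD: tensor_pair A "Dh :: ('v, 'v merom \<Rightarrow> 'v merom) halg" ..
sublocale MA: tensor_pair M A ..
sublocale AM: tensor_pair A M ..

abbreviation A3 where "A3 \<equiv> add_monoid (mtensor A M)"

lemma comm_group_A3: "comm_group A3"
  by (rule abelian_group.a_comm_group[OF AM.abelian_group_mtensor])

lemma A3_simps: "carrier A3 = carrier AM.Q" "X \<otimes>\<^bsub>A3\<^esub> Y = X \<otimes>\<^bsub>AM.Q\<^esub> Y"
  by simp_all

text \<open>Such a pair can still lie in \<open>matching\<close> through other degrees, but then one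
  entry is zero by \<open>bigrade_disjoint\<close>. The tensor is trivial either way.\<close>

lemma pure_mismatch:
  assumes b: "b \<in> bigrade A \<gamma> \<beta>" and c: "c \<in> bigrade A \<beta>' \<delta>" and ne: "\<beta> \<noteq> \<beta>'"
  shows "AA.t b c = \<one>\<^bsub>AA.Q\<^esub>"
proof (cases "(b, c) \<in> matching A A")
  case True
  then obtain \<gamma>2 \<beta>2 \<delta>2 where 2: "b \<in> bigrade A \<gamma>2 \<beta>2" "c \<in> bigrade A \<beta>2 \<delta>2"
    by (auto elim!: matchingE)
  show ?thesis
  proof (cases "\<beta>2 = \<beta>")
    case True
    then have "c = \<zero>" using bigrade_disjoint[OF c 2(2)] ne by auto
    then show ?thesis using AA.pure_zero_right[OF b] by simp
  next
    case False
    then have "b = \<zero>" using bigrade_disjoint[OF b 2(1)] by auto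
    then show ?thesis using AA.pure_zero_left[OF c] by simp
  qed
qed (rule AA.pure_nonmatching)

text \<open>
  For fixed \<open>c\<close>, \<^const>\<open>tensor_assoc\<close> lifts the map \<open>(a, b) \<mapsto> a \<otimes> (b \<otimes> c)\<close> from all of \<open>A \<otimes> A\<close>, including
  those \<open>b\<close> whose right degree differs from the left degree of \<open>c\<close>.
\<close>

lemma pure_any_degree:
  assumes b: "b \<in> bigrade A \<gamma> \<beta>" and c: "c \<in> bigrade A \<beta>' \<delta>"
  shows "AA.t b c \<in> bigrade M \<gamma> \<delta>"
    and "b' \<in> bigrade A \<gamma> \<beta> \<Longrightarrow> AA.t (b \<oplus> b') c = AA.t b c \<oplus>\<^bsub>M\<^esub> AA.t b' c"
    and "mom_l M f \<otimes>\<^bsub>M\<^esub> AA.t b c = AA.t (mom_l A f \<otimes> b) c"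
proof -
  have one: "mom_l M f \<otimes>\<^bsub>M\<^esub> \<one>\<^bsub>AA.Q\<^esub> = \<one>\<^bsub>AA.Q\<^esub>"
    using hom_one[OF AA.mom_l_mult_hom AA.Q.is_group AA.Q.is_group] .
  show "AA.t b c \<in> bigrade M \<gamma> \<delta>"
    by (cases "\<beta> = \<beta>'")
      (use AA.pure_in_bigrade[OF b] c M.bigrade_zero in \<open>auto simp: pure_mismatch[OF b c]\<close>)
  show "AA.t (b \<oplus> b') c = AA.t b c \<oplus>\<^bsub>M\<^esub> AA.t b' c" if "b' \<in> bigrade A \<gamma> \<beta>"
    by (cases "\<beta> = \<beta>'")
      (use balancedD(2)[OF AA.pure_balanced b] c that in
        \<open>auto simp: pure_mismatch[OF b c] pure_mismatch[OF that c] pure_mismatch[OF bigrade_add[OF b that] c]\<close>)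
  show "mom_l M f \<otimes>\<^bsub>M\<^esub> AA.t b c = AA.t (mom_l A f \<otimes> b) c"
  proof (cases "\<beta> = \<beta>'")
    case True
    then show ?thesis using AA.mom_l_mult_pure[OF b] c by blast
  next
    case False
    show ?thesis
      unfolding pure_mismatch[OF b c False] pure_mismatch[OF mom_l_bigrade[OF b] c False] by (rule one)
  qed
qed

text \<open>The left moment map of \<open>M\<close> acts on the first entry of the tensor of b and
  c, so balancing between a and b becomes balancing between a and that tensor.\<close>

lemma assoc_inner_balanced:
  assumes c: "c \<in> bigrade A \<beta>' \<delta>"
  shows "balanced A A A3 (\<lambda>(a, b). AM.t a (AA.t b c))"
  unfolding AM.balanced_add_mtensor
proof (rule balancedI; simp only: prod.case)
  note u = balancedD[OF AM.pure_balanced, simplified prod.case]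
  fix \<alpha> \<beta> \<gamma> a b assume a: "a \<in> bigrade A \<alpha> \<gamma>" and b: "b \<in> bigrade A \<gamma> \<beta>"
  note bc = pure_any_degree[OF b c]
  show "AM.t (a \<oplus> a') (AA.t b c) = AM.t a (AA.t b c) \<otimes>\<^bsub>AM.Q\<^esub> AM.t a' (AA.t b c)"
    if "a' \<in> bigrade A \<alpha> \<gamma>" for a' by (rule u(2)[OF a bc(1) that])
  show "AM.t a (AA.t (b \<oplus> b') c) = AM.t a (AA.t b c) \<otimes>\<^bsub>AM.Q\<^esub> AM.t a (AA.t b' c)"
    if b': "b' \<in> bigrade A \<gamma> \<beta>" for b'
    unfolding bc(2)[OF b'] by (rule u(3)[OF a bc(1) pure_any_degree(1)[OF b' c]])
  show "AM.t (mom_r A f \<otimes> a) (AA.t b c) = AM.t a (AA.t (mom_l A f \<otimes> b) c)" for f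
    unfolding bc(3)[symmetric] by (rule u(4)[OF a bc(1)])
qed (rule AM.pure_closed)

definition assoc_pure where
  "assoc_pure = (\<lambda>(Y, c). tensor_lift A3 (\<lambda>(a, b). AM.t a (AA.t b c)) Y)"

lemma assoc_pure_hom: "c \<in> bigrade A \<beta>' \<delta> \<Longrightarrow> (\<lambda>Y. assoc_pure (Y, c)) \<in> hom AA.Q A3"
  unfolding assoc_pure_def prod.case by (rule AA.lift_hom[OF comm_group_A3 assoc_inner_balanced])

lemma assoc_pure_pure:
  "a \<in> bigrade A \<alpha> \<gamma> \<Longrightarrow> b \<in> bigrade A \<gamma> \<beta> \<Longrightarrow> c \<in> bigrade A \<beta>' \<delta> \<Longrightarrow>
    assoc_pure (AA.t a b, c) = AM.t a (AA.t b c)"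
  unfolding assoc_pure_def prod.case
  by (subst AA.lift_pure[OF comm_group_A3 assoc_inner_balanced]) auto

text \<open>The right moment map of \<open>M\<close> acts on b and is exchanged with c inside the
  inner tensor. The exchange needs matching degrees, hence the comparison on generators of the
  bidegree of Y.\<close>

lemma assoc_pure_balanced: "balanced M A A3 assoc_pure"
proof (rule balancedI)
  note u = balancedD[OF AM.pure_balanced, simplified prod.case]
  note t = balancedD[OF AA.pure_balanced, simplified prod.case]
  note A3 = comm_group.axioms(2)[OF comm_group_A3]
  fix \<alpha> \<beta> \<gamma> Y c assume Y: "Y \<in> bigrade M \<alpha> \<gamma>" and c: "c \<in> bigrade A \<gamma> \<beta>"
  note YQ = AA.bigrade_mtensor_carrier[OF Y]
  show "assoc_pure (Y, c) \<in> carrier A3" by (rule hom_in_carrier[OF assoc_pure_hom[OF c] YQ])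
  show "assoc_pure (Y \<oplus>\<^bsub>M\<^esub> Y', c) = assoc_pure (Y, c) \<otimes>\<^bsub>A3\<^esub> assoc_pure (Y', c)"
    if "Y' \<in> bigrade M \<alpha> \<gamma>" for Y'
    using hom_mult[OF assoc_pure_hom[OF c] YQ AA.bigrade_mtensor_carrier[OF that]] by simp
  show "assoc_pure (Y, c \<oplus> c') = assoc_pure (Y, c) \<otimes>\<^bsub>A3\<^esub> assoc_pure (Y, c')"
    if c': "c' \<in> bigrade A \<gamma> \<beta>" for c'
  proof (rule AA.hom_eq_bigradeI[OF A3 assoc_pure_hom[OF bigrade_add[OF c c']]
        hom_mult2[OF comm_group_A3 assoc_pure_hom[OF c] assoc_pure_hom[OF c']] _ Y])
    fix \<delta> a b assume a: "a \<in> bigrade A \<alpha> \<delta>" and b: "b \<in> bigrade A \<delta> \<gamma>"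
    show "assoc_pure (AA.t a b, c \<oplus> c') = assoc_pure (AA.t a b, c) \<otimes>\<^bsub>A3\<^esub> assoc_pure (AA.t a b, c')"
      unfolding assoc_pure_pure[OF a b c] assoc_pure_pure[OF a b c'] assoc_pure_pure[OF a b bigrade_add[OF c c']]
        t(3)[OF b c c'] A3_simps
      using u(3)[OF a AA.pure_in_bigrade[OF b c] AA.pure_in_bigrade[OF b c']] by simp
  qed
  show "assoc_pure (mom_r M f \<otimes>\<^bsub>M\<^esub> Y, c) = assoc_pure (Y, mom_l A f \<otimes> c)" for f
  proof (rule AA.hom_eq_bigradeI[OF A3 hom_compose[OF AA.mom_r_mult_hom assoc_pure_hom[OF c], unfolded o_def]
        assoc_pure_hom[OF mom_l_bigrade[OF c]] _ Y])
    fix \<delta> a b assume a: "a \<in> bigrade A \<alpha> \<delta>" and b: "b \<in> bigrade A \<delta> \<gamma>"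
    show "assoc_pure (mom_r M f \<otimes>\<^bsub>M\<^esub> AA.t a b, c) = assoc_pure (AA.t a b, mom_l A f \<otimes> c)"
      unfolding AA.mom_r_mult_pure[OF a b] assoc_pure_pure[OF a mom_r_bigrade[OF b] c]
        assoc_pure_pure[OF a b mom_l_bigrade[OF c]] t(4)[OF b c] ..
  qed
qed

lemma tensor_assoc_eq: "tensor_assoc A A A = tensor_lift A3 assoc_pure"
  by (simp only: tensor_assoc_def assoc_pure_def Let_def)

lemma tensor_assoc_hom: "tensor_assoc A A A \<in> hom MA.Q AM.Q"
  unfolding tensor_assoc_eq using MA.lift_hom[OF comm_group_A3 assoc_pure_balanced] AM.hom_add_mtensor by blast

lemma tensor_assoc_pure:
  "Y \<in> bigrade M \<alpha> \<gamma> \<Longrightarrow> c \<in> bigrade A \<gamma> \<beta> \<Longrightarrow> tensor_assoc A A A (MA.t Y c) = assoc_pure (Y, c)"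
  unfolding tensor_assoc_eq by (rule MA.lift_pure[OF comm_group_A3 assoc_pure_balanced])

lemma graded_map_comult: "graded_map A M \<Delta>"
  by (rule graded_map_h_hom[OF comult_hom])

lemma graded_map_counit: "graded_map A Dh \<epsilon>"
  by (rule graded_map_h_hom[OF counit_hom])

lemma comult_ring_hom: "\<Delta> \<in> ring_hom A M"
  and counit_ring_hom: "\<epsilon> \<in> ring_hom A Dh"
  using comult_hom counit_hom unfolding h_hom_def by blast+

lemma comult_closed: "a \<in> carrier A \<Longrightarrow> \<Delta> a \<in> carrier AA.Q"
  using ring_hom_closed[OF comult_ring_hom] by simp

lemma comult_add_hom: "\<Delta> \<in> hom (add_monoid A) AA.Q"
  by (rule homI) (use comult_closed ring_hom_add[OF comult_ring_hom] in simp_all)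

lemma comult_bigrade: "a \<in> bigrade A \<alpha> \<beta> \<Longrightarrow> \<Delta> a \<in> bigrade M \<alpha> \<beta>"
  by (rule graded_mapD(1)[OF graded_map_comult])

lemma counit_eq:
  assumes "a \<in> bigrade A \<alpha> \<beta>"
  shows "\<epsilon> a = (\<lambda>g. \<epsilon> a 1 * shift (- \<beta>) g)" "\<alpha> \<noteq> \<beta> \<Longrightarrow> \<epsilon> a = (\<lambda>_. 0)"
  using Dh_apply_1[OF graded_mapD(1)[OF graded_map_counit assms]] by blast+

lemma shift_in_Dh: "shift (- \<alpha>) \<in> bigrade Dh \<alpha> \<alpha>"
  unfolding Dh_simps(8) by (auto intro!: exI[of _ 1])

text \<open>In Sweedler notation, the sum of \<Phi> (a1, a2).\<close>

abbreviation sweedler :: "('a \<times> 'a \<Rightarrow> 'a) \<Rightarrow> 'a \<Rightarrow> 'a" where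
  "sweedler \<Phi> a \<equiv> tensor_lift (add_monoid A) \<Phi> (\<Delta> a)"

lemma sweedler_hom: "balanced A A (add_monoid A) \<Phi> \<Longrightarrow> sweedler \<Phi> \<in> hom (add_monoid A) (add_monoid A)"
  using hom_compose[OF comult_add_hom AA.lift_hom[OF a_comm_group]] by (simp only: o_def)

text \<open>\<open>\<Delta> a\<close> has the bidegree of a, so the outer degrees of x and y are
  known in the comparison.\<close>

lemma sweedler_cong:
  assumes "balanced A A (add_monoid A) \<Phi>" "balanced A A (add_monoid A) \<Psi>" "a \<in> bigrade A \<alpha> \<beta>"
    and "\<And>\<gamma> x y. x \<in> bigrade A \<alpha> \<gamma> \<Longrightarrow> y \<in> bigrade A \<gamma> \<beta> \<Longrightarrow> \<Phi> (x, y) = \<Psi> (x, y)"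
  shows "sweedler \<Phi> a = sweedler \<Psi> a"
  by (rule AA.lift_cong[OF a_comm_group assms(1,2,4) comult_bigrade[OF assms(3)]])

lemma sweedler_comp_hom:
  assumes \<Phi>: "balanced A A (add_monoid A) \<Phi>" and h: "h \<in> hom (add_monoid A) (add_monoid A)"
    and a: "a \<in> carrier A"
  shows "h (sweedler \<Phi> a) = sweedler (\<lambda>p. h (\<Phi> p)) a"
  by (rule AA.hom_eqI[OF add.is_group hom_compose[OF AA.lift_hom[OF a_comm_group \<Phi>] h, unfolded o_def]
        AA.lift_hom[OF a_comm_group balanced_hom[OF \<Phi> h]] _ comult_closed[OF a]])
    (simp only: AA.lift_pure[OF a_comm_group \<Phi>] AA.lift_pure[OF a_comm_group balanced_hom[OF \<Phi> h]])

text \<open>The canonical isomorphism between A and its tensor product with \<open>Dh\<close> is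
  replaced by evaluating an arbitrary balanced map at the tensor that the counit axiom
  provides.\<close>

lemma sweedler_counit_right:
  assumes \<Xi>: "balanced A Dh (add_monoid A) \<Xi>" and a: "a \<in> bigrade A \<alpha> \<beta>"
  shows "sweedler (\<lambda>(x, y). \<Xi> (x, \<epsilon> y)) a = \<Xi> (a, shift (- \<beta>))"
    and "balanced A A (add_monoid A) (\<lambda>(x, y). \<Xi> (x, \<epsilon> y))"
  using tensor_lift_graded_map[OF AA.tensor_pair_axioms AD.tensor_pair_axioms a_comm_group \<Xi>
      graded_map_id graded_map_counit comult_closed[OF bigrade_carrier[OF a]]]
    AD.lift_pure[OF a_comm_group \<Xi> a shift_in_Dh]
  unfolding counit_right[OF a] by auto

end

section \<open>The antipode is antimultiplicative\<close>

context h_algebra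
begin

text \<open>The condition under which \<open>x \<otimes> y \<mapsto> F x \<cdot> y\<close> is well defined on \<open>A \<otimes> A\<close>.\<close>

definition mom_twisted :: "('a \<Rightarrow> 'a) \<Rightarrow> bool" where
  "mom_twisted F \<longleftrightarrow> F \<in> hom (add_monoid A) (add_monoid A) \<and>
     (\<forall>x\<in>carrier A. \<forall>f. F (mom_r A f \<otimes> x) = F x \<otimes> mom_l A f)"

lemma mom_twistedD:
  assumes "mom_twisted F"
  shows "F \<in> hom (add_monoid A) (add_monoid A)" "x \<in> carrier A \<Longrightarrow> F x \<in> carrier A"
    "x \<in> carrier A \<Longrightarrow> y \<in> carrier A \<Longrightarrow> F (x \<oplus> y) = F x \<oplus> F y"
    "x \<in> carrier A \<Longrightarrow> F (mom_r A f \<otimes> x) = F x \<otimes> mom_l A f"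
  using assms hom_in_carrier[of F "add_monoid A" "add_monoid A"] hom_mult[of F "add_monoid A" "add_monoid A"]
  unfolding mom_twisted_def by auto

lemma mom_twisted_l_mult:
  assumes "mom_twisted F" "c \<in> carrier A" shows "mom_twisted (\<lambda>x. c \<otimes> F x)"
  using assms mom_twistedD[OF assms(1)] hom_compose[OF mom_twistedD(1)[OF assms(1)] hom_l_mult[OF assms(2)]]
  unfolding mom_twisted_def by (simp add: o_def m_assoc)

lemma mom_twisted_r_mult:
  assumes "mom_twisted F" "c \<in> carrier A" shows "mom_twisted (\<lambda>x. F (x \<otimes> c))"
  using assms mom_twistedD[OF assms(1)] hom_compose[OF hom_r_mult[OF assms(2)] mom_twistedD(1)[OF assms(1)]]
  unfolding mom_twisted_def by (simp add: o_def m_assoc)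

lemma balanced_mom_twisted:
  assumes F: "mom_twisted F"
  shows "balanced A A (add_monoid A) (\<lambda>(x, y). F x \<otimes> y)"
  by (rule balancedI)
    (simp_all add: mom_twistedD[OF F] bigrade_carrier l_distr r_distr m_assoc)

end

section \<open>The antipode as a convolution inverse\<close>

context h_hopf_algebroid
begin

lemma antipode_in: "a \<in> carrier A \<Longrightarrow> S a \<in> carrier A"
  using antipode_closed by blast

lemma mom_twisted_antipode: "mom_twisted S"
  unfolding mom_twisted_def by (auto intro!: homI simp: antipode_in antipode_add antipode_mom_r)

lemma antipode_mom_l_left:
  assumes "x \<in> bigrade A \<alpha> \<beta>"
  shows "S (mom_l A f \<otimes> x) = mom_r A (shift \<alpha> f) \<otimes> S x"
  using antipode_mom_l[OF bigrade_carrier[OF assms]] mom_l_shift[OF assms] by simp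

text \<open>Passing \<open>mom_r A f\<close> through x and \<open>mom_l A f\<close> through y both
  shift f by the common inner degree \<gamma>, and S turns the second into a right moment map
  between the factors.\<close>

lemma balanced_antipode_right: "balanced A A (add_monoid A) (\<lambda>(x, y). x \<otimes> S y)"
proof (rule balancedI; simp only: prod.case)
  fix \<alpha> \<beta> \<gamma> x y f
  assume x: "x \<in> bigrade A \<alpha> \<gamma>" and y: "y \<in> bigrade A \<gamma> \<beta>"
  show "mom_r A f \<otimes> x \<otimes> S y = x \<otimes> S (mom_l A f \<otimes> y)"
    unfolding antipode_mom_l_left[OF y] mom_r_shift[OF x]
    using bigrade_carrier[OF x] bigrade_carrier[OF y] by (simp add: m_assoc antipode_in)
qed (simp_all add: bigrade_carrier antipode_in antipode_add l_distr r_distr)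

definition mult_antipode where
  "mult_antipode = tensor_lift (add_monoid A) (\<lambda>(x, y). x \<otimes> S y)"

lemma mult_antipode_hom: "mult_antipode \<in> hom AA.Q (add_monoid A)"
  unfolding mult_antipode_def by (rule AA.lift_hom[OF a_comm_group balanced_antipode_right])

lemma mult_antipode_pure:
  "x \<in> bigrade A \<alpha> \<gamma> \<Longrightarrow> y \<in> bigrade A \<gamma> \<beta> \<Longrightarrow> mult_antipode (AA.t x y) = x \<otimes> S y"
  unfolding mult_antipode_def by (subst AA.lift_pure[OF a_comm_group balanced_antipode_right]) auto

lemma mult_antipode_closed: "Y \<in> carrier AA.Q \<Longrightarrow> mult_antipode Y \<in> carrier A"
  using hom_in_carrier[OF mult_antipode_hom] by simp

lemma mult_antipode_mom_l:
  assumes "Y \<in> carrier AA.Q"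
  shows "mult_antipode (mom_l M f \<otimes>\<^bsub>M\<^esub> Y) = mom_l A f \<otimes> mult_antipode Y"
proof (rule AA.hom_eqI[OF add.is_group hom_compose[OF AA.mom_l_mult_hom mult_antipode_hom, unfolded o_def]
      hom_compose[OF mult_antipode_hom hom_l_mult[OF mom_l_closed], unfolded o_def] _ assms])
  fix \<alpha> \<beta> \<gamma> x y assume x: "x \<in> bigrade A \<alpha> \<gamma>" and y: "y \<in> bigrade A \<gamma> \<beta>"
  show "mult_antipode (mom_l M f \<otimes>\<^bsub>M\<^esub> AA.t x y) = mom_l A f \<otimes> mult_antipode (AA.t x y)"
    unfolding AA.mom_l_mult_pure[OF x y] mult_antipode_pure[OF x y] mult_antipode_pure[OF mom_l_bigrade[OF x] y]
    using bigrade_carrier[OF x] bigrade_carrier[OF y] by (simp add: m_assoc antipode_in)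
qed

text \<open>Makes F x * y * S z well defined on the threefold tensor product: the factor
  \<open>mom_l A f\<close> that F releases on its right is absorbed by
  \<open>mult_antipode_mom_l\<close>.\<close>

lemma balanced_mult_antipode:
  assumes F: "mom_twisted F"
  shows "balanced A M (add_monoid A) (\<lambda>(x, Y). F x \<otimes> mult_antipode Y)"
proof (rule balancedI; simp only: prod.case)
  note F = mom_twistedD[OF F]
  fix \<alpha> \<beta> \<gamma> x Y assume x: "x \<in> bigrade A \<alpha> \<gamma>" and Y: "Y \<in> bigrade M \<gamma> \<beta>"
  note xc = bigrade_carrier[OF x] and YQ = AA.bigrade_mtensor_carrier[OF Y]
  note c = F(2)[OF xc] mult_antipode_closed[OF YQ]
  show "F x \<otimes> mult_antipode Y \<in> carrier (add_monoid A)" using c by simp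
  show "F (x \<oplus> x') \<otimes> mult_antipode Y = F x \<otimes> mult_antipode Y \<otimes>\<^bsub>add_monoid A\<^esub> (F x' \<otimes> mult_antipode Y)"
    if "x' \<in> bigrade A \<alpha> \<gamma>" for x'
    using c F xc bigrade_carrier[OF that] by (simp add: l_distr)
  show "F x \<otimes> mult_antipode (Y \<oplus>\<^bsub>M\<^esub> Y') = F x \<otimes> mult_antipode Y \<otimes>\<^bsub>add_monoid A\<^esub> (F x \<otimes> mult_antipode Y')"
    if "Y' \<in> bigrade M \<gamma> \<beta>" for Y'
    using c hom_mult[OF mult_antipode_hom YQ AA.bigrade_mtensor_carrier[OF that]]
      mult_antipode_closed[OF AA.bigrade_mtensor_carrier[OF that]] by (simp add: r_distr)
  show "F (mom_r A f \<otimes> x) \<otimes> mult_antipode Y = F x \<otimes> mult_antipode (mom_l M f \<otimes>\<^bsub>M\<^esub> Y)" for f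
    unfolding mult_antipode_mom_l[OF YQ] F(4)[OF xc] using c by (simp add: m_assoc)
qed

text \<open>The right counit axiom without operators: evaluation at 1 sends the shift by - \<beta>
  to 1, so the moment-map factor disappears.\<close>

lemma sweedler_counit_twisted:
  assumes F: "mom_twisted F" and a: "a \<in> bigrade A \<alpha> \<beta>"
  shows "sweedler (\<lambda>(x, y). F (mom_r A (\<epsilon> y 1) \<otimes> x)) a = F a"
    and "balanced A A (add_monoid A) (\<lambda>(x, y). F (mom_r A (\<epsilon> y 1) \<otimes> x))"
proof -
  note F' = mom_twistedD[OF F]
  have \<Xi>: "balanced A Dh (add_monoid A) (\<lambda>(x, D). F (mom_r A (D 1) \<otimes> x))"
  proof (rule balancedI; simp only: prod.case)
    fix \<alpha> \<beta> \<gamma> x f and D :: "'v merom \<Rightarrow> 'v merom"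
    assume x: "x \<in> bigrade A \<alpha> \<gamma>"
    have "mom_r A (D 1) \<otimes> (mom_r A f \<otimes> x) = mom_r A ((mom_l Dh f \<otimes>\<^bsub>Dh\<^esub> D) 1) \<otimes> x"
      using bigrade_carrier[OF x] mom_r_mult[of "D 1" f] by (simp add: Dh_simps m_assoc mult.commute)
    then show "F (mom_r A (D 1) \<otimes> (mom_r A f \<otimes> x)) = F (mom_r A ((mom_l Dh f \<otimes>\<^bsub>Dh\<^esub> D) 1) \<otimes> x)" by simp
  qed (simp_all add: bigrade_carrier F' l_distr r_distr Dh_simps(2) mom_r_add)
  from sweedler_counit_right[OF \<Xi> a]
  show "sweedler (\<lambda>(x, y). F (mom_r A (\<epsilon> y 1) \<otimes> x)) a = F a"
    "balanced A A (add_monoid A) (\<lambda>(x, y). F (mom_r A (\<epsilon> y 1) \<otimes> x))"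
    using bigrade_carrier[OF a] by simp_all
qed

text \<open>F turns the right moment map of the counit value into a left one, which the right
  antipode axiom rewrites as a2 * S a3. Coassociativity then groups a1 with a2.\<close>

lemma convolution_expand:
  assumes F: "mom_twisted F" and a: "a \<in> bigrade A \<alpha> \<beta>"
  shows "F a = tensor_lift (add_monoid A) (\<lambda>(x, Y). F x \<otimes> mult_antipode Y)
    (tensor_assoc A A A (tensor_map M A \<Delta> (\<lambda>x. x) (\<Delta> a)))"
proof -
  note aQ = comult_closed[OF bigrade_carrier[OF a]]
  note lm = tensor_lift_graded_map[OF AA.tensor_pair_axioms AM.tensor_pair_axioms a_comm_group
      balanced_mult_antipode[OF F] graded_map_id graded_map_comult aQ]
  have "F a = sweedler (\<lambda>(x, y). F (mom_r A (\<epsilon> y 1) \<otimes> x)) a"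
    by (rule sweedler_counit_twisted(1)[OF F a, symmetric])
  also have "\<dots> = sweedler (\<lambda>(x, y). case (x, \<Delta> y) of (x, Y) \<Rightarrow> F x \<otimes> mult_antipode Y) a"
  proof (rule sweedler_cong[OF sweedler_counit_twisted(2)[OF F a] lm(2) a])
    fix \<gamma> x y assume x: "x \<in> bigrade A \<alpha> \<gamma>" and y: "y \<in> bigrade A \<gamma> \<beta>"
    have "mult_antipode (\<Delta> y) = mom_l A (\<epsilon> y 1)"
      unfolding mult_antipode_def by (rule antipode_right[OF bigrade_carrier[OF y]])
    then show "(case (x, y) of (x, y) \<Rightarrow> F (mom_r A (\<epsilon> y 1) \<otimes> x)) =
        (case (x, y) of (x, y) \<Rightarrow> case (x, \<Delta> y) of (x, Y) \<Rightarrow> F x \<otimes> mult_antipode Y)"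
      using mom_twistedD(4)[OF F bigrade_carrier[OF x]] by simp
  qed
  also have "\<dots> = tensor_lift (add_monoid A) (\<lambda>(x, Y). F x \<otimes> mult_antipode Y)
      (tensor_map A M (\<lambda>x. x) \<Delta> (\<Delta> a))"
    by (rule lm(1)[symmetric])
  finally show ?thesis unfolding coassoc[OF bigrade_carrier[OF a]] .
qed

text \<open>By associativity in A, the first two tensor factors enter only through the convolution
  of F with the identity.\<close>

lemma convolution_assoc:
  assumes F: "mom_twisted F" and Y: "Y \<in> bigrade M \<alpha> \<gamma>" and c: "c \<in> bigrade A \<gamma> \<beta>"
  shows "tensor_lift (add_monoid A) (\<lambda>(x, Y). F x \<otimes> mult_antipode Y) (tensor_assoc A A A (MA.t Y c)) =
    tensor_lift (add_monoid A) (\<lambda>(x, y). F x \<otimes> y) Y \<otimes> S c"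
proof -
  let ?\<Phi> = "\<lambda>(x, Y). F x \<otimes> mult_antipode Y"
  note \<Phi> = balanced_mult_antipode[OF F] and bF = balanced_mom_twisted[OF F]
  have h: "tensor_lift (add_monoid A) ?\<Phi> \<in> hom A3 (add_monoid A)"
    using AM.lift_hom[OF a_comm_group \<Phi>] by (simp add: hom_def)
  note Sc = antipode_in[OF bigrade_carrier[OF c]]
  have "tensor_lift (add_monoid A) ?\<Phi> (assoc_pure (Y, c)) =
    tensor_lift (add_monoid A) (\<lambda>(x, y). F x \<otimes> y) Y \<otimes> S c"
  proof (rule AA.hom_eq_bigradeI[OF add.is_group hom_compose[OF assoc_pure_hom[OF c] h, unfolded o_def]
        hom_compose[OF AA.lift_hom[OF a_comm_group bF] hom_r_mult[OF Sc], unfolded o_def] _ Y])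
    fix \<delta> a b assume a: "a \<in> bigrade A \<alpha> \<delta>" and b: "b \<in> bigrade A \<delta> \<gamma>"
    show "tensor_lift (add_monoid A) ?\<Phi> (assoc_pure (AA.t a b, c)) =
        tensor_lift (add_monoid A) (\<lambda>(x, y). F x \<otimes> y) (AA.t a b) \<otimes> S c"
      unfolding assoc_pure_pure[OF a b c] AM.lift_pure[OF a_comm_group \<Phi> a AA.pure_in_bigrade[OF b c]]
        AA.lift_pure[OF a_comm_group bF a b] prod.case mult_antipode_pure[OF b c]
      using Sc a b mom_twistedD(2)[OF F] by (simp add: m_assoc bigrade_carrier)
  qed
  then show ?thesis unfolding tensor_assoc_pure[OF Y c] .
qed

text \<open>
  The antipode is a right convolution inverse of the identity, so
  \<open>F a = \<Sum> F a\<^sub>1 \<cdot> \<epsilon> a\<^sub>2 = \<Sum> (F a\<^sub>1 \<cdot> a\<^sub>2) \<cdot> S a\<^sub>3\<close> depends only on \<open>\<Sum> F a\<^sub>1 \<cdot> a\<^sub>2\<close>.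
\<close>

lemma convolution_cancel:
  assumes F: "mom_twisted F" and G: "mom_twisted G"
    and eq: "\<And>\<alpha> \<beta> b. b \<in> bigrade A \<alpha> \<beta> \<Longrightarrow>
      sweedler (\<lambda>(x, y). F x \<otimes> y) b = sweedler (\<lambda>(x, y). G x \<otimes> y) b"
    and a: "a \<in> carrier A"
  shows "F a = G a"
proof (rule hom_eq_on_bigrade[OF add.is_group mom_twistedD(1)[OF F] mom_twistedD(1)[OF G] _ a])
  fix \<alpha> \<beta> a assume a: "a \<in> bigrade A \<alpha> \<beta>"
  \<comment> \<open>At \<open>\<Delta> a\<close> this gives back F a by
    \<open>convolution_expand\<close>; on pure tensors it depends only on the convolution product,
    where F and G agree by hypothesis.\<close>
  define k where "k F = (\<lambda>X. tensor_lift (add_monoid A) (\<lambda>(x, Y). F x \<otimes> mult_antipode Y)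
    (tensor_assoc A A A (tensor_map M A \<Delta> (\<lambda>x. x) X)))" for F
  note tm = tensor_map_hom[OF AA.tensor_pair_axioms MA.tensor_pair_axioms
      balanced_graded_map[OF MA.tensor_pair_axioms graded_map_comult graded_map_id]]
  have k: "k F \<in> hom AA.Q (add_monoid A)" if "mom_twisted F" for F
    unfolding k_def
    by (rule hom_compose[OF tm(1) hom_compose[OF tensor_assoc_hom
            AM.lift_hom[OF a_comm_group balanced_mult_antipode[OF that]]], unfolded o_def])
  have "k F (\<Delta> a) = k G (\<Delta> a)"
  proof (rule AA.hom_eqI[OF add.is_group k[OF F] k[OF G] _ comult_closed[OF bigrade_carrier[OF a]]])
    fix \<alpha> \<beta> \<gamma> x y assume x: "x \<in> bigrade A \<alpha> \<gamma>" and y: "y \<in> bigrade A \<gamma> \<beta>"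
    show "k F (AA.t x y) = k G (AA.t x y)"
      unfolding k_def tm(2)[OF x y] convolution_assoc[OF F comult_bigrade[OF x] y]
        convolution_assoc[OF G comult_bigrade[OF x] y] eq[OF x] ..
  qed
  then show "F a = G a"
    unfolding k_def convolution_expand[OF F a, symmetric] convolution_expand[OF G a, symmetric] .
qed

text \<open>The right antipode axiom at the unit, where both the comultiplication and the counit are
  unital.\<close>

lemma antipode_one: "S \<one> = \<one>"
proof -
  have "\<Delta> \<one> = AA.t \<one> \<one>" using ring_hom_one[OF comult_ring_hom] by simp
  then have "mult_antipode (AA.t \<one> \<one>) = mom_l A (\<epsilon> \<one> 1)"
    unfolding mult_antipode_def using antipode_right[OF one_closed] by simp
  then show ?thesis
    unfolding mult_antipode_pure[OF one_in one_in] ring_hom_one[OF counit_ring_hom]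
    by (simp add: Dh_simps antipode_in)
qed

lemma counit_mult_1:
  assumes "a \<in> bigrade A \<alpha> \<beta>" "b \<in> carrier A"
  shows "\<epsilon> (a \<otimes> b) 1 = \<epsilon> a 1 * shift (- \<beta>) (\<epsilon> b 1)"
  unfolding ring_hom_mult[OF counit_ring_hom bigrade_carrier[OF assms(1)] assms(2)] Dh_simps(3) o_apply
  by (rule fun_cong[OF counit_eq(1)[OF assms(1)]])

text \<open>
  Both sides are regarded as functions of \<open>b\<close>, and convolution with the identity is cancelled; the
  left-hand side then becomes the sum of \<open>S x \<cdot> y\<close> over \<open>\<Delta> (a \<cdot> b)\<close>.
\<close>

lemma sweedler_antipode_mult:
  assumes a: "a \<in> bigrade A \<alpha> \<beta>" and b: "b \<in> carrier A"
  shows "sweedler (\<lambda>(x, y). S (x \<otimes> b) \<otimes> y) a = S b \<otimes> mom_r A (shift \<alpha> (\<epsilon> a 1))"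
proof -
  note tS = mom_twisted_antipode
  note tw = mom_twisted_r_mult[OF tS]
  note bal = balanced_mom_twisted[OF tw]
  note ac = bigrade_carrier[OF a]
  note \<Delta>a = comult_closed[OF ac]
  \<comment> \<open>\<open>mom_r A h\<close> is the value of the left antipode axiom at a.\<close>
  define h where "h = shift \<alpha> (\<epsilon> a 1)"
  let ?F = "\<lambda>b. sweedler (\<lambda>(x, y). S (x \<otimes> b) \<otimes> y) a"
  let ?G = "\<lambda>b. S b \<otimes> mom_r A h"
  have Fc: "?F b \<in> carrier A" if "b \<in> carrier A" for b
    using hom_in_carrier[OF sweedler_hom[OF bal[OF that]], of a] ac by simp
  have F: "mom_twisted ?F"
    unfolding mom_twisted_def
  proof (intro conjI homI ballI allI)
    fix b c assume "b \<in> carrier (add_monoid A)" "c \<in> carrier (add_monoid A)"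
    then have bc: "b \<in> carrier A" "c \<in> carrier A" by simp_all
    show "?F b \<in> carrier (add_monoid A)" using Fc bc by simp
    have "?F (b \<oplus> c) = ?F b \<otimes>\<^bsub>add_monoid A\<^esub> ?F c"
    proof (rule AA.hom_eqI[OF add.is_group _ hom_mult2[OF a_comm_group AA.lift_hom[OF a_comm_group bal[OF bc(1)]]
            AA.lift_hom[OF a_comm_group bal[OF bc(2)]]] _ \<Delta>a])
      show "tensor_lift (add_monoid A) (\<lambda>(x, y). S (x \<otimes> (b \<oplus> c)) \<otimes> y) \<in> hom AA.Q (add_monoid A)"
        using bc by (intro AA.lift_hom[OF a_comm_group bal]) simp
      fix \<alpha> \<beta> \<gamma> x y assume xy: "x \<in> bigrade A \<alpha> \<gamma>" "y \<in> bigrade A \<gamma> \<beta>"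
      then show "tensor_lift (add_monoid A) (\<lambda>(x, y). S (x \<otimes> (b \<oplus> c)) \<otimes> y) (AA.t x y) =
          tensor_lift (add_monoid A) (\<lambda>(x, y). S (x \<otimes> b) \<otimes> y) (AA.t x y) \<otimes>\<^bsub>add_monoid A\<^esub>
          tensor_lift (add_monoid A) (\<lambda>(x, y). S (x \<otimes> c) \<otimes> y) (AA.t x y)"
        using bc bigrade_carrier[OF xy(1)] bigrade_carrier[OF xy(2)]
        by (simp add: AA.lift_pure[OF a_comm_group bal xy] r_distr l_distr antipode_add antipode_in)
    qed
    then show "?F (b \<otimes>\<^bsub>add_monoid A\<^esub> c) = ?F b \<otimes>\<^bsub>add_monoid A\<^esub> ?F c" by simp
  next
    fix b f assume b: "b \<in> carrier A"
    have "?F b \<otimes> mom_l A f = sweedler (\<lambda>p. (case p of (x, y) \<Rightarrow> S (x \<otimes> b) \<otimes> y) \<otimes> mom_l A f) a"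
      by (rule sweedler_comp_hom[OF bal[OF b] hom_r_mult[OF mom_l_closed] ac])
    also have "\<dots> = ?F (mom_r A f \<otimes> b)"
    proof (rule sweedler_cong[OF balanced_hom[OF bal[OF b] hom_r_mult[OF mom_l_closed]] bal a])
      show "mom_r A f \<otimes> b \<in> carrier A" using b by simp
      fix \<gamma> x y assume x: "x \<in> bigrade A \<alpha> \<gamma>" and y: "y \<in> bigrade A \<gamma> \<beta>"
      note xy = bigrade_carrier[OF x] bigrade_carrier[OF y]
      \<comment> \<open>The shift by - \<gamma> acquired in passing x is undone in passing y, whose
        left degree is \<gamma>.\<close>
      have "x \<otimes> (mom_r A f \<otimes> b) = mom_r A (shift (- \<gamma>) f) \<otimes> (x \<otimes> b)"
        using mom_r_shift_right[OF x, of f] xy b by (simp add: m_assoc[symmetric])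
      then have "S (x \<otimes> (mom_r A f \<otimes> b)) \<otimes> y = S (x \<otimes> b) \<otimes> (mom_l A (shift (- \<gamma>) f) \<otimes> y)"
        using xy b by (simp add: antipode_mom_r antipode_in m_assoc)
      also have "mom_l A (shift (- \<gamma>) f) \<otimes> y = y \<otimes> mom_l A f"
        using mom_l_shift_right[OF y] by simp
      finally show "(case (x, y) of (x, y) \<Rightarrow> S (x \<otimes> b) \<otimes> y) \<otimes> mom_l A f =
          (case (x, y) of (x, y) \<Rightarrow> S (x \<otimes> (mom_r A f \<otimes> b)) \<otimes> y)"
        using xy b by (simp add: m_assoc antipode_in)
    qed
    finally show "?F (mom_r A f \<otimes> b) = ?F b \<otimes> mom_l A f" ..
  qed
  have G: "mom_twisted ?G"
    unfolding mom_twisted_def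
    by (auto intro!: homI simp: antipode_in antipode_add l_distr antipode_mom_r m_assoc mom_l_mom_r)
  have "?F b = ?G b"
  proof (rule convolution_cancel[OF F G _ b])
    fix \<alpha>' \<beta>' b assume b: "b \<in> bigrade A \<alpha>' \<beta>'"
    note bc = bigrade_carrier[OF b]
    note bS = balanced_mom_twisted[OF tS]
    \<comment> \<open>For pure tensors x, y in place of \<open>\<Delta> a\<close> and c, d in place
      of \<open>\<Delta> b\<close>, both sides are S (x * c) * y * d. The reduction treats first
      \<open>\<Delta> b\<close>, then \<open>\<Delta> a\<close>.\<close>
    have "sweedler (\<lambda>(x, y). ?F x \<otimes> y) b = tensor_lift (add_monoid A) (\<lambda>(x, y). S x \<otimes> y) (\<Delta> a \<otimes>\<^bsub>M\<^esub> \<Delta> b)"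
    proof (rule AA.hom_eqI[OF add.is_group AA.lift_hom[OF a_comm_group balanced_mom_twisted[OF F]]
          hom_compose[OF AA.mult_hom_right[OF \<Delta>a] AA.lift_hom[OF a_comm_group bS], unfolded o_def]
          _ comult_closed[OF bc]])
      fix \<alpha> \<beta> \<gamma> c d assume c: "c \<in> bigrade A \<alpha> \<gamma>" and d: "d \<in> bigrade A \<gamma> \<beta>"
      note cd = bigrade_carrier[OF c] bigrade_carrier[OF d]
      have "?F c \<otimes> d = tensor_lift (add_monoid A) (\<lambda>(x, y). S x \<otimes> y) (\<Delta> a \<otimes>\<^bsub>M\<^esub> AA.t c d)"
      proof (rule AA.hom_eqI[OF add.is_group
            hom_compose[OF AA.lift_hom[OF a_comm_group bal[OF cd(1)]] hom_r_mult[OF cd(2)], unfolded o_def]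
            hom_compose[OF AA.mult_hom_left[OF AA.pure_closed] AA.lift_hom[OF a_comm_group bS], unfolded o_def]
            _ \<Delta>a])
        fix \<alpha> \<beta> \<gamma> x y assume x: "x \<in> bigrade A \<alpha> \<gamma>" and y: "y \<in> bigrade A \<gamma> \<beta>"
        show "tensor_lift (add_monoid A) (\<lambda>(x, y). S (x \<otimes> c) \<otimes> y) (AA.t x y) \<otimes> d =
            tensor_lift (add_monoid A) (\<lambda>(x, y). S x \<otimes> y) (AA.t x y \<otimes>\<^bsub>M\<^esub> AA.t c d)"
          unfolding AA.pure_mult_pure[OF x y c d] AA.lift_pure[OF a_comm_group bal[OF cd(1)] x y]
            AA.lift_pure[OF a_comm_group bS bigrade_mult[OF x c] bigrade_mult[OF y d]] prod.case
          using cd bigrade_carrier[OF x] bigrade_carrier[OF y] by (simp add: m_assoc antipode_in)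
      qed
      then show "tensor_lift (add_monoid A) (\<lambda>(x, y). ?F x \<otimes> y) (AA.t c d) =
          tensor_lift (add_monoid A) (\<lambda>(x, y). S x \<otimes> y) (\<Delta> a \<otimes>\<^bsub>M\<^esub> AA.t c d)"
        unfolding AA.lift_pure[OF a_comm_group balanced_mom_twisted[OF F] c d] by simp
    qed
    also have "\<dots> = sweedler (\<lambda>(x, y). S x \<otimes> y) (a \<otimes> b)"
      using ring_hom_mult[OF comult_ring_hom ac bc] by simp
    also have "\<dots> = mom_r A (shift (\<alpha> + \<alpha>') (\<epsilon> (a \<otimes> b) 1))"
      by (rule antipode_left[OF bigrade_mult[OF a b]])
    also have "\<epsilon> (a \<otimes> b) 1 = \<epsilon> a 1 * shift (- \<beta>) (\<epsilon> b 1)" by (rule counit_mult_1[OF a bc])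
    \<comment> \<open>On diagonal degrees the shifts by \<alpha> and - \<beta> cancel on the second
      factor; otherwise one of the two counit values is zero.\<close>
    also have "shift (\<alpha> + \<alpha>') (\<epsilon> a 1 * shift (- \<beta>) (\<epsilon> b 1)) = shift \<alpha>' (\<epsilon> b 1) * shift \<beta>' h"
    proof (cases "\<alpha> = \<beta> \<and> \<alpha>' = \<beta>'")
      case True
      then show ?thesis by (simp add: h_def shift_mult shift_shift algebra_simps)
    next
      case False
      then have "\<epsilon> a 1 = 0 \<or> \<epsilon> b 1 = 0" using counit_eq(2)[OF a] counit_eq(2)[OF b] by auto
      then show ?thesis by (auto simp: h_def)
    qed
    also have "mom_r A (shift \<alpha>' (\<epsilon> b 1) * shift \<beta>' h) =
        sweedler (\<lambda>(x, y). S x \<otimes> y) b \<otimes> mom_r A (shift \<beta>' h)"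
      unfolding antipode_left[OF b] by (rule mom_r_mult)
    also have "\<dots> = sweedler (\<lambda>p. (case p of (x, y) \<Rightarrow> S x \<otimes> y) \<otimes> mom_r A (shift \<beta>' h)) b"
      by (rule sweedler_comp_hom[OF bS hom_r_mult[OF mom_r_closed] bc])
    \<comment> \<open>Moving the moment map left past y, of right degree \<beta>', turns
      \<open>shift \<beta>' h\<close> back into \<open>h\<close>.\<close>
    also have "\<dots> = sweedler (\<lambda>(x, y). ?G x \<otimes> y) b"
    proof (rule sweedler_cong[OF balanced_hom[OF bS hom_r_mult[OF mom_r_closed]] balanced_mom_twisted[OF G] b])
      fix \<gamma> x y assume x: "x \<in> bigrade A \<alpha>' \<gamma>" and y: "y \<in> bigrade A \<gamma> \<beta>'"
      show "(case (x, y) of (x, y) \<Rightarrow> S x \<otimes> y) \<otimes> mom_r A (shift \<beta>' h) =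
          (case (x, y) of (x, y) \<Rightarrow> ?G x \<otimes> y)"
        using mom_r_shift[OF y, of h] bigrade_carrier[OF x] bigrade_carrier[OF y]
        by (simp add: m_assoc antipode_in)
    qed
    finally show "sweedler (\<lambda>(x, y). ?F x \<otimes> y) b = sweedler (\<lambda>(x, y). ?G x \<otimes> y) b" .
  qed
  then show ?thesis by (simp only: h_def)
qed

text \<open>The second cancellation, in a for fixed b: the constant left factor S b can be pulled
  out of the Sweedler sum, and \<open>sweedler_antipode_mult\<close> gives what remains.\<close>

lemma antipode_mult:
  assumes a: "a \<in> carrier A" and b: "b \<in> carrier A"
  shows "S (a \<otimes> b) = S b \<otimes> S a"
proof (rule convolution_cancel[OF mom_twisted_r_mult[OF mom_twisted_antipode b]
      mom_twisted_l_mult[OF mom_twisted_antipode antipode_in[OF b]] _ a])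
  note bS = balanced_mom_twisted[OF mom_twisted_antipode]
  fix \<alpha> \<beta> a assume a: "a \<in> bigrade A \<alpha> \<beta>"
  note Sb = antipode_in[OF b]
  have "sweedler (\<lambda>(x, y). S (x \<otimes> b) \<otimes> y) a = S b \<otimes> sweedler (\<lambda>(x, y). S x \<otimes> y) a"
    unfolding sweedler_antipode_mult[OF a b] antipode_left[OF a] ..
  also have "\<dots> = sweedler (\<lambda>p. S b \<otimes> (case p of (x, y) \<Rightarrow> S x \<otimes> y)) a"
    by (rule sweedler_comp_hom[OF bS hom_l_mult[OF Sb] bigrade_carrier[OF a]])
  also have "\<dots> = sweedler (\<lambda>(x, y). S b \<otimes> S x \<otimes> y) a"
    by (rule sweedler_cong[OF balanced_hom[OF bS hom_l_mult[OF Sb]]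
          balanced_mom_twisted[OF mom_twisted_l_mult[OF mom_twisted_antipode Sb]] a])
      (simp add: Sb antipode_in bigrade_carrier m_assoc)
  finally show "sweedler (\<lambda>(x, y). S (x \<otimes> b) \<otimes> y) a = sweedler (\<lambda>(x, y). S b \<otimes> S x \<otimes> y) a" .
qed

lemma antipode_mom: "S (mom_l A f) = mom_r A f" "S (mom_r A f) = mom_l A f"
  using antipode_mom_l[OF one_closed, of f] antipode_mom_r[OF one_closed, of f]
  by (simp_all add: antipode_one)

end

section \<open>Conjugation of difference operators\<close>

lemma conj_conj [simp]: "conj_merom (conj_merom f) = f"
  by transfer (simp add: conjV_conjV generically_eq_refl)

lemma conj_shift: "conj_merom (shift \<alpha> f) = shift (conjV \<alpha>) (conj_merom f)"
  by transfer (simp add: conjV_conjV conjV_add generically_eq_refl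
      meromorphic_fun_conj[OF meromorphic_fun_shift])

lemma conj_zero [simp]: "conj_merom 0 = 0"
  by transfer (simp add: generically_eq_refl meromorphic_fun_const)

lemma conjV_minus: "conjV (- x) = - conjV (x :: 'a::complex_fd_space_conj)"
proof -
  have "conjV (0 :: 'a) = 0" using conjV_add[of "0 :: 'a" 0] by simp
  then show ?thesis using conjV_add[of x "- x"] by (simp add: eq_neg_iff_add_eq_0 add.commute)
qed

lemma const_merom_diff: "const_merom c - const_merom d = const_merom (c - d)"
  unfolding minus_merom_def
  by transfer (simp add: generically_eq_refl meromorphic_fun_const)

lemma const_merom_cancel:
  assumes "f * const_merom c = 0" "c \<noteq> 0" shows "f = 0"
proof -
  have "f = f * const_merom c * const_merom (inverse c)"
    using assms(2) by (simp add: mult.assoc const_merom_mult const_merom_1)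
  then show ?thesis using assms(1) by simp
qed

section \<open>Linear independence of shifts and adjoints of monomials\<close>

lemma complex_functional_exists:
  fixes v :: "'v::complex_fd_space"
  assumes "v \<noteq> 0"
  obtains L :: "'v \<Rightarrow> complex" where "\<And>x y. L (x + y) = L x + L y" "\<And>c x. L (c *\<^sub>C x) = c * L x" "L v \<noteq> 0"
proof -
  \<comment> \<open>The unit law for complex scalars is obtained from compatibility with real
    ones.\<close>
  have one: "1 *\<^sub>C x = x" for x :: 'v using scaleC_of_real[of 1 x] by simp
  interpret V: vector_space "scaleC :: complex \<Rightarrow> 'v \<Rightarrow> 'v"
    by unfold_locales (simp_all add: scaleC_add_left scaleC_add_right scaleC_scaleC one)
  interpret W: vector_space "(*) :: complex \<Rightarrow> complex \<Rightarrow> complex"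
    by unfold_locales (simp_all add: algebra_simps)
  interpret VW: vector_space_pair "scaleC :: complex \<Rightarrow> 'v \<Rightarrow> 'v" "(*) :: complex \<Rightarrow> complex \<Rightarrow> complex" ..
  have "V.independent {v}" using assms by (simp add: V.dependent_single)
  from VW.linear_independent_extend[OF this, of "\<lambda>_. 1"]
  obtain L where L: "Vector_Spaces.linear scaleC (*) L" "L v = 1" by auto
  interpret L: Vector_Spaces.linear scaleC "(*)" L by fact
  show ?thesis by (rule that[of L]) (simp_all add: L.add L.scale L(2))
qed

text \<open>Take \<open>F\<close> to be a complex linear functional \<open>\<phi>\<close> on which \<open>\<alpha>\<close> and \<open>\<beta>\<close> differ.\<close>

lemma separating_merom:
  fixes \<alpha> \<beta> :: "'v::complex_fd_space"
  assumes "\<alpha> \<noteq> \<beta>"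
  obtains F :: "'v merom" and \<phi> where "\<phi> \<alpha> \<noteq> \<phi> \<beta>" "\<And>\<gamma>. shift \<gamma> F = F + const_merom (\<phi> \<gamma>)"
proof -
  have "\<alpha> - \<beta> \<noteq> 0" using assms by simp
  then obtain L :: "'v \<Rightarrow> complex" where L: "\<And>x y. L (x + y) = L x + L y"
    "\<And>c x. L (c *\<^sub>C x) = c * L x" "L (\<alpha> - \<beta>) \<noteq> 0"
    by (rule complex_functional_exists) (rule that)
  have "linear L"
  proof (rule linearI)
    fix r and x :: 'v
    show "L (r *\<^sub>R x) = r *\<^sub>R L x"
      unfolding scaleC_of_real[symmetric] L(2) by (simp add: scaleR_conv_of_real)
  qed (rule L(1))
  then have "(L has_derivative L) (at x)" for x
    by (intro bounded_linear_imp_has_derivative bounded_linear_fd)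
  then have "holo_on UNIV L" unfolding holo_on_def using L(2) by blast
  moreover have "nonvanishing_on UNIV (\<lambda>_. 1 :: complex)" unfolding nonvanishing_on_def by auto
  ultimately have mer: "meromorphic_fun L"
    unfolding meromorphic_fun_def
    by (metis UNIV_I div_by_1 holo_on_const open_UNIV)
  define F where "F = abs_merom L"
  have "shift \<gamma> F = F + const_merom (L \<gamma>)" for \<gamma>
  proof -
    have R: "meromorphic_fun L \<and> meromorphic_fun L \<and> generically_eq L L"
      "meromorphic_fun (\<lambda>_ :: 'v. L \<gamma>) \<and> meromorphic_fun (\<lambda>_ :: 'v. L \<gamma>) \<and> generically_eq (\<lambda>_ :: 'v. L \<gamma>) (\<lambda>_. L \<gamma>)"
      using mer by (simp_all only: meromorphic_fun_const generically_eq_refl simp_thms)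
    show ?thesis
      unfolding F_def by (simp only: shift.abs_eq[OF R(1)] const_merom.abs_eq plus_merom.abs_eq[OF R] L(1))
  qed
  moreover have "L \<alpha> \<noteq> L \<beta>" using L(1)[of "\<alpha> - \<beta>" \<beta>] L(3) by simp
  ultimately show ?thesis using that by blast
qed

text \<open>Dedekind's argument for independence of characters: apply the relation to F * g and
  subtract F + \<phi> \<beta>0 times the relation at g. The \<beta>0 term cancels, and every other
  coefficient is multiplied by a constant.\<close>

lemma diffop_independent:
  assumes "finite I" "diffop I f = (\<lambda>_. 0)" "\<beta> \<in> I"
  shows "f \<beta> = 0"
  using assms
proof (induction I arbitrary: f \<beta> rule: finite_induct)
  case (insert \<beta>0 J)
  have D: "f \<beta>0 * shift \<beta>0 g + (\<Sum>\<beta>\<in>J. f \<beta> * shift \<beta> g) = 0" for g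
    using fun_cong[OF insert.prems(1), of g] insert.hyps by (simp add: diffop_def)
  have J: "f \<beta>1 = 0" if \<beta>1: "\<beta>1 \<in> J" for \<beta>1
  proof -
    have "\<beta>1 \<noteq> \<beta>0" using \<beta>1 insert.hyps by auto
    \<comment> \<open>F has to separate only \<beta>1 from \<beta>0; it is chosen anew for each
      \<beta>1, so other constants may vanish.\<close>
    then obtain F \<phi> where F: "\<phi> \<beta>1 \<noteq> \<phi> \<beta>0" "\<And>\<gamma>. shift \<gamma> F = F + const_merom (\<phi> \<gamma>)"
      using separating_merom by metis
    have J: "(\<Sum>\<beta>\<in>J. f \<beta> * shift \<beta> h) = - (f \<beta>0 * shift \<beta>0 h)" for h
      using D[of h] by (simp only: eq_neg_iff_add_eq_0 add.commute)
    have "(\<Sum>\<beta>\<in>J. (f \<beta> * const_merom (\<phi> \<beta> - \<phi> \<beta>0)) * shift \<beta> g) = 0" for g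
    proof -
      have "(\<Sum>\<beta>\<in>J. (f \<beta> * const_merom (\<phi> \<beta> - \<phi> \<beta>0)) * shift \<beta> g) =
          (\<Sum>\<beta>\<in>J. f \<beta> * shift \<beta> (F * g) - (F + const_merom (\<phi> \<beta>0)) * (f \<beta> * shift \<beta> g))"
        by (intro sum.cong refl) (simp add: shift_mult F(2) const_merom_diff[symmetric] algebra_simps)
      also have "\<dots> = (\<Sum>\<beta>\<in>J. f \<beta> * shift \<beta> (F * g)) -
          (F + const_merom (\<phi> \<beta>0)) * (\<Sum>\<beta>\<in>J. f \<beta> * shift \<beta> g)"
        by (simp only: sum_subtractf sum_distrib_left)
      also have "\<dots> = 0"
        unfolding J by (simp add: shift_mult F(2) algebra_simps)
      finally show ?thesis .
    qed
    then have "f \<beta>1 * const_merom (\<phi> \<beta>1 - \<phi> \<beta>0) = 0"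
      by (intro insert.IH[of "\<lambda>\<beta>. f \<beta> * const_merom (\<phi> \<beta> - \<phi> \<beta>0)"] \<beta>1) (simp add: diffop_def)
    then show ?thesis by (rule const_merom_cancel) (use F in simp)
  qed
  then have "f \<beta>0 = 0" using D[of 1] by simp
  then show ?case using J insert.prems(2) by blast
qed simp

text \<open>The definite description is resolved by independence of shifts: in any presentation the
  coefficients other than that of - \<alpha> are zero.\<close>

lemma star_Dh_monomial:
  "star_Dh (\<lambda>g. f * shift (- \<alpha>) g) = (\<lambda>g. shift (conjV \<alpha>) (conj_merom f * g))"
  unfolding star_Dh_def
proof (rule the_equality)
  show "\<exists>I h. finite I \<and> (\<lambda>g. f * shift (- \<alpha>) g) = diffop I h \<and>
      (\<lambda>g. shift (conjV \<alpha>) (conj_merom f * g)) =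
      (\<lambda>g. \<Sum>\<beta>\<in>I. shift (- conjV \<beta>) (conj_merom (h \<beta>) * g))"
    by (intro exI[of _ "{- \<alpha>}"] exI[of _ "\<lambda>_. f"]) (simp add: diffop_def conjV_minus)
next
  fix E assume "\<exists>I h. finite I \<and> (\<lambda>g. f * shift (- \<alpha>) g) = diffop I h \<and>
      E = (\<lambda>g. \<Sum>\<beta>\<in>I. shift (- conjV \<beta>) (conj_merom (h \<beta>) * g))"
  then obtain I h where I: "finite I" "\<And>g. f * shift (- \<alpha>) g = diffop I h g"
    and E: "E = (\<lambda>g. \<Sum>\<beta>\<in>I. shift (- conjV \<beta>) (conj_merom (h \<beta>) * g))"
    by (metis (no_types, lifting))
  let ?J = "insert (- \<alpha>) I"
  let ?h = "\<lambda>\<beta>. if \<beta> \<in> I then h \<beta> else 0"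
  \<comment> \<open>The difference of the two presentations, padded with zeros to a common index
    set.\<close>
  have "diffop ?J (\<lambda>\<beta>. ?h \<beta> - (if \<beta> = - \<alpha> then f else 0)) = (\<lambda>_. 0)"
  proof
    fix g
    have "diffop ?J (\<lambda>\<beta>. ?h \<beta> - (if \<beta> = - \<alpha> then f else 0)) g =
        diffop ?J ?h g - diffop ?J (\<lambda>\<beta>. if \<beta> \<in> {- \<alpha>} then f else 0) g"
      by (simp add: diffop_def left_diff_distrib sum_subtractf)
    also have "diffop ?J ?h = diffop I h" using I(1) by (intro diffop_extend[symmetric]) auto
    also have "diffop ?J (\<lambda>\<beta>. if \<beta> \<in> {- \<alpha>} then f else 0) = diffop {- \<alpha>} (\<lambda>_. f)"
      using I(1) by (intro diffop_extend[symmetric]) auto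
    finally show "diffop ?J (\<lambda>\<beta>. ?h \<beta> - (if \<beta> = - \<alpha> then f else 0)) g = 0"
      using I(2)[of g] by (simp add: diffop_def)
  qed
  then have h: "?h \<beta> = (if \<beta> = - \<alpha> then f else 0)" if "\<beta> \<in> ?J" for \<beta>
    using diffop_independent[of ?J "\<lambda>\<beta>. ?h \<beta> - (if \<beta> = - \<alpha> then f else 0)" \<beta>] that I(1) by simp
  have "E g = shift (conjV \<alpha>) (conj_merom f * g)" for g
  proof -
    have "E g = (\<Sum>\<beta>\<in>?J. shift (- conjV \<beta>) (conj_merom (?h \<beta>) * g))"
      unfolding E using I(1) by (intro sum.mono_neutral_cong_left) auto
    also have "\<dots> = (\<Sum>\<beta>\<in>?J. if \<beta> = - \<alpha> then shift (conjV \<alpha>) (conj_merom f * g) else 0)"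
      by (intro sum.cong refl) (simp only: h, simp add: conjV_minus)
    also have "\<dots> = shift (conjV \<alpha>) (conj_merom f * g)" using I(1) by simp
    finally show ?thesis .
  qed
  then show "E = (\<lambda>g. shift (conjV \<alpha>) (conj_merom f * g))" by blast
qed

section \<open>Degrees of adjoints and the conjugated antipode\<close>

context h_algebra
begin

text \<open>Compare both ways of moving \<mu> F past the sum: the difference is the sum of the
  components multiplied by the constants \<phi> (deg q) - \<phi> \<alpha>, so each such product
  vanishes, and the constant at p is invertible. The parameter \<open>deg\<close> stands for the
  left or the right degree.\<close>

lemma weight_component_zero:
  assumes I: "finite I" "\<And>\<alpha> \<beta>. (\<alpha>, \<beta>) \<in> I \<Longrightarrow> w (\<alpha>, \<beta>) \<in> bigrade A \<alpha> \<beta>" 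
    and \<mu>: "moment_embedding A \<mu>"
    and deg: "\<And>q f. q \<in> I \<Longrightarrow> \<mu> f \<otimes> w q = w q \<otimes> \<mu> (shift (deg q) f)"
    and x: "\<And>f. \<mu> f \<otimes> (\<Oplus>q\<in>I. w q) = (\<Oplus>q\<in>I. w q) \<otimes> \<mu> (shift \<alpha> f)"
    and p: "p \<in> I" "deg p \<noteq> \<alpha>"
  shows "w p = \<zero>"
proof -
  have \<mu>in: "\<mu> f \<in> bigrade A 0 0" for f using \<mu> unfolding moment_embedding_def by blast
  note \<mu>c = bigrade_carrier[OF \<mu>in]
  have \<mu>h: "\<mu> (f + g) = \<mu> f \<oplus> \<mu> g" "\<mu> (f * g) = \<mu> f \<otimes> \<mu> g" "\<mu> 1 = \<one>" for f g
    using \<mu> unfolding moment_embedding_def by blast+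
  have w: "w q \<in> carrier A" if "q \<in> I" for q
    using I(2)[of "fst q" "snd q"] that bigrade_carrier by auto
  obtain F \<phi> where F: "\<phi> (deg p) \<noteq> \<phi> \<alpha>" "\<And>\<gamma>. shift \<gamma> F = F + const_merom (\<phi> \<gamma>)"
    using separating_merom[OF p(2)] by metis
  let ?v = "\<lambda>q. w q \<otimes> \<mu> (const_merom (\<phi> (deg q) - \<phi> \<alpha>))"
  let ?s = "(\<Oplus>q\<in>I. w q) \<otimes> \<mu> (shift \<alpha> F)"
  have "shift (deg q) F = shift \<alpha> F + const_merom (\<phi> (deg q) - \<phi> \<alpha>)" for q
    by (simp add: F(2) const_merom_diff[symmetric])
  then have v: "\<mu> F \<otimes> w q = w q \<otimes> \<mu> (shift \<alpha> F) \<oplus> ?v q" if "q \<in> I" for q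
    using deg[OF that] w[OF that] \<mu>c by (simp add: \<mu>h(1) r_distr)
  have "?s = (\<Oplus>q\<in>I. \<mu> F \<otimes> w q)"
    unfolding x[symmetric] using w \<mu>c by (intro finsum_rdistr[OF I(1)]) auto
  also have "\<dots> = (\<Oplus>q\<in>I. w q \<otimes> \<mu> (shift \<alpha> F) \<oplus> ?v q)"
    using w \<mu>c by (intro finsum_cong') (auto simp: v)
  also have "\<dots> = (\<Oplus>q\<in>I. w q \<otimes> \<mu> (shift \<alpha> F)) \<oplus> (\<Oplus>q\<in>I. ?v q)"
    using w \<mu>c by (intro finsum_addf) auto
  also have "(\<Oplus>q\<in>I. w q \<otimes> \<mu> (shift \<alpha> F)) = ?s"
    using w \<mu>c by (intro finsum_ldistr[OF I(1), symmetric]) auto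
  finally have s: "?s = ?s \<oplus> (\<Oplus>q\<in>I. ?v q)" .
  have "?s \<in> carrier A" "(\<Oplus>q\<in>I. ?v q) \<in> carrier A"
    using w \<mu>c by (auto intro!: finsum_closed m_closed)
  then have "(\<Oplus>q\<in>I. ?v q) = \<zero>" using s by (rule iffD1[OF add.l_cancel_one'])
  moreover have "?v (\<alpha>, \<beta>) \<in> bigrade A \<alpha> \<beta>" if "(\<alpha>, \<beta>) \<in> I" for \<alpha> \<beta>
    using bigrade_mult[OF I(2)[OF that] \<mu>in] by simp
  ultimately have "?v p = \<zero>"
    using p(1) by (intro bigrade_independent[of I ?v p] I(1)) auto
  moreover have "w p = ?v p \<otimes> \<mu> (const_merom (inverse (\<phi> (deg p) - \<phi> \<alpha>)))"
    using F(1) w[OF p(1)] \<mu>c by (simp add: m_assoc \<mu>h(2)[symmetric] \<mu>h(3) const_merom_mult const_merom_1)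
  ultimately show ?thesis using \<mu>c by simp
qed

text \<open>Converse to the commutation relations: a component of another bidegree differs in its
  left or its right degree, and \<open>weight_component_zero\<close> removes it.\<close>

lemma bigradeI:
  assumes x: "x \<in> carrier A" and l: "\<And>f. mom_l A f \<otimes> x = x \<otimes> mom_l A (shift \<alpha> f)"
    and r: "\<And>f. mom_r A f \<otimes> x = x \<otimes> mom_r A (shift \<beta> f)"
  shows "x \<in> bigrade A \<alpha> \<beta>"
proof -
  obtain I w where I: "finite I" "\<And>\<alpha> \<beta>. (\<alpha>, \<beta>) \<in> I \<Longrightarrow> w (\<alpha>, \<beta>) \<in> bigrade A \<alpha> \<beta>" and xw: "x = (\<Oplus>p\<in>I. w p)"
    using bigrade_span[OF x] by blast
  have Iq: "w q \<in> bigrade A (fst q) (snd q)" if "q \<in> I" for q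
    using I(2)[of "fst q" "snd q"] that by simp
  have "w q \<in> bigrade A \<alpha> \<beta>" if q: "q \<in> I" for q
  proof (cases "q = (\<alpha>, \<beta>)")
    case True
    then show ?thesis using I(2) q by blast
  next
    case False
    then consider "fst q \<noteq> \<alpha>" | "snd q \<noteq> \<beta>" by (cases q) auto
    then have "w q = \<zero>"
    proof cases
      case 1
      show ?thesis
        by (rule weight_component_zero[OF I mom_l_embedding mom_l_shift[OF Iq] l[unfolded xw] q 1])
    next
      case 2
      show ?thesis
        by (rule weight_component_zero[OF I mom_r_embedding mom_r_shift[OF Iq] r[unfolded xw] q 2])
    qed
    then show ?thesis by (simp add: bigrade_zero)
  qed
  with I(1) have "(\<Oplus>p\<in>I. w p) \<in> bigrade A \<alpha> \<beta>"
  proof (induction I rule: finite_induct)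
    case (insert p I)
    have "w p \<in> bigrade A \<alpha> \<beta>" "(\<Oplus>p\<in>I. w p) \<in> bigrade A \<alpha> \<beta>" "w \<in> I \<rightarrow> carrier A"
      using insert.IH insert.prems bigrade_carrier by blast+
    then show ?case using insert.hyps by (simp add: bigrade_add bigrade_carrier)
  qed (simp add: bigrade_zero)
  then show ?thesis unfolding xw .
qed

end

section \<open>Adjoints in the tensor product\<close>

context h_star_algebra
begin

lemma star_in: "x \<in> carrier A \<Longrightarrow> star x \<in> carrier A"
  using star_closed by blast

lemma star_hom: "star \<in> hom (add_monoid A) (add_monoid A)"
  by (rule homI) (simp_all add: star_in star_add)

text \<open>Applying star reverses the commutation relations, which negates degrees, while
  conjugation of functions conjugates the shifts.\<close>

lemma star_bigrade:
  assumes x: "x \<in> bigrade A \<alpha> \<beta>" shows "star x \<in> bigrade A (- conjV \<alpha>) (- conjV \<beta>)"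
proof (rule bigradeI)
  note xc = bigrade_carrier[OF x]
  show "star x \<in> carrier A" using xc by (rule star_in)
  fix f
  have "mom_l A f \<otimes> star x = star (x \<otimes> mom_l A (conj_merom f))"
    using xc by (simp add: star_mult star_mom_l)
  also have "\<dots> = star x \<otimes> mom_l A (shift (- conjV \<alpha>) f)"
    unfolding mom_l_shift_right[OF x]
    using xc by (simp add: star_mult star_mom_l conj_shift conjV_minus)
  finally show "mom_l A f \<otimes> star x = star x \<otimes> mom_l A (shift (- conjV \<alpha>) f)" .
  have "mom_r A f \<otimes> star x = star (x \<otimes> mom_r A (conj_merom f))"
    using xc by (simp add: star_mult star_mom_r)
  also have "\<dots> = star x \<otimes> mom_r A (shift (- conjV \<beta>) f)"
    unfolding mom_r_shift_right[OF x]
    using xc by (simp add: star_mult star_mom_r conj_shift conjV_minus)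
  finally show "mom_r A f \<otimes> star x = star x \<otimes> mom_r A (shift (- conjV \<beta>) f)" .
qed

end

context h_star_bialgebroid
begin

text \<open>After star the moment maps stand on the right. Bringing them back to the left shifts
  both by the same conjugated inner degree.\<close>

lemma balanced_star: "balanced A A AA.Q (\<lambda>(a, b). AA.t (star a) (star b))"
proof (rule balancedI; simp only: prod.case)
  note t = balancedD[OF AA.pure_balanced, simplified prod.case]
  fix \<alpha> \<beta> \<gamma> a b assume a: "a \<in> bigrade A \<alpha> \<gamma>" and b: "b \<in> bigrade A \<gamma> \<beta>"
  note c = bigrade_carrier[OF a] bigrade_carrier[OF b]
  note s = star_bigrade[OF a] star_bigrade[OF b]
  show "AA.t (star (a \<oplus> a')) (star b) = AA.t (star a) (star b) \<otimes>\<^bsub>AA.Q\<^esub> AA.t (star a') (star b)"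
    if "a' \<in> bigrade A \<alpha> \<gamma>" for a'
    unfolding star_add[OF c(1) bigrade_carrier[OF that]] by (rule t(2)[OF s star_bigrade[OF that]])
  show "AA.t (star a) (star (b \<oplus> b')) = AA.t (star a) (star b) \<otimes>\<^bsub>AA.Q\<^esub> AA.t (star a) (star b')"
    if "b' \<in> bigrade A \<gamma> \<beta>" for b'
    unfolding star_add[OF c(2) bigrade_carrier[OF that]] by (rule t(3)[OF s star_bigrade[OF that]])
  show "AA.t (star (mom_r A f \<otimes> a)) (star b) = AA.t (star a) (star (mom_l A f \<otimes> b))" for f
    unfolding star_mult[OF mom_r_closed c(1)] star_mult[OF mom_l_closed c(2)] star_mom_l star_mom_r
      mom_r_shift_right[OF s(1)] mom_l_shift_right[OF s(2)]
    by (rule t(4)[OF s])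
qed (rule AA.pure_closed)

text \<open>The adjoint of a monomial puts the shift in front of the coefficient; this produces the
  shift by \<alpha> that appears in the left antipode axiom. Off the diagonal both sides are
  zero.\<close>

lemma counit_star:
  assumes "b \<in> bigrade A \<alpha> \<beta>"
  shows "conj_merom (\<epsilon> (star b) 1) = shift \<alpha> (\<epsilon> b 1)"
proof -
  have "\<epsilon> (star b) = star_Dh (\<lambda>g. \<epsilon> b 1 * shift (- \<beta>) g)"
    using star_counit[OF bigrade_carrier[OF assms]] counit_eq(1)[OF assms] by simp
  then have "conj_merom (\<epsilon> (star b) 1) = shift \<beta> (\<epsilon> b 1)"
    unfolding star_Dh_monomial by (simp add: conj_shift conjV_conjV)
  then show ?thesis using counit_eq(2)[OF assms] by (cases "\<alpha> = \<beta>") auto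
qed

end

section \<open>Comparison of the antipode with its conjugated inverse\<close>

locale h_star_hopf_algebroid = h_hopf_algebroid A \<Delta> \<epsilon> S + h_star_bialgebroid A \<Delta> \<epsilon> star
  for A :: "('v::complex_fd_space_conj, 'a) halg" (structure) and \<Delta> \<epsilon> S star +
  assumes antipode_bij: "bij_betw S (carrier A) (carrier A)"
begin

definition antipode_inv where "antipode_inv = inv_into (carrier A) S"

lemma antipode_inv_in: "x \<in> carrier A \<Longrightarrow> antipode_inv x \<in> carrier A"
  using antipode_bij bij_betw_imp_surj_on unfolding antipode_inv_def by (metis inv_into_into)

lemma antipode_antipode_inv: "x \<in> carrier A \<Longrightarrow> S (antipode_inv x) = x"
  using antipode_bij unfolding antipode_inv_def by (rule bij_betw_inv_into_right)

lemma antipode_inv_eqI: "y \<in> carrier A \<Longrightarrow> S y = x \<Longrightarrow> antipode_inv x = y"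
  using bij_betw_inv_into_left[OF antipode_bij] unfolding antipode_inv_def by blast

lemma antipode_inv_hom: "antipode_inv \<in> hom (add_monoid A) (add_monoid A)"
  by (rule homI)
    (auto simp: antipode_inv_in antipode_antipode_inv antipode_add intro!: antipode_inv_eqI)

text \<open>Composing S with star, S and star gives the identity exactly when S equals this
  map.\<close>

definition conj_antipode where "conj_antipode = (\<lambda>x. star (antipode_inv (star x)))"

text \<open>Uses antimultiplicativity: the axioms control S when a left moment map stands on the
  right of its argument, while here it stands on the left of a possibly inhomogeneous
  element.\<close>

lemma mom_twisted_conj_antipode: "mom_twisted conj_antipode"
  unfolding mom_twisted_def
proof (intro conjI ballI allI)
  show "conj_antipode \<in> hom (add_monoid A) (add_monoid A)"
    using hom_compose[OF star_hom hom_compose[OF antipode_inv_hom star_hom]]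
    unfolding conj_antipode_def by (simp only: o_def)
  fix x f assume x: "x \<in> carrier A"
  have "antipode_inv (star (mom_r A f \<otimes> x)) = mom_l A (conj_merom f) \<otimes> antipode_inv (star x)"
    using x by (intro antipode_inv_eqI)
      (simp_all add: star_in antipode_inv_in antipode_mult antipode_antipode_inv antipode_mom star_mult star_mom_r)
  then show "conj_antipode (mom_r A f \<otimes> x) = conj_antipode x \<otimes> mom_l A f"
    using x by (simp add: conj_antipode_def star_in antipode_inv_in star_mult star_mom_l)
qed

lemma sweedler_conj_antipode:
  assumes b: "b \<in> bigrade A \<alpha> \<beta>"
  shows "sweedler (\<lambda>(x, y). conj_antipode x \<otimes> y) b = mom_r A (shift \<alpha> (\<epsilon> b 1))"
proof -
  note bc = bigrade_carrier[OF b]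
  note tm = tensor_map_hom[OF AA.tensor_pair_axioms AA.tensor_pair_axioms balanced_star]
  note bal = balanced_mom_twisted[OF mom_twisted_conj_antipode]
  have "sweedler (\<lambda>(x, y). conj_antipode x \<otimes> y) b =
      star (antipode_inv (mult_antipode (tensor_map A A star star (\<Delta> b))))"
  proof (rule AA.hom_eqI[OF add.is_group AA.lift_hom[OF a_comm_group bal]
        hom_compose[OF tm(1) hom_compose[OF mult_antipode_hom hom_compose[OF antipode_inv_hom star_hom]], unfolded o_def]
        _ comult_closed[OF bc]])
    fix \<alpha> \<beta> \<gamma> x y assume x: "x \<in> bigrade A \<alpha> \<gamma>" and y: "y \<in> bigrade A \<gamma> \<beta>"
    note xy = bigrade_carrier[OF x] bigrade_carrier[OF y]
    \<comment> \<open>Applying S to the right-hand side reverses its factors and cancels the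
      inverse.\<close>
    have "antipode_inv (star x \<otimes> S (star y)) = star y \<otimes> antipode_inv (star x)"
      using xy by (intro antipode_inv_eqI) (simp_all add: star_in antipode_inv_in antipode_mult antipode_antipode_inv)
    then show "tensor_lift (add_monoid A) (\<lambda>(x, y). conj_antipode x \<otimes> y) (AA.t x y) =
        star (antipode_inv (mult_antipode (tensor_map A A star star (AA.t x y))))"
      unfolding AA.lift_pure[OF a_comm_group bal x y] tm(2)[OF x y]
        mult_antipode_pure[OF star_bigrade[OF x] star_bigrade[OF y]]
      using xy by (simp add: conj_antipode_def star_mult star_in antipode_inv_in star_star)
  qed
  also have "tensor_map A A star star (\<Delta> b) = \<Delta> (star b)" by (rule star_comult[OF bc])
  also have "mult_antipode (\<Delta> (star b)) = mom_l A (\<epsilon> (star b) 1)"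
    unfolding mult_antipode_def by (rule antipode_right[OF star_in[OF bc]])
  \<comment> \<open>S exchanges the two moment maps, so its inverse turns the value of the right
    axiom into a right moment map.\<close>
  also have "antipode_inv \<dots> = mom_r A (\<epsilon> (star b) 1)"
    by (rule antipode_inv_eqI) (simp_all add: antipode_mom)
  also have "star \<dots> = mom_r A (shift \<alpha> (\<epsilon> b 1))"
    unfolding star_mom_r counit_star[OF b] ..
  finally show ?thesis .
qed

lemma antipode_eq_conj_antipode: "a \<in> carrier A \<Longrightarrow> S a = conj_antipode a"
  by (rule convolution_cancel[OF mom_twisted_antipode mom_twisted_conj_antipode])
    (simp_all only: sweedler_conj_antipode antipode_left)

text \<open>Only the inner S is rewritten; the two stars that become adjacent cancel, and the outer
  S meets its inverse.\<close>

lemma antipode_star_antipode_star: "a \<in> carrier A \<Longrightarrow> S (star (S (star a))) = a"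
  by (simp add: antipode_eq_conj_antipode[of "star a"] conj_antipode_def star_in star_star
      antipode_inv_in antipode_antipode_inv)

end

theorem lemma2p9:
  fixes A :: "('v::complex_fd_space_conj, 'a) halg"
    and \<Delta> :: "'a \<Rightarrow> ('a \<times> 'a \<Rightarrow>\<^sub>0 int) set"
    and \<epsilon> :: "'a \<Rightarrow> 'v merom \<Rightarrow> 'v merom"
    and S star :: "'a \<Rightarrow> 'a"
  assumes "h_hopf_algebroid A \<Delta> \<epsilon> S"
    and "h_star_bialgebroid A \<Delta> \<epsilon> star"
    and "bij_betw S (carrier A) (carrier A)"
  shows "\<forall>a\<in>carrier A. (S \<circ> star \<circ> S \<circ> star) a = a"
proof -
  interpret h_star_hopf_algebroid A \<Delta> \<epsilon> S star
    using assms by (simp add: h_star_hopf_algebroid_def h_star_hopf_algebroid_axioms_def)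
  show ?thesis by (simp add: antipode_star_antipode_star)
qed

end
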